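(* Let $d\in\mathbb{N}$, $d\ge 1$, $p\in(1,\infty)$ and $m>0$ satisfy $m(p-1)>1$ and $dp>d+1$. Let $o\in\mathbb{R}^d$ and $r^o(y):=|y-o|$. For every $x\in\mathbb{R}^d$ and every probabilistically weak solution $X$ (as defined in the context) starting at $x$, on a stochastic basis $(\Omega,\mathscr{F},\mathscr{F}_\bullet,\mathbf{P}^x)$, the radial process $r^o\circ X=(|X_t-o|)_{t\ge0}$ is a semimartingale under $\mathbf{P}^x$.
   Context: Parameters: $\beta:=p+d(m(p-1)-1)$, $\gamma:=\frac{p-1}{m(p-1)-1}$, $\kappa:=\frac{m(p-1)-1}{mp}\beta^{-1/(p-1)}$, all positive. $\omega_{d-1}$ is the area of the unit sphere in $\mathbb{R}^d$ ($\omega_0=2$). Barenblatt profile: for $t>0$, $r\ge 0$, $S(t,r):=C-\kappa[t^{-1/\beta}r]^{p/(p-1)}$ and $U(t,r):=t^{-d/\beta}\,\max\{S(t,r),0\}^\gamma$, where $C>0$ is the unique constant (depending only on $d,p,m$) such that $\omega_{d-1}\int_0^\infty U(t,r)r^{d-1}\,\mathrm{d}r=1$ for every $t>0$. Put $\rho:=(C/\kappa)^{(p-1)/p}$; the support of $U(t,\cdot)$ is $[0,\rho t^{1/\beta}]$. The Barenblatt solution is $w^x(t,y):=U(t,|y-x|)$. Coefficients: for $0<r<\rho t^{1/\beta}$ let $a(t,r):=m^{p-1}|\partial_rU(t,r)|^{p-2}U(t,r)^{(m-1)(p-1)}$ and $a_r:=\partial_r a$; set $a(t,r):=a_r(t,r):=0$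 for $r\ge\rho t^{1/\beta}$ and for $r=0$. For $z\in\mathbb{R}^d$, $\mathrm{sgn}\,z:=z/|z|$ if $z\ne0$, $\mathrm{sgn}\,0:=0$. A stochastic basis is a complete probability space $(\Omega,\mathscr{F},\mathbf{P}^x)$ with a right-continuous filtration $\mathscr{F}_\bullet$ augmented by null sets; $\mathbf{E}^x$ denotes expectation. A probabilistically weak solution starting at $x\in\mathbb{R}^d$ is a continuous $\mathscr{F}_\bullet$-adapted $\mathbb{R}^d$-valued process $X$ on a stochastic basis carrying a standard $d$-dimensional $\mathscr{F}_\bullet$-Brownian motion $W$ such that (a) $\mathbf{E}^x[\int_0^t a(s,|X_s-x|)\,\mathrm{d}s]<\infty$ and $\mathbf{E}^x[\int_0^t|a_r(s,|X_s-x|)|\,\mathrm{d}s]<\infty$ for every $t>0$; (b) $\mathbf{P}^x$-a.s., for all $t\ge0$, $X_t=X_0+\int_0^t\sqrt{2a(s,|X_s-x|)}\,\mathrm{d}W_s+\int_0^t a_r(s,|X_s-x|)\,\mathrm{sgn}(X_s-x)\,\mathrm{d}s$; (c) for every $t>0$ the law of $X_t$ is $w^x(t,\cdot)\,\mathscr{L}^d$ ($\mathscr{L}^d$ Lebesgue measure); consequently $X_0=x$ a.s. *)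

theory Defs
  imports "HOL-Probability.Probability"
begin

section \<open>The Barenblatt solution and its coefficients\<close>

definition bb_beta :: "nat \<Rightarrow> real \<Rightarrow> real \<Rightarrow> real" where
  "bb_beta d p m = p + real d * (m * (p - 1) - 1)"

definition bb_gamma :: "real \<Rightarrow> real \<Rightarrow> real" where
  "bb_gamma p m = (p - 1) / (m * (p - 1) - 1)"

definition bb_kappa :: "nat \<Rightarrow> real \<Rightarrow> real \<Rightarrow> real" where
  "bb_kappa d p m = (m * (p - 1) - 1) / (m * p) * bb_beta d p m powr (- 1 / (p - 1))"

text \<open>Surface area \<open>\<omega>\<^bsub>d-1\<^esub>\<close> of the unit sphere of the \<open>d\<close>-dimensional Euclidean space,
  expressed through the volume of the unit ball.\<close>

definition sphere_area :: "nat \<Rightarrow> real" where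
  "sphere_area d = real d * unit_ball_vol (real d)"

lemma sphere_area_1: "sphere_area 1 = 2"
  by (simp add: sphere_area_def)

lemma sphere_area_Gamma:
  assumes "d \<ge> 1"
  shows "sphere_area d = 2 * pi powr (real d / 2) / Gamma (real d / 2)"
proof -
  have rec: "Gamma (real d / 2 + 1) = real d / 2 * Gamma (real d / 2)"
    using assms by (intro Gamma_plus1) (auto elim!: nonpos_Ints_cases)
  have "Gamma (real d / 2) > 0"
    using assms by (intro Gamma_real_pos) auto
  then show ?thesis
    unfolding sphere_area_def unit_ball_vol_def rec using assms by (simp add: field_simps)
qed

definition bb_profile :: "nat \<Rightarrow> real \<Rightarrow> real \<Rightarrow> real \<Rightarrow> real \<Rightarrow> real \<Rightarrow> real" where
  "bb_profile d p m C t r =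
     (let S = C - bb_kappa d p m * (t powr (- 1 / bb_beta d p m) * r) powr (p / (p - 1))
      in t powr (- real d / bb_beta d p m) * max S 0 powr bb_gamma p m)"

definition bb_C :: "nat \<Rightarrow> real \<Rightarrow> real \<Rightarrow> real" where
  "bb_C d p m = (THE C. C > 0 \<and>
     (\<forall>t>0. sphere_area d * (LBINT r:{0..}. bb_profile d p m C t r * r ^ (d - 1)) = 1))"

definition bb_U :: "nat \<Rightarrow> real \<Rightarrow> real \<Rightarrow> real \<Rightarrow> real \<Rightarrow> real" where
  "bb_U d p m = bb_profile d p m (bb_C d p m)"

definition bb_rho :: "nat \<Rightarrow> real \<Rightarrow> real \<Rightarrow> real" where
  "bb_rho d p m = (bb_C d p m / bb_kappa d p m) powr ((p - 1) / p)"

definition barenblatt ::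
  "real \<Rightarrow> real \<Rightarrow> 'a::euclidean_space \<Rightarrow> real \<Rightarrow> 'a \<Rightarrow> real" where
  "barenblatt p m x t y = bb_U DIM('a) p m t (norm (y - x))"

definition bb_a :: "nat \<Rightarrow> real \<Rightarrow> real \<Rightarrow> real \<Rightarrow> real \<Rightarrow> real" where
  "bb_a d p m t r =
     (if 0 < r \<and> r < bb_rho d p m * t powr (1 / bb_beta d p m)
      then m powr (p - 1) * \<bar>deriv (bb_U d p m t) r\<bar> powr (p - 2)
             * bb_U d p m t r powr ((m - 1) * (p - 1))
      else 0)"

definition bb_ar :: "nat \<Rightarrow> real \<Rightarrow> real \<Rightarrow> real \<Rightarrow> real \<Rightarrow> real" where
  "bb_ar d p m t r =
     (if 0 < r \<and> r < bb_rho d p m * t powr (1 / bb_beta d p m)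
      then deriv (bb_a d p m t) r else 0)"

section \<open>Stochastic bases and processes\<close>

text \<open>Time is \<open>[0,\<infinity>)\<close>. Filtrations and processes are indexed by type \<open>real\<close> so that the
  library's \<open>filtration\<close> and \<open>stopping_time\<close> apply; the \<open>\<sigma>\<close>-algebras at negative times are an
  arbitrary monotone extension and processes are only looked at for times \<open>\<ge> 0\<close>.\<close>

locale stochastic_basis = prob_space M + complete_measure M + filtration "space M" F
  for M :: "'w measure" and F :: "real \<Rightarrow> 'w measure" +
  assumes sets_F_subset: "t \<ge> 0 \<Longrightarrow> sets (F t) \<subseteq> sets M"
    and right_continuous: "t \<ge> 0 \<Longrightarrow> sets (F t) = (\<Inter>s\<in>{t<..}. sets (F s))"
    and augmented: "null_sets M \<subseteq> sets (F 0)"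

definition adapted :: "(real \<Rightarrow> 'w measure) \<Rightarrow> (real \<Rightarrow> 'w \<Rightarrow> 'b::topological_space) \<Rightarrow> bool" where
  "adapted F Y \<longleftrightarrow> (\<forall>t\<ge>0. Y t \<in> borel_measurable (F t))"

definition continuous_process ::
  "'w measure \<Rightarrow> (real \<Rightarrow> 'w \<Rightarrow> 'b::topological_space) \<Rightarrow> bool" where
  "continuous_process M Y \<longleftrightarrow> (\<forall>\<omega>\<in>space M. continuous_on {0..} (\<lambda>t. Y t \<omega>))"

definition cadlag_process :: "'w measure \<Rightarrow> (real \<Rightarrow> 'w \<Rightarrow> real) \<Rightarrow> bool" where
  "cadlag_process M Y \<longleftrightarrow>
     (\<forall>\<omega>\<in>space M. \<forall>t\<ge>0. ((\<lambda>s. Y s \<omega>) \<longlongrightarrow> Y t \<omega>) (at_right t) \<and>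
        (t > 0 \<longrightarrow> (\<exists>l. ((\<lambda>s. Y s \<omega>) \<longlongrightarrow> l) (at_left t))))"

definition progressive :: "(real \<Rightarrow> 'w measure) \<Rightarrow> (real \<Rightarrow> 'w \<Rightarrow> real) \<Rightarrow> bool" where
  "progressive F H \<longleftrightarrow>
     (\<forall>t\<ge>0. (\<lambda>(s, \<omega>). H s \<omega>) \<in> borel_measurable (restrict_space borel {0..t} \<Otimes>\<^sub>M F t))"

section \<open>Semimartingales\<close>

definition martingale ::
  "'w measure \<Rightarrow> (real \<Rightarrow> 'w measure) \<Rightarrow> (real \<Rightarrow> 'w \<Rightarrow> real) \<Rightarrow> bool" where
  "martingale M F N \<longleftrightarrow> adapted F N \<and> (\<forall>t\<ge>0. integrable M (N t)) \<and>
     (\<forall>s\<ge>0. \<forall>t\<ge>s. AE \<omega> in M. real_cond_exp M (F s) (N t) \<omega> = N s \<omega>)"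

text \<open>Localizing sequences consist of finite stopping times, which is no restriction: a
  localizing sequence \<open>\<tau>\<^sub>n\<close> with values in \<open>[0,\<infinity>]\<close> may be replaced by \<open>min \<tau>\<^sub>n n\<close>.\<close>

definition local_martingale ::
  "'w measure \<Rightarrow> (real \<Rightarrow> 'w measure) \<Rightarrow> (real \<Rightarrow> 'w \<Rightarrow> real) \<Rightarrow> bool" where
  "local_martingale M F N \<longleftrightarrow> adapted F N \<and> cadlag_process M N \<and>
     (\<exists>\<tau> :: nat \<Rightarrow> 'w \<Rightarrow> real.
        (\<forall>n. stopping_time F (\<tau> n)) \<and>
        (\<forall>n. \<forall>\<omega>\<in>space M. 0 \<le> \<tau> n \<omega> \<and> \<tau> n \<omega> \<le> \<tau> (Suc n) \<omega>) \<and>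
        (AE \<omega> in M. filterlim (\<lambda>n. \<tau> n \<omega>) at_top sequentially) \<and>
        (\<forall>n. martingale M F (\<lambda>t \<omega>. N (min t (\<tau> n \<omega>)) \<omega> - N 0 \<omega>)))"

definition locally_finite_variation :: "(real \<Rightarrow> real) \<Rightarrow> bool" where
  "locally_finite_variation g \<longleftrightarrow>
     (\<forall>T\<ge>0. \<exists>B. \<forall>k (\<sigma> :: nat \<Rightarrow> real). mono \<sigma> \<and> range \<sigma> \<subseteq> {0..T} \<longrightarrow>
        (\<Sum>i<k. \<bar>g (\<sigma> (Suc i)) - g (\<sigma> i)\<bar>) \<le> B)"

definition semimartingale ::
  "'w measure \<Rightarrow> (real \<Rightarrow> 'w measure) \<Rightarrow> (real \<Rightarrow> 'w \<Rightarrow> real) \<Rightarrow> bool" where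
  "semimartingale M F Y \<longleftrightarrow> adapted F Y \<and> cadlag_process M Y \<and>
     (\<exists>N A. local_martingale M F N \<and> adapted F A \<and> cadlag_process M A \<and>
        (\<forall>\<omega>\<in>space M. locally_finite_variation (\<lambda>t. A t \<omega>)) \<and>
        (\<forall>\<omega>\<in>space M. N 0 \<omega> = 0 \<and> A 0 \<omega> = 0) \<and>
        (AE \<omega> in M. \<forall>t\<ge>0. Y t \<omega> = Y 0 \<omega> + N t \<omega> + A t \<omega>))"

section \<open>Brownian motion and the It\^o integral\<close>

text \<open>The density below is that of the centred Gaussian law with covariance matrix
  \<open>(t - s)\<close> times the identity; \<open>normal_density\<close> takes the standard deviation, not the variance.\<close>

definition brownian_motion ::
  "'w measure \<Rightarrow> (real \<Rightarrow> 'w measure) \<Rightarrow> (real \<Rightarrow> 'w \<Rightarrow> 'a::euclidean_space) \<Rightarrow> bool" where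
  "brownian_motion M F W \<longleftrightarrow> adapted F W \<and> continuous_process M W \<and>
     (AE \<omega> in M. W 0 \<omega> = 0) \<and>
     (\<forall>s\<ge>0. \<forall>t>s.
        distr M borel (\<lambda>\<omega>. W t \<omega> - W s \<omega>) =
          density lborel (\<lambda>y. ennreal (\<Prod>b\<in>Basis. normal_density 0 (sqrt (t - s)) (y \<bullet> b))) \<and>
        prob_space.indep_set M (sets (F s))
          {(\<lambda>\<omega>. W t \<omega> - W s \<omega>) -` B \<inter> space M | B. B \<in> sets borel})"

text \<open>A simple process is given by its number of steps \<open>k\<close>, its grid \<open>\<tau> 0 \<le> \<dots> \<le> \<tau> k\<close> and its
  values \<open>\<xi> i\<close> on \<open>(\<tau> i, \<tau> (i + 1)]\<close>.\<close>

definition simple_data ::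
  "'w measure \<Rightarrow> (real \<Rightarrow> 'w measure) \<Rightarrow> nat \<Rightarrow> (nat \<Rightarrow> real) \<Rightarrow> (nat \<Rightarrow> 'w \<Rightarrow> real) \<Rightarrow> bool" where
  "simple_data M F k \<tau> \<xi> \<longleftrightarrow> 0 \<le> \<tau> 0 \<and> (\<forall>i<k. \<tau> i \<le> \<tau> (Suc i)) \<and>
     (\<forall>i<k. \<xi> i \<in> borel_measurable (F (\<tau> i)) \<and> (\<exists>B. \<forall>\<omega>\<in>space M. \<bar>\<xi> i \<omega>\<bar> \<le> B))"

definition simple_process ::
  "nat \<Rightarrow> (nat \<Rightarrow> real) \<Rightarrow> (nat \<Rightarrow> 'w \<Rightarrow> real) \<Rightarrow> real \<Rightarrow> 'w \<Rightarrow> real" where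
  "simple_process k \<tau> \<xi> s \<omega> = (\<Sum>i<k. \<xi> i \<omega> * indicator {\<tau> i<..\<tau> (Suc i)} s)"

definition simple_integral ::
  "(real \<Rightarrow> 'w \<Rightarrow> 'a::euclidean_space) \<Rightarrow> nat \<Rightarrow> (nat \<Rightarrow> real) \<Rightarrow> (nat \<Rightarrow> 'w \<Rightarrow> real)
     \<Rightarrow> real \<Rightarrow> 'w \<Rightarrow> 'a" where
  "simple_integral W k \<tau> \<xi> t \<omega> =
     (\<Sum>i<k. \<xi> i \<omega> *\<^sub>R (W (min t (\<tau> (Suc i))) \<omega> - W (min t (\<tau> i)) \<omega>))"

text \<open>\<open>I\<close> is (a continuous version of) the It\^o integral process of the scalar integrand \<open>H\<close>
  against the vector-valued Brownian motion \<open>W\<close>, in the standard \<open>L\<^sup>2\<close> sense: \<open>H\<close> is progressive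
  with \<open>\<integral>\<^sub>0\<^sup>t H\<^sub>s\<^sup>2 ds\<close> of finite expectation for all \<open>t\<close>, and \<open>I\<close> is the \<open>L\<^sup>2\<close> limit of the integrals
  of simple processes approximating \<open>H\<close>. By the It\^o isometry \<open>I\<close> is unique up to
  indistinguishability.\<close>

definition ito_integral ::
  "'w measure \<Rightarrow> (real \<Rightarrow> 'w measure) \<Rightarrow> (real \<Rightarrow> 'w \<Rightarrow> 'a::euclidean_space)
     \<Rightarrow> (real \<Rightarrow> 'w \<Rightarrow> real) \<Rightarrow> (real \<Rightarrow> 'w \<Rightarrow> 'a) \<Rightarrow> bool" where
  "ito_integral M F W H I \<longleftrightarrow>
     progressive F H \<and>
     (\<forall>t\<ge>0. (\<integral>\<^sup>+\<omega>. (\<integral>\<^sup>+s\<in>{0..t}. ennreal ((H s \<omega>)\<^sup>2) \<partial>lborel) \<partial>M) < \<infinity>) \<and>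
     adapted F I \<and> continuous_process M I \<and>
     (\<exists>k \<tau> \<xi>. (\<forall>n :: nat. simple_data M F (k n) (\<tau> n) (\<xi> n)) \<and>
        (\<forall>t\<ge>0. (\<lambda>n. \<integral>\<^sup>+\<omega>. (\<integral>\<^sup>+s\<in>{0..t}.
             ennreal ((simple_process (k n) (\<tau> n) (\<xi> n) s \<omega> - H s \<omega>)\<^sup>2) \<partial>lborel) \<partial>M)
           \<longlonglongrightarrow> 0) \<and>
        (\<forall>t\<ge>0. (\<lambda>n. \<integral>\<^sup>+\<omega>.
             ennreal ((norm (simple_integral W (k n) (\<tau> n) (\<xi> n) t \<omega> - I t \<omega>))\<^sup>2) \<partial>M)
           \<longlonglongrightarrow> 0))"

section \<open>Probabilistically weak solutions\<close>

definition weak_solution ::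
  "real \<Rightarrow> real \<Rightarrow> 'a::euclidean_space \<Rightarrow> 'w measure \<Rightarrow> (real \<Rightarrow> 'w measure)
     \<Rightarrow> (real \<Rightarrow> 'w \<Rightarrow> 'a) \<Rightarrow> bool" where
  "weak_solution p m x M F X \<longleftrightarrow>
     stochastic_basis M F \<and> adapted F X \<and> continuous_process M X \<and>
     (\<exists>W :: real \<Rightarrow> 'w \<Rightarrow> 'a. brownian_motion M F W \<and>
        (\<forall>t>0. (\<integral>\<^sup>+\<omega>. (\<integral>\<^sup>+s\<in>{0..t}.
             ennreal (bb_a DIM('a) p m s (norm (X s \<omega> - x))) \<partial>lborel) \<partial>M) < \<infinity>) \<and>
        (\<forall>t>0. (\<integral>\<^sup>+\<omega>. (\<integral>\<^sup>+s\<in>{0..t}.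
             ennreal \<bar>bb_ar DIM('a) p m s (norm (X s \<omega> - x))\<bar> \<partial>lborel) \<partial>M) < \<infinity>) \<and>
        (\<exists>I. ito_integral M F W (\<lambda>s \<omega>. sqrt (2 * bb_a DIM('a) p m s (norm (X s \<omega> - x)))) I \<and>
           (AE \<omega> in M. \<forall>t\<ge>0.
              X t \<omega> = X 0 \<omega> + I t \<omega> +
                (LBINT s:{0..t}. bb_ar DIM('a) p m s (norm (X s \<omega> - x)) *\<^sub>R sgn (X s \<omega> - x))))) \<and>
     (\<forall>t>0. distr M borel (X t) = density lborel (\<lambda>y. ennreal (barenblatt p m x t y)))"

end

theory Submission
  imports Defs
begin

text \<open>
  Neither the Ito formula nor the Doob-Meyer theorem is used. Write \<open>X = X\<^sub>0 + I + V\<close> with the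
  martingale part \<open>I\<close> and the drift \<open>V\<close>, whose variation on \<open>[0, t]\<close> is at most
  \<open>A\<^sub>t = \<integral>\<^sub>0\<^sup>t \<bar>a\<^sub>r\<bar> ds\<close>, and put \<open>Y = \<bar>X - q\<bar> + A\<close>. The subgradient inequality for the norm gives
  \<open>Y\<^sub>t - Y\<^sub>s \<ge> sgn (X\<^sub>s - q) \<bullet> (I\<^sub>t - I\<^sub>s)\<close>, so if \<open>N\<close> is the martingale obtained by summing the right-hand
  side over the dyadic grid of mesh \<open>2\<^sup>-\<^sup>n\<close>, then \<open>Y - N\<close> increases along that grid and the second
  moments of \<open>N\<close> are bounded by those of \<open>I\<close>. The martingales with these two properties form
  convex sets that shrink with \<open>n\<close>; by the parallelogram identity, almost minimisers of a weighted
  square norm over these sets converge, to a martingale \<open>L\<close> for which \<open>Y - L\<close> increases along all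
  dyadic numbers. The right limits of \<open>Y - L\<close> are adapted since the filtration is right-continuous,
  and they provide the finite variation part.
\<close>

section \<open>Square integrable functions\<close>

text \<open>The norm is not differentiable at \<open>q\<close>, and the process may visit that
  point, so a change of variables would have to account for a local time. Convexity replaces it: the
  norm enters only through an inequality, and \<open>A\<close> is added so that the drift cannot
  spoil this inequality. Convergence of the grid martingales themselves is never shown; what is
  available is an energy bound uniform in the mesh. The condition that \<open>Y - N\<close>
  increases along a grid survives midpoints and almost sure limits, and a finer grid contains the
  coarser ones, so the Hilbert space argument for projections onto a decreasing sequence of convex
  sets can take the place of weak compactness. Only the martingales need second moments:
  \<open>Y\<close> and \<open>A\<close> enter the construction pathwise, through almost sure
  inequalities, and no moment of them is used. The limit martingale is controlled at fixed times
  only and nothing is known about its paths. This is why monotonicity is kept on the countable set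
  of dyadic times until right limits produce a version with good paths.\<close>

lemma (in finite_measure) integrable_of_square:
  fixes f :: "'a \<Rightarrow> real"
  assumes "f \<in> borel_measurable M" "integrable M (\<lambda>x. (f x)\<^sup>2)"
  shows "integrable M f"
proof (rule Bochner_Integration.integrable_bound)
  show "integrable M (\<lambda>x. 1 + (f x)\<^sup>2)"
    using assms by simp
  have "\<bar>y\<bar> \<le> 1 + y\<^sup>2" for y :: real
    using sum_squares_bound[of "\<bar>y\<bar>" 1] by (simp add: power2_eq_square)
  then show "AE x in M. norm (f x) \<le> norm (1 + (f x)\<^sup>2)"
    by auto
qed (use assms in auto)

lemma integrable_mult_of_squares:
  fixes f g :: "'a \<Rightarrow> real"
  assumes [measurable]: "f \<in> borel_measurable M" "g \<in> borel_measurable M"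
    and "integrable M (\<lambda>x. (f x)\<^sup>2)" "integrable M (\<lambda>x. (g x)\<^sup>2)"
  shows "integrable M (\<lambda>x. f x * g x)"
proof (rule Bochner_Integration.integrable_bound)
  show "integrable M (\<lambda>x. (f x)\<^sup>2 + (g x)\<^sup>2)"
    using assms by simp
  have "\<bar>y * z\<bar> \<le> y\<^sup>2 + z\<^sup>2" for y z :: real
  proof -
    have "2 * (\<bar>y\<bar> * \<bar>z\<bar>) \<le> y\<^sup>2 + z\<^sup>2"
      using sum_squares_bound[of "\<bar>y\<bar>" "\<bar>z\<bar>"] by (simp add: mult.assoc)
    then show ?thesis
      using mult_nonneg_nonneg[OF abs_ge_zero abs_ge_zero, of y z] unfolding abs_mult by linarith
  qed
  then show "AE x in M. norm (f x * g x) \<le> norm ((f x)\<^sup>2 + (g x)\<^sup>2)"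
    by auto
qed simp

lemma integrable_square_add:
  fixes f g :: "'a \<Rightarrow> real"
  assumes [measurable]: "f \<in> borel_measurable M" "g \<in> borel_measurable M"
    and "integrable M (\<lambda>x. (f x)\<^sup>2)" "integrable M (\<lambda>x. (g x)\<^sup>2)"
  shows "integrable M (\<lambda>x. (f x + g x)\<^sup>2)"
  using assms integrable_mult_of_squares[OF assms] by (simp add: power2_sum mult.assoc)

lemma integrable_square_diff:
  fixes f g :: "'a \<Rightarrow> real"
  assumes [measurable]: "f \<in> borel_measurable M" "g \<in> borel_measurable M"
    and "integrable M (\<lambda>x. (f x)\<^sup>2)" "integrable M (\<lambda>x. (g x)\<^sup>2)"
  shows "integrable M (\<lambda>x. (f x - g x)\<^sup>2)"
  using integrable_square_add[of f M "\<lambda>x. - g x"] assms by simp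

text \<open>The parallelogram identity, solved for the midpoint: the second moment of a midpoint
  falls below the average by a quarter of the squared distance.\<close>

lemma integral_midpoint_sq:
  fixes f g :: "'a \<Rightarrow> real"
  assumes "f \<in> borel_measurable M" "g \<in> borel_measurable M"
    and "integrable M (\<lambda>x. (f x)\<^sup>2)" "integrable M (\<lambda>x. (g x)\<^sup>2)"
  shows "(\<integral>x. ((f x + g x) / 2)\<^sup>2 \<partial>M) =
    (2 * (\<integral>x. (f x)\<^sup>2 \<partial>M) + 2 * (\<integral>x. (g x)\<^sup>2 \<partial>M) - (\<integral>x. (f x - g x)\<^sup>2 \<partial>M)) / 4"
proof -
  have eq: "((a + b) / 2)\<^sup>2 = (2 * a\<^sup>2 + 2 * b\<^sup>2 - (a - b)\<^sup>2) / 4" for a b :: real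
    by (simp add: power2_eq_square field_simps)
  show ?thesis
    unfolding eq using assms integrable_square_diff[OF assms] by simp
qed

lemma integrable_square_bounded_mult:
  fixes f g :: "'a \<Rightarrow> real"
  assumes [measurable]: "f \<in> borel_measurable M" "g \<in> borel_measurable M"
    and "integrable M (\<lambda>x. (f x)\<^sup>2)" and B: "\<And>x. x \<in> space M \<Longrightarrow> \<bar>g x\<bar> \<le> B"
  shows "integrable M (\<lambda>x. (g x * f x)\<^sup>2)"
proof (rule Bochner_Integration.integrable_bound)
  show "integrable M (\<lambda>x. B\<^sup>2 * (f x)\<^sup>2)"
    using assms by simp
  show "AE x in M. norm ((g x * f x)\<^sup>2) \<le> norm (B\<^sup>2 * (f x)\<^sup>2)"
  proof (rule AE_I2)
    fix x assume "x \<in> space M"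
    then have "(g x)\<^sup>2 \<le> B\<^sup>2"
      using B[of x] by (metis abs_le_square_iff abs_of_nonneg abs_ge_zero order_trans)
    then show "norm ((g x * f x)\<^sup>2) \<le> norm (B\<^sup>2 * (f x)\<^sup>2)"
      by (simp add: power_mult_distrib mult_right_mono)
  qed
qed simp

text \<open>The variance of \<open>\<bar>f\<bar>\<close> is nonnegative.\<close>

lemma (in prob_space) expectation_abs_le_sqrt:
  fixes f :: "'a \<Rightarrow> real"
  assumes [measurable]: "f \<in> borel_measurable M" and sq: "integrable M (\<lambda>x. (f x)\<^sup>2)"
  shows "(\<integral>x. \<bar>f x\<bar> \<partial>M) \<le> sqrt (\<integral>x. (f x)\<^sup>2 \<partial>M)"
proof -
  have "integrable M (\<lambda>x. \<bar>f x\<bar>)"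
    using integrable_of_square[OF assms] by simp
  then have "variance (\<lambda>x. \<bar>f x\<bar>) = (\<integral>x. (f x)\<^sup>2 \<partial>M) - (\<integral>x. \<bar>f x\<bar> \<partial>M)\<^sup>2"
    using sq by (subst variance_eq) auto
  then have "(\<integral>x. \<bar>f x\<bar> \<partial>M)\<^sup>2 \<le> (\<integral>x. (f x)\<^sup>2 \<partial>M)"
    using variance_positive[of "\<lambda>x. \<bar>f x\<bar>"] by simp
  then show ?thesis
    by (rule real_le_rsqrt)
qed

text \<open>Fatou's lemma bounds the second moment of the limit. Bounded second moments also make
  the sequence uniformly integrable, so that almost sure convergence improves to convergence in
  mean, which is enough to preserve the martingale property.\<close>

lemma (in prob_space) L2_bounded_convergence:
  fixes f :: "nat \<Rightarrow> 'a \<Rightarrow> real"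
  assumes f[measurable]: "\<And>n. f n \<in> borel_measurable M"
    and sq: "\<And>n. integrable M (\<lambda>x. (f n x)\<^sup>2)"
    and le: "\<And>n. (\<integral>x. (f n x)\<^sup>2 \<partial>M) \<le> c"
    and g[measurable]: "g \<in> borel_measurable M" and lim: "AE x in M. (\<lambda>n. f n x) \<longlonglongrightarrow> g x"
  shows "integrable M (\<lambda>x. (g x)\<^sup>2)" "(\<integral>x. (g x)\<^sup>2 \<partial>M) \<le> c"
    "(\<lambda>n. \<integral>x. \<bar>f n x - g x\<bar> \<partial>M) \<longlonglongrightarrow> 0"
proof -
  have c0: "0 \<le> c"
    by (rule order_trans[OF _ le[of 0]]) (simp add: integral_nonneg_AE)
  have "(\<integral>\<^sup>+x. ennreal ((g x)\<^sup>2) \<partial>M) = (\<integral>\<^sup>+x. liminf (\<lambda>n. ennreal ((f n x)\<^sup>2)) \<partial>M)"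
  proof (rule nn_integral_cong_AE, use lim in eventually_elim)
    fix x assume "(\<lambda>n. f n x) \<longlonglongrightarrow> g x"
    then have "(\<lambda>n. ennreal ((f n x)\<^sup>2)) \<longlonglongrightarrow> ennreal ((g x)\<^sup>2)"
      by (intro tendsto_intros tendsto_ennrealI)
    then show "ennreal ((g x)\<^sup>2) = liminf (\<lambda>n. ennreal ((f n x)\<^sup>2))"
      by (intro lim_imp_Liminf[symmetric]) simp_all
  qed
  also have "\<dots> \<le> liminf (\<lambda>n. \<integral>\<^sup>+x. ennreal ((f n x)\<^sup>2) \<partial>M)"
    by (rule nn_integral_liminf) simp
  also have "\<dots> \<le> liminf (\<lambda>n. ennreal c)"
    using sq le by (intro Liminf_mono always_eventually allI) (simp add: nn_integral_eq_integral ennreal_leI)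
  also have "\<dots> = ennreal c"
    by (simp add: Liminf_const)
  finally have g2: "(\<integral>\<^sup>+x. ennreal ((g x)\<^sup>2) \<partial>M) \<le> ennreal c" .
  then show gsq: "integrable M (\<lambda>x. (g x)\<^sup>2)"
    by (intro integrableI_bounded) (auto simp: order_le_less_trans)
  then show gc: "(\<integral>x. (g x)\<^sup>2 \<partial>M) \<le> c"
    using g2 c0 by (simp add: nn_integral_eq_integral)
  have dsq: "integrable M (\<lambda>x. (f n x - g x)\<^sup>2)" for n
    by (intro integrable_square_diff sq gsq) simp_all
  have dint: "integrable M (\<lambda>x. f n x - g x)" for n
    by (rule integrable_of_square[OF _ dsq]) simp
  have dle: "(\<integral>x. (f n x - g x)\<^sup>2 \<partial>M) \<le> 4 * c" for n
  proof -
    have "(\<integral>x. (f n x - g x)\<^sup>2 \<partial>M) \<le> (\<integral>x. 2 * (f n x)\<^sup>2 + 2 * (g x)\<^sup>2 \<partial>M)"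
    proof (rule integral_mono)
      fix x show "(f n x - g x)\<^sup>2 \<le> 2 * (f n x)\<^sup>2 + 2 * (g x)\<^sup>2"
        using zero_le_power2[of "f n x + g x"] by (simp add: power2_eq_square algebra_simps)
    qed (use dsq sq gsq in auto)
    also have "\<dots> \<le> 4 * c"
      using sq gsq le[of n] gc by simp
    finally show ?thesis .
  qed
  show "(\<lambda>n. \<integral>x. \<bar>f n x - g x\<bar> \<partial>M) \<longlonglongrightarrow> 0"
  proof (rule LIMSEQ_I)
    fix e :: real assume e: "0 < e"
    \<comment> \<open>Truncation level. The part of \<open>\<bar>f n x - g x\<bar>\<close> below
      \<open>K\<close> goes to 0 by dominated convergence; the excess is at most the square divided
      by \<open>K\<close>, with integral at most \<open>4 * c / K \<le> e / 2\<close>. The summand 1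
      keeps \<open>K\<close> positive when \<open>c = 0\<close>.\<close>
    define K where "K = 8 * (c + 1) / e"
    have K: "0 < K"
      using c0 e by (simp add: K_def)
    have "(\<lambda>n. \<integral>x. min \<bar>f n x - g x\<bar> K \<partial>M) \<longlonglongrightarrow> (\<integral>x. 0 \<partial>M)"
    proof (rule integral_dominated_convergence[where w="\<lambda>_. K"])
      show "AE x in M. (\<lambda>n. min \<bar>f n x - g x\<bar> K) \<longlonglongrightarrow> 0"
        using lim
      proof eventually_elim
        fix x assume "(\<lambda>n. f n x) \<longlonglongrightarrow> g x"
        then have "(\<lambda>n. min \<bar>f n x - g x\<bar> K) \<longlonglongrightarrow> min \<bar>g x - g x\<bar> K"
          by (intro tendsto_intros)
        then show "(\<lambda>n. min \<bar>f n x - g x\<bar> K) \<longlonglongrightarrow> 0"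
          using K by simp
      qed
    qed (use K in auto)
    from LIMSEQ_D[OF this, of "e / 2"] e
    have "\<exists>n0. \<forall>n\<ge>n0. \<bar>\<integral>x. min \<bar>f n x - g x\<bar> K \<partial>M\<bar> < e / 2"
      by simp
    then obtain n0 where n0: "\<And>n. n \<ge> n0 \<Longrightarrow> \<bar>\<integral>x. min \<bar>f n x - g x\<bar> K \<partial>M\<bar> < e / 2"
      by blast
    have "norm ((\<integral>x. \<bar>f n x - g x\<bar> \<partial>M) - 0) < e" if "n \<ge> n0" for n
    proof -
      have i1: "integrable M (\<lambda>x. min \<bar>f n x - g x\<bar> K)"
        by (rule integrable_min) (use dint in auto)
      have "(\<integral>x. \<bar>f n x - g x\<bar> \<partial>M) \<le> (\<integral>x. min \<bar>f n x - g x\<bar> K + (f n x - g x)\<^sup>2 / K \<partial>M)"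
      proof (rule integral_mono)
        fix x
        have "K * \<bar>y\<bar> \<le> K * min \<bar>y\<bar> K + y\<^sup>2" for y
        proof (cases "\<bar>y\<bar> \<le> K")
          case False
          then have "K * \<bar>y\<bar> \<le> \<bar>y\<bar> * \<bar>y\<bar>"
            by (intro mult_right_mono) auto
          also have "\<dots> = y\<^sup>2"
            by (simp add: power2_eq_square)
          also have "\<dots> \<le> K * min \<bar>y\<bar> K + y\<^sup>2"
            using K by simp
          finally show ?thesis .
        qed simp
        then show "\<bar>f n x - g x\<bar> \<le> min \<bar>f n x - g x\<bar> K + (f n x - g x)\<^sup>2 / K"
          using K by (simp add: field_simps)
      qed (use i1 dint dsq in auto)
      also have "\<dots> = (\<integral>x. min \<bar>f n x - g x\<bar> K \<partial>M) + (\<integral>x. (f n x - g x)\<^sup>2 \<partial>M) / K"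
        using i1 dsq by simp
      also have "(\<integral>x. (f n x - g x)\<^sup>2 \<partial>M) / K \<le> 4 * c / K"
        using dle[of n] K by (simp add: divide_right_mono)
      also have "4 * c / K \<le> e / 2"
        using c0 e by (simp add: K_def field_simps)
      finally show ?thesis
        using n0[OF that] by (simp add: integral_nonneg_AE)
    qed
    then show "\<exists>n0. \<forall>n\<ge>n0. norm ((\<integral>x. \<bar>f n x - g x\<bar> \<partial>M) - 0) < e"
      by blast
  qed
qed

text \<open>With increments for \<open>f n\<close> and \<open>g\<close>, this passes the martingale
  property to a limit in mean.\<close>

lemma integral_indicator_L1_limit:
  fixes f :: "nat \<Rightarrow> 'a \<Rightarrow> real"
  assumes f: "\<And>n. integrable M (f n)" and g: "integrable M g" and G: "G \<in> sets M"
    and lim: "(\<lambda>n. \<integral>x. \<bar>f n x - g x\<bar> \<partial>M) \<longlonglongrightarrow> 0"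
    and zero: "\<And>n. (\<integral>x. f n x * indicator G x \<partial>M) = 0"
  shows "(\<integral>x. g x * indicator G x \<partial>M) = 0"
proof -
  have "\<bar>\<integral>x. g x * indicator G x \<partial>M\<bar> \<le> (\<integral>x. \<bar>f n x - g x\<bar> \<partial>M)" for n
  proof -
    have "(\<integral>x. g x * indicator G x \<partial>M) = (\<integral>x. (g x - f n x) * indicator G x \<partial>M)"
      using zero[of n] f g G by (simp add: left_diff_distrib integrable_real_mult_indicator)
    also have "\<bar>\<dots>\<bar> \<le> (\<integral>x. \<bar>f n x - g x\<bar> \<partial>M)"
    proof (rule order_trans[OF integral_abs_bound integral_mono])
      show "integrable M (\<lambda>x. \<bar>(g x - f n x) * indicator G x\<bar>)"
        by (intro integrable_abs integrable_real_mult_indicator G Bochner_Integration.integrable_diff f g)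
    qed (use f g in \<open>auto simp: indicator_def\<close>)
    finally show ?thesis .
  qed
  then have "\<bar>\<integral>x. g x * indicator G x \<partial>M\<bar> \<le> 0"
    by (intro LIMSEQ_le_const[OF lim]) blast
  then show ?thesis
    by simp
qed

lemma L1_limit_diff:
  fixes f g :: "nat \<Rightarrow> 'a \<Rightarrow> real"
  assumes f: "\<And>n. integrable M (f n)" "integrable M f'" "(\<lambda>n. \<integral>x. \<bar>f n x - f' x\<bar> \<partial>M) \<longlonglongrightarrow> 0"
    and g: "\<And>n. integrable M (g n)" "integrable M g'" "(\<lambda>n. \<integral>x. \<bar>g n x - g' x\<bar> \<partial>M) \<longlonglongrightarrow> 0"
  shows "(\<lambda>n. \<integral>x. \<bar>f n x - g n x - (f' x - g' x)\<bar> \<partial>M) \<longlonglongrightarrow> 0"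
proof (rule tendsto_sandwich[OF _ _ tendsto_const])
  show "(\<lambda>n. (\<integral>x. \<bar>f n x - f' x\<bar> \<partial>M) + (\<integral>x. \<bar>g n x - g' x\<bar> \<partial>M)) \<longlonglongrightarrow> 0"
    using tendsto_add[OF f(3) g(3)] by simp
  show "\<forall>\<^sub>F n in sequentially. (\<integral>x. \<bar>f n x - g n x - (f' x - g' x)\<bar> \<partial>M)
      \<le> (\<integral>x. \<bar>f n x - f' x\<bar> \<partial>M) + (\<integral>x. \<bar>g n x - g' x\<bar> \<partial>M)"
  proof (intro always_eventually allI)
    fix n
    note i = f(1)[of n] f(2) g(1)[of n] g(2)
    have "(\<integral>x. \<bar>f n x - g n x - (f' x - g' x)\<bar> \<partial>M) \<le> (\<integral>x. \<bar>f n x - f' x\<bar> + \<bar>g n x - g' x\<bar> \<partial>M)"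
      using i by (intro integral_mono) auto
    then show "(\<integral>x. \<bar>f n x - g n x - (f' x - g' x)\<bar> \<partial>M)
        \<le> (\<integral>x. \<bar>f n x - f' x\<bar> \<partial>M) + (\<integral>x. \<bar>g n x - g' x\<bar> \<partial>M)"
      using i by simp
  qed
qed (simp add: always_eventually integral_nonneg_AE)

section \<open>Square integrable martingales\<close>

text \<open>Testing increments on the sets of \<open>F s\<close> avoids versions of conditional
  expectations: the condition is an exact linear equation, stable under linear combinations and
  limits in mean. No path regularity is asked for.\<close>

definition sq_martingale ::
  "'w measure \<Rightarrow> (real \<Rightarrow> 'w measure) \<Rightarrow> (real \<Rightarrow> 'w \<Rightarrow> real) \<Rightarrow> bool" where
  "sq_martingale M F N \<longleftrightarrow> adapted F N \<and> (\<forall>t\<ge>0. integrable M (\<lambda>\<omega>. (N t \<omega>)\<^sup>2)) \<and>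
     (\<forall>s\<ge>0. \<forall>t\<ge>s. \<forall>G\<in>sets (F s). (\<integral>\<omega>. (N t \<omega> - N s \<omega>) * indicator G \<omega> \<partial>M) = 0)"

context stochastic_basis
begin

lemma subalgebra_F: "t \<ge> 0 \<Longrightarrow> subalgebra M (F t)"
  by (simp add: subalgebra_def space_F sets_F_subset)

lemma measurable_F_mono: "f \<in> borel_measurable (F s) \<Longrightarrow> s \<le> t \<Longrightarrow> f \<in> borel_measurable (F t)"
  using measurable_mono[OF order_refl refl sets_F_mono, of s t] by (auto simp: space_F)

lemma measurable_F_imp: "f \<in> borel_measurable (F t) \<Longrightarrow> t \<ge> 0 \<Longrightarrow> f \<in> borel_measurable M"
  using measurable_from_subalg[OF subalgebra_F] by blast

lemma adapted_measurable_F: "adapted F N \<Longrightarrow> 0 \<le> s \<Longrightarrow> s \<le> t \<Longrightarrow> N s \<in> borel_measurable (F t)"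
  unfolding adapted_def using measurable_F_mono by blast

lemma adapted_measurable: "adapted F N \<Longrightarrow> 0 \<le> t \<Longrightarrow> N t \<in> borel_measurable M"
  unfolding adapted_def using measurable_F_imp by blast

lemma sets_F_imp: "G \<in> sets (F t) \<Longrightarrow> t \<ge> 0 \<Longrightarrow> G \<in> sets M"
  using sets_F_subset by blast

text \<open>Right-continuity of the filtration enters here. It makes right limits at
  \<open>t\<close> measurable at time \<open>t\<close>, although they are built from values at later
  times.\<close>

lemma measurable_F_right:
  fixes f :: "'w \<Rightarrow> 'b::topological_space"
  assumes t: "0 \<le> t" and f: "\<And>u. t < u \<Longrightarrow> f \<in> borel_measurable (F u)"
  shows "f \<in> borel_measurable (F t)"
proof (rule measurableI)
  fix S :: "'b set" assume S: "S \<in> sets borel"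
  have "f -` S \<inter> space (F t) \<in> sets (F u)" if "t < u" for u
    using measurable_sets[OF f[OF that] S] by (simp add: space_F)
  then show "f -` S \<inter> space (F t) \<in> sets (F t)"
    using right_continuous[OF t] by simp
qed simp

text \<open>Augmentation puts null sets into \<open>F 0\<close>, so a set of full measure can be
  chosen in every \<open>F t\<close>. A process may then be redefined off this set without losing
  adaptedness, which provides properties that are demanded of every path.\<close>

lemma AE_full_set:
  assumes "AE \<omega> in M. P \<omega>"
  obtains G where "G \<subseteq> space M" "\<And>t. 0 \<le> t \<Longrightarrow> G \<in> sets (F t)" "AE \<omega> in M. \<omega> \<in> G" "\<And>\<omega>. \<omega> \<in> G \<Longrightarrow> P \<omega>"
proof -
  obtain E where E: "{\<omega> \<in> space M. \<not> P \<omega>} \<subseteq> E" "E \<in> null_sets M"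
    using assms unfolding eventually_ae_filter by blast
  show ?thesis
  proof (rule that[of "space M - E"])
    show "space M - E \<in> sets (F t)" if "0 \<le> t" for t
    proof -
      have "E \<in> sets (F t)"
        using E(2) augmented sets_F_mono[OF that] by blast
      then show ?thesis
        unfolding space_F[of t, symmetric] by auto
    qed
    show "AE \<omega> in M. \<omega> \<in> space M - E"
      using AE_not_in[OF E(2)] AE_space by eventually_elim simp
  qed (use E(1) in auto)
qed

lemma sq_martingaleD:
  assumes "sq_martingale M F N"
  shows "adapted F N" "t \<ge> 0 \<Longrightarrow> N t \<in> borel_measurable M"
    "t \<ge> 0 \<Longrightarrow> integrable M (\<lambda>\<omega>. (N t \<omega>)\<^sup>2)" "t \<ge> 0 \<Longrightarrow> integrable M (N t)"
    "0 \<le> s \<Longrightarrow> s \<le> t \<Longrightarrow> G \<in> sets (F s) \<Longrightarrow> (\<integral>\<omega>. (N t \<omega> - N s \<omega>) * indicator G \<omega> \<partial>M) = 0"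
proof -
  note N = assms[unfolded sq_martingale_def]
  show A: "adapted F N"
    using N by blast
  show m: "N t \<in> borel_measurable M" if "t \<ge> 0"
    using adapted_measurable[OF A that] .
  show i: "integrable M (\<lambda>\<omega>. (N t \<omega>)\<^sup>2)" if "t \<ge> 0"
    using N that by blast
  show "integrable M (N t)" if "t \<ge> 0"
    using integrable_of_square[OF m[OF that] i[OF that]] .
  show "(\<integral>\<omega>. (N t \<omega> - N s \<omega>) * indicator G \<omega> \<partial>M) = 0" if "0 \<le> s" "s \<le> t" "G \<in> sets (F s)"
    using N that by blast
qed

text \<open>The last assumption says that \<open>Z\<close> has conditional expectation 0 given
  \<open>F s\<close>; the factor \<open>U\<close> can be pulled out of it.\<close>

lemma integral_mult_eq_0:
  fixes U Z :: "'w \<Rightarrow> real"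
  assumes s: "s \<ge> 0" and U: "U \<in> borel_measurable (F s)" "integrable M (\<lambda>\<omega>. (U \<omega>)\<^sup>2)"
    and Z: "Z \<in> borel_measurable M" "integrable M (\<lambda>\<omega>. (Z \<omega>)\<^sup>2)"
    and zero: "\<And>G. G \<in> sets (F s) \<Longrightarrow> (\<integral>\<omega>. Z \<omega> * indicator G \<omega> \<partial>M) = 0"
  shows "(\<integral>\<omega>. U \<omega> * Z \<omega> \<partial>M) = 0"
proof -
  interpret finite_measure_subalgebra M "F s"
    using subalgebra_F[OF s] by unfold_locales
  have UM: "U \<in> borel_measurable M"
    using measurable_F_imp U s by blast
  have "AE \<omega> in M. real_cond_exp M (F s) Z \<omega> = 0"
    using integrable_of_square[OF Z] zero
    by (intro real_cond_exp_charact) (auto simp: set_lebesgue_integral_def mult.commute)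
  then have "(\<integral>\<omega>. U \<omega> * real_cond_exp M (F s) Z \<omega> \<partial>M) = 0"
    by (intro integral_eq_zero_AE) auto
  then show ?thesis
    using real_cond_exp_intg(2)[OF integrable_mult_of_squares[OF UM Z(1) U(2) Z(2)] U(1) Z(1)] by simp
qed

lemma sq_martingale_orthogonal:
  assumes N: "sq_martingale M F N" and st: "0 \<le> s" "s \<le> t"
    and U: "U \<in> borel_measurable (F s)" "integrable M (\<lambda>\<omega>. (U \<omega>)\<^sup>2)"
  shows "(\<integral>\<omega>. U \<omega> * (N t \<omega> - N s \<omega>) \<partial>M) = 0"
  using st
  by (intro integral_mult_eq_0[OF st(1) U] integrable_square_diff borel_measurable_diff
      sq_martingaleD[OF N]) auto

lemma sq_martingale_pythagoras:
  assumes N: "sq_martingale M F N" and st: "0 \<le> s" "s \<le> t"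
  shows "(\<integral>\<omega>. (N t \<omega> - N s \<omega>)\<^sup>2 \<partial>M) = (\<integral>\<omega>. (N t \<omega>)\<^sup>2 \<partial>M) - (\<integral>\<omega>. (N s \<omega>)\<^sup>2 \<partial>M)"
proof -
  note D = sq_martingaleD[OF N]
  have t0: "0 \<le> t"
    using st by simp
  note [measurable] = D(2)[OF st(1)] D(2)[OF t0]
  have "(\<integral>\<omega>. N s \<omega> * (N t \<omega> - N s \<omega>) \<partial>M) = 0"
    using D(1) D(3)[of s] st adapted_measurable_F[of N s s] by (intro sq_martingale_orthogonal[OF N]) auto
  moreover have "integrable M (\<lambda>\<omega>. N s \<omega> * (N t \<omega> - N s \<omega>))"
    using D(3) st t0 by (intro integrable_mult_of_squares integrable_square_diff) auto
  moreover have "(N t \<omega> - N s \<omega>)\<^sup>2 = (N t \<omega>)\<^sup>2 - (N s \<omega>)\<^sup>2 - 2 * (N s \<omega> * (N t \<omega> - N s \<omega>))" for \<omega>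
    by (simp add: power2_eq_square algebra_simps)
  ultimately show ?thesis
    using D(3)[OF st(1)] D(3)[OF t0] by simp
qed

lemma sq_martingale_mono:
  assumes N: "sq_martingale M F N" and st: "0 \<le> s" "s \<le> t"
  shows "(\<integral>\<omega>. (N s \<omega>)\<^sup>2 \<partial>M) \<le> (\<integral>\<omega>. (N t \<omega>)\<^sup>2 \<partial>M)"
proof -
  have "0 \<le> (\<integral>\<omega>. (N t \<omega> - N s \<omega>)\<^sup>2 \<partial>M)"
    by simp
  then show ?thesis
    using sq_martingale_pythagoras[OF assms] by simp
qed

lemma sq_martingale_zero: "sq_martingale M F (\<lambda>_ _. 0)"
  by (simp add: sq_martingale_def adapted_def)

lemma sq_martingale_add:
  assumes N: "sq_martingale M F N" and N': "sq_martingale M F N'"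
  shows "sq_martingale M F (\<lambda>t \<omega>. N t \<omega> + N' t \<omega>)"
  unfolding sq_martingale_def
proof (intro conjI allI impI ballI)
  note D = sq_martingaleD[OF N] and D' = sq_martingaleD[OF N']
  show "adapted F (\<lambda>t \<omega>. N t \<omega> + N' t \<omega>)"
    using D(1) D'(1) by (auto simp: adapted_def intro!: borel_measurable_add)
  show "integrable M (\<lambda>\<omega>. (N t \<omega> + N' t \<omega>)\<^sup>2)" if "0 \<le> t" for t
    using that by (intro integrable_square_add D(2,3) D'(2,3))
  fix s t :: real and G assume st: "0 \<le> s" "s \<le> t" and G: "G \<in> sets (F s)"
  have i: "integrable M (\<lambda>\<omega>. (N t \<omega> - N s \<omega>) * indicator G \<omega>)"
    "integrable M (\<lambda>\<omega>. (N' t \<omega> - N' s \<omega>) * indicator G \<omega>)"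
    using D(4) D'(4) st sets_F_imp[OF G]
    by (auto intro!: integrable_real_mult_indicator Bochner_Integration.integrable_diff)
  have "(N t \<omega> + N' t \<omega> - (N s \<omega> + N' s \<omega>)) * indicator G \<omega>
      = (N t \<omega> - N s \<omega>) * indicator G \<omega> + (N' t \<omega> - N' s \<omega>) * indicator G \<omega>" for \<omega>
    by (simp add: algebra_simps)
  then show "(\<integral>\<omega>. (N t \<omega> + N' t \<omega> - (N s \<omega> + N' s \<omega>)) * indicator G \<omega> \<partial>M) = 0"
    using i D(5)[OF st G] D'(5)[OF st G] by simp
qed

lemma sq_martingale_cmult:
  assumes N: "sq_martingale M F N"
  shows "sq_martingale M F (\<lambda>t \<omega>. c * N t \<omega>)"
proof -
  note D = sq_martingaleD[OF N]
  have "(\<integral>\<omega>. (c * N t \<omega> - c * N s \<omega>) * indicator G \<omega> \<partial>M)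
      = c * (\<integral>\<omega>. (N t \<omega> - N s \<omega>) * indicator G \<omega> \<partial>M)" for s t G
    by (subst integral_mult_right_zero[symmetric]) (simp add: algebra_simps)
  then show ?thesis
    using D(1,3,5) unfolding sq_martingale_def by (auto simp: adapted_def power_mult_distrib)
qed

lemma sq_martingale_diff:
  assumes N: "sq_martingale M F N" and N': "sq_martingale M F N'"
  shows "sq_martingale M F (\<lambda>t \<omega>. N t \<omega> - N' t \<omega>)"
  using sq_martingale_add[OF N sq_martingale_cmult[OF N', of "-1"]] by simp

lemma sq_martingale_sum:
  assumes "finite J" "\<And>j. j \<in> J \<Longrightarrow> sq_martingale M F (N j)"
  shows "sq_martingale M F (\<lambda>t \<omega>. \<Sum>j\<in>J. N j t \<omega>)"
  using assms by (induction J rule: finite_induct) (auto intro: sq_martingale_zero sq_martingale_add)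

lemma sq_martingale_const:
  assumes U: "U \<in> borel_measurable (F 0)" "integrable M (\<lambda>\<omega>. (U \<omega>)\<^sup>2)"
  shows "sq_martingale M F (\<lambda>t. U)"
  using U measurable_F_mono by (auto simp: sq_martingale_def adapted_def)

text \<open>For processes such as \<open>approx\<close>, whose number of summands grows with time,
  but which on each \<open>[0, T]\<close> agree with one fixed finite sum of martingales.\<close>

lemma sq_martingale_local:
  assumes loc: "\<And>T. 0 \<le> T \<Longrightarrow>
      \<exists>N'. sq_martingale M F N' \<and> (\<forall>t\<in>{0..T}. \<forall>\<omega>\<in>space M. N t \<omega> = N' t \<omega>)"
  shows "sq_martingale M F N"
  unfolding sq_martingale_def adapted_def
proof (intro conjI allI impI ballI)
  fix t :: real assume t: "0 \<le> t"
  obtain N' where N': "sq_martingale M F N'" "\<And>\<omega>. \<omega> \<in> space M \<Longrightarrow> N t \<omega> = N' t \<omega>"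
    using loc[OF t] t by fastforce
  note D = sq_martingaleD[OF N'(1)]
  have "N' t \<in> borel_measurable (F t)"
    using D(1) t by (simp add: adapted_def)
  then show "N t \<in> borel_measurable (F t)"
    using N'(2) measurable_cong[of "F t" "N t" "N' t"] by (simp add: space_F)
  show "integrable M (\<lambda>\<omega>. (N t \<omega>)\<^sup>2)"
    using D(3)[OF t] N'(2) by (subst Bochner_Integration.integrable_cong[OF refl]) auto
next
  fix s t :: real and G assume st: "0 \<le> s" "s \<le> t" and G: "G \<in> sets (F s)"
  obtain N' where N': "sq_martingale M F N'"
      "\<And>r \<omega>. r \<in> {0..t} \<Longrightarrow> \<omega> \<in> space M \<Longrightarrow> N r \<omega> = N' r \<omega>"
    using loc[of t] st by fastforce
  have "(\<integral>\<omega>. (N t \<omega> - N s \<omega>) * indicator G \<omega> \<partial>M) = (\<integral>\<omega>. (N' t \<omega> - N' s \<omega>) * indicator G \<omega> \<partial>M)"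
    using st by (intro Bochner_Integration.integral_cong) (auto simp: N'(2))
  then show "(\<integral>\<omega>. (N t \<omega> - N s \<omega>) * indicator G \<omega> \<partial>M) = 0"
    using sq_martingaleD(5)[OF N'(1) st G] by simp
qed

text \<open>The integral against \<open>Z\<close> of the one-step integrand with value
  \<open>\<xi>\<close> on \<open>(a, b]\<close>. All discrete stochastic integrals below are finite
  sums of such blocks.\<close>

lemma sq_martingale_block:
  assumes Z: "sq_martingale M F Z" and ab: "0 \<le> a" "a \<le> b"
    and \<xi>: "\<xi> \<in> borel_measurable (F a)" and B: "\<And>\<omega>. \<omega> \<in> space M \<Longrightarrow> \<bar>\<xi> \<omega>\<bar> \<le> B"
  shows "sq_martingale M F (\<lambda>t \<omega>. \<xi> \<omega> * (Z (min t b) \<omega> - Z (min t a) \<omega>))"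
  unfolding sq_martingale_def
proof (intro conjI allI impI ballI)
  note D = sq_martingaleD[OF Z]
  have \<xi>M: "\<xi> \<in> borel_measurable M"
    using \<xi> ab measurable_F_imp by blast
  show "adapted F (\<lambda>t \<omega>. \<xi> \<omega> * (Z (min t b) \<omega> - Z (min t a) \<omega>))"
    unfolding adapted_def
  proof (intro allI impI)
    fix t :: real assume t: "0 \<le> t"
    \<comment> \<open>Up to time \<open>a\<close> the factor \<open>\<xi>\<close> need not be
      measurable for \<open>F t\<close>, but there the increment vanishes identically.\<close>
    show "(\<lambda>\<omega>. \<xi> \<omega> * (Z (min t b) \<omega> - Z (min t a) \<omega>)) \<in> borel_measurable (F t)"
    proof (cases "t \<le> a")
      case False
      then show ?thesis
        using t ab measurable_F_mono[OF \<xi>, of t]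
        by (intro borel_measurable_times borel_measurable_diff adapted_measurable_F[OF D(1)]) auto
    qed (use ab in simp)
  qed
  show "integrable M (\<lambda>\<omega>. (\<xi> \<omega> * (Z (min t b) \<omega> - Z (min t a) \<omega>))\<^sup>2)" if "0 \<le> t" for t
    using that ab
    by (intro integrable_square_bounded_mult[where B=B] integrable_square_diff borel_measurable_diff
        D(2) D(3) \<xi>M B) auto
  fix s t :: real and G assume st: "0 \<le> s" "s \<le> t" and G: "G \<in> sets (F s)"
  \<comment> \<open>Between \<open>s\<close> and \<open>t\<close> the block moves only on the
    overlap of \<open>(s, t]\<close> and \<open>(a, b]\<close>, which is \<open>(u, v]\<close>. As
    \<open>a\<close> and \<open>s\<close> are at most \<open>u\<close>, both \<open>\<xi>\<close>
    and \<open>G\<close> are known at time \<open>u\<close>, and orthogonality applies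
    there.\<close>
  define u where "u = max s a"
  define v where "v = min t b"
  have u0: "0 \<le> u"
    using st ab by (simp add: u_def)
  let ?R = "\<lambda>t \<omega>. \<xi> \<omega> * (Z (min t b) \<omega> - Z (min t a) \<omega>)"
  show "(\<integral>\<omega>. (?R t \<omega> - ?R s \<omega>) * indicator G \<omega> \<partial>M) = 0"
  proof (cases "u \<le> v")
    case False
    then have "?R t \<omega> - ?R s \<omega> = 0" for \<omega>
      using st ab unfolding u_def v_def
      by (cases "t \<le> a"; cases "s \<le> a"; cases "b \<le> s") (auto simp: min_def max_def)
    then have "(\<lambda>\<omega>. (?R t \<omega> - ?R s \<omega>) * indicator G \<omega>) = (\<lambda>\<omega>. 0)"
      by (simp only: mult_zero_left)
    then show ?thesis
      by simp
  next
    case uv: True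
    have "?R t \<omega> - ?R s \<omega> = \<xi> \<omega> * (Z v \<omega> - Z u \<omega>)" for \<omega>
      using st ab uv unfolding u_def v_def by (auto simp: min_def max_def algebra_simps)
    then have "(\<integral>\<omega>. (?R t \<omega> - ?R s \<omega>) * indicator G \<omega> \<partial>M)
        = (\<integral>\<omega>. (\<xi> \<omega> * indicator G \<omega>) * (Z v \<omega> - Z u \<omega>) \<partial>M)"
      by (simp add: mult_ac)
    also have "\<dots> = 0"
    proof (rule sq_martingale_orthogonal[OF Z u0 uv])
      have [measurable]: "\<xi> \<in> borel_measurable (F u)" "G \<in> sets (F u)"
        using measurable_F_mono[OF \<xi>, of u] sets_F_mono[of s u] G by (auto simp: u_def)
      show "(\<lambda>\<omega>. \<xi> \<omega> * indicator G \<omega>) \<in> borel_measurable (F u)"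
        by measurable
      show "integrable M (\<lambda>\<omega>. (\<xi> \<omega> * indicator G \<omega>)\<^sup>2)"
      proof (rule integrable_square_bounded_mult[where B=B])
        show "integrable M (\<lambda>\<omega>. (indicator G \<omega> :: real)\<^sup>2)"
        proof -
          have "(\<lambda>\<omega>. (indicator G \<omega> :: real)\<^sup>2) = indicator G"
            by (auto simp: indicator_def)
          then show ?thesis
            using sets_F_imp[OF G st(1)] by (simp add: emeasure_eq_measure)
        qed
      qed (use \<xi>M sets_F_imp[OF G st(1)] B in auto)
    qed
    finally show ?thesis .
  qed
qed

lemma sq_martingale_L1_limit:
  assumes N: "\<And>n. sq_martingale M F (N n)" and L: "adapted F L"
    and sq: "\<And>t. 0 \<le> t \<Longrightarrow> integrable M (\<lambda>\<omega>. (L t \<omega>)\<^sup>2)"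
    and lim: "\<And>t. 0 \<le> t \<Longrightarrow> (\<lambda>n. \<integral>\<omega>. \<bar>N n t \<omega> - L t \<omega>\<bar> \<partial>M) \<longlonglongrightarrow> 0"
  shows "sq_martingale M F L"
  unfolding sq_martingale_def
proof (intro conjI allI impI ballI L sq)
  fix s t :: real and G assume st: "0 \<le> s" "s \<le> t" and G: "G \<in> sets (F s)"
  have iN: "integrable M (N n r)" and iL: "integrable M (L r)" if "0 \<le> r" for n r
    using that sq_martingaleD[OF N] integrable_of_square[of "L r"] sq[of r] adapted_measurable[OF L, of r] by auto
  have t0: "0 \<le> t"
    using st by simp
  show "(\<integral>\<omega>. (L t \<omega> - L s \<omega>) * indicator G \<omega> \<partial>M) = 0"
  proof (rule integral_indicator_L1_limit)
    show "(\<integral>\<omega>. (N n t \<omega> - N n s \<omega>) * indicator G \<omega> \<partial>M) = 0" for n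
      using sq_martingaleD(5)[OF N st G] .
    show "(\<lambda>n. \<integral>\<omega>. \<bar>N n t \<omega> - N n s \<omega> - (L t \<omega> - L s \<omega>)\<bar> \<partial>M) \<longlonglongrightarrow> 0"
      by (intro L1_limit_diff iN iL lim t0 st(1))
  qed (use iN iL t0 st sets_F_imp[OF G] in auto)
qed

lemma sq_martingale_imp_martingale:
  assumes N: "sq_martingale M F N"
  shows "martingale M F N"
  unfolding martingale_def
proof (intro conjI allI impI)
  note D = sq_martingaleD[OF N]
  show "adapted F N"
    by (rule D)
  show "integrable M (N t)" if "0 \<le> t" for t
    using D(4)[OF that] .
  fix s t :: real assume st: "0 \<le> s" "s \<le> t"
  interpret finite_measure_subalgebra M "F s"
    using subalgebra_F[OF st(1)] by unfold_locales
  have i: "integrable M (N t)" "integrable M (N s)"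
    using D(4) st by auto
  show "AE \<omega> in M. real_cond_exp M (F s) (N t) \<omega> = N s \<omega>"
  proof (rule real_cond_exp_charact[OF _ i])
    show "N s \<in> borel_measurable (F s)"
      using D(1) st by (simp add: adapted_def)
    fix G assume G: "G \<in> sets (F s)"
    have "(\<integral>\<omega>. N t \<omega> * indicator G \<omega> \<partial>M) - (\<integral>\<omega>. N s \<omega> * indicator G \<omega> \<partial>M) = 0"
      using D(5)[OF st G] sets_F_imp[OF G st(1)] i
      by (simp add: left_diff_distrib integrable_real_mult_indicator)
    then show "(\<integral>x\<in>G. N t x \<partial>M) = (\<integral>x\<in>G. N s x \<partial>M)"
      by (simp add: set_lebesgue_integral_def mult.commute)
  qed
qed

lemma sq_martingale_stopped_const:
  assumes N: "sq_martingale M F N" and a: "0 \<le> a"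
  shows "sq_martingale M F (\<lambda>t. N (min t a))"
proof -
  have N0: "sq_martingale M F (\<lambda>t. N 0)"
    using sq_martingaleD(1,3)[OF N] by (intro sq_martingale_const) (auto simp: adapted_def)
  have "sq_martingale M F (\<lambda>t \<omega>. N 0 \<omega> + 1 * (N (min t a) \<omega> - N (min t 0) \<omega>))"
    by (rule sq_martingale_add[OF N0 sq_martingale_block[OF N order_refl a, where B=1]]) auto
  then show ?thesis
    by (rule sq_martingale_local[OF exI[where P="\<lambda>N'. sq_martingale M F N' \<and> _ N'"], OF conjI]) auto
qed

text \<open>The constant times \<open>n\<close> serve as localizing sequence.\<close>

lemma sq_martingale_imp_local_martingale:
  assumes N: "sq_martingale M F N" and "cadlag_process M N"
  shows "local_martingale M F N"
  unfolding local_martingale_def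
proof (intro conjI exI[of _ "\<lambda>n \<omega>. real n"] allI ballI)
  show "adapted F N" "cadlag_process M N"
    using sq_martingaleD(1)[OF N] assms by auto
  show "stopping_time F (\<lambda>\<omega>. real n)" for n
    by (rule stopping_time_const)
  show "AE \<omega> in M. filterlim (\<lambda>n. real n) at_top sequentially"
    using filterlim_real_sequentially by simp
  have N0: "sq_martingale M F (\<lambda>t. N 0)"
    using sq_martingaleD(1,3)[OF N] by (intro sq_martingale_const) (auto simp: adapted_def)
  show "martingale M F (\<lambda>t \<omega>. N (min t (real n)) \<omega> - N 0 \<omega>)" for n
    using sq_martingale_diff[OF sq_martingale_stopped_const[OF N, of "real n"] N0]
    by (simp add: sq_martingale_imp_martingale)
qed auto

end

section \<open>Discrete compensation along dyadic grids\<close>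

text \<open>The infima of \<open>Q\<close> over the sets increase and are bounded by
  \<open>K\<close>, so they converge to some \<open>s\<close>. Two elements with \<open>Q\<close>
  near \<open>s\<close>, lying in a common set whose infimum is near \<open>s\<close>, have a
  midpoint that cannot be much smaller, and the identity \<open>par\<close> forces them to be close.
  No linear structure is needed, only the operation \<open>mid\<close>.\<close>

lemma midpoint_minimizing_sequence:
  fixes C :: "nat \<Rightarrow> 'v set" and Q :: "'v \<Rightarrow> real" and D :: "'v \<Rightarrow> 'v \<Rightarrow> real" and mid :: "'v \<Rightarrow> 'v \<Rightarrow> 'v"
  assumes dec: "\<And>m n. m \<le> n \<Longrightarrow> C n \<subseteq> C m" and ne: "\<And>n. C n \<noteq> {}"
    and mid: "\<And>n f g. f \<in> C n \<Longrightarrow> g \<in> C n \<Longrightarrow> mid f g \<in> C n"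
    and Q: "\<And>f. f \<in> C 0 \<Longrightarrow> 0 \<le> Q f" "\<And>f. f \<in> C 0 \<Longrightarrow> Q f \<le> K"
    and par: "\<And>f g. f \<in> C 0 \<Longrightarrow> g \<in> C 0 \<Longrightarrow> D f g = 2 * Q f + 2 * Q g - 4 * Q (mid f g)"
  obtains h where "\<And>i. h i \<in> C i" "\<And>i. D (h i) (h (Suc i)) \<le> (1 / 4) ^ i"
proof -
  define \<mu> where "\<mu> n = Inf (Q ` C n)" for n
  have C0: "f \<in> C n \<Longrightarrow> f \<in> C 0" for f n
    using dec[of 0 n] by auto
  have bdd: "bdd_below (Q ` C n)" for n
    using Q(1) C0 by (intro bdd_belowI[of _ 0]) auto
  have \<mu>_le: "f \<in> C n \<Longrightarrow> \<mu> n \<le> Q f" for f n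
    unfolding \<mu>_def using bdd by (intro cInf_lower) auto
  have \<mu>_mono: "m \<le> n \<Longrightarrow> \<mu> m \<le> \<mu> n" for m n
    unfolding \<mu>_def using ne[of n] bdd[of m] dec[of m n] by (intro cInf_superset_mono image_mono) auto
  have \<mu>_K: "\<mu> n \<le> K" for n
  proof -
    obtain f where "f \<in> C n"
      using ne by blast
    then show ?thesis
      using \<mu>_le[of f n] Q(2)[of f] C0[of f n] by linarith
  qed
  then have bdd': "bdd_above (range \<mu>)"
    by (intro bdd_aboveI[of _ K]) auto
  define s where "s = (SUP n. \<mu> n)"
  have \<mu>_s: "\<mu> n \<le> s" for n
    unfolding s_def by (intro cSUP_upper bdd') auto
  \<comment> \<open>The identity gives at most
    \<open>2 * (s + e i) + 2 * (s + e i) - 4 * (s - e i) = 8 * e i\<close>. The ratio 1/4 is chosen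
    so that the distances, which are square roots, decay like the summable
    \<open>(1 / 2) ^ i\<close>.\<close>
  define e :: "nat \<Rightarrow> real" where "e i = (1 / 4) ^ i / 8" for i
  have e0: "0 < e i" for i
    by (simp add: e_def)
  \<comment> \<open>The set from which \<open>h\<close> is taken may lie much deeper than
    \<open>i\<close>: its index \<open>r\<close> must be so large that the infimum has almost
    reached \<open>s\<close>.\<close>
  have "\<exists>h. h \<in> C i \<and> (\<exists>r\<ge>i. h \<in> C r \<and> s - e i < \<mu> r \<and> Q h < s + e i)" for i
  proof -
    have "s - e i < (SUP n. \<mu> n)"
      using e0[of i] by (simp add: s_def)
    then obtain r0 where "s - e i < \<mu> r0"
      using less_cSUP_iff[OF _ bdd'] by auto
    then have r: "s - e i < \<mu> (max r0 i)"
      using \<mu>_mono[of r0 "max r0 i"] by simp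
    have "Inf (Q ` C (max r0 i)) < s + e i"
      using \<mu>_s[of "max r0 i"] e0[of i] by (simp add: \<mu>_def)
    then obtain h where "h \<in> C (max r0 i)" "Q h < s + e i"
      using cInf_less_iff[OF _ bdd] ne by auto
    then show ?thesis
      using r dec[of i "max r0 i"] by (intro exI[of _ h] conjI exI[of _ "max r0 i"]) auto
  qed
  then obtain h where h: "\<And>i. h i \<in> C i" "\<And>i. \<exists>r\<ge>i. h i \<in> C r \<and> s - e i < \<mu> r \<and> Q (h i) < s + e i"
    by metis
  have "D (h i) (h (Suc i)) \<le> (1 / 4) ^ i" for i
  proof -
    obtain r where r: "h i \<in> C r" "s - e i < \<mu> r" "Q (h i) < s + e i"
      using h(2) by blast
    obtain r' where r': "h (Suc i) \<in> C r'" "s - e (Suc i) < \<mu> r'" "Q (h (Suc i)) < s + e (Suc i)"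
      using h(2) by blast
    have e: "e (Suc i) \<le> e i"
      by (simp add: e_def)
    have "h i \<in> C (min r r')" "h (Suc i) \<in> C (min r r')"
      using r(1) r'(1) dec[of "min r r'" r] dec[of "min r r'" r'] by auto
    then have "\<mu> (min r r') \<le> Q (mid (h i) (h (Suc i)))"
      by (intro \<mu>_le mid)
    \<comment> \<open>Both near-minimisers lie in the larger set, the one with index
      \<open>min r r'\<close>; its infimum is \<open>\<mu> r\<close> or \<open>\<mu> r'\<close>, and
      either is above \<open>s - e i\<close>.\<close>
    moreover have "s - e i < \<mu> (min r r')"
      using r(2) r'(2) e by (cases "r \<le> r'") (auto simp: min_def)
    moreover have "D (h i) (h (Suc i)) = 2 * Q (h i) + 2 * Q (h (Suc i)) - 4 * Q (mid (h i) (h (Suc i)))"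
      using h(1) C0 by (intro par) auto
    ultimately have "D (h i) (h (Suc i)) \<le> 8 * e i"
      using r(3) r'(3) e by linarith
    then show ?thesis
      by (simp add: e_def)
  qed
  with h(1) show ?thesis
    by (rule that)
qed

text \<open>The sum of the absolute increments has finite integral, hence is finite almost
  everywhere, and the sequence telescopes.\<close>

lemma AE_convergent_of_summable_L1:
  fixes f :: "nat \<Rightarrow> 'a \<Rightarrow> real"
  assumes f: "\<And>n. integrable M (f n)" and sum: "summable (\<lambda>n. \<integral>x. \<bar>f (Suc n) x - f n x\<bar> \<partial>M)"
  shows "AE x in M. convergent (\<lambda>n. f n x)"
proof -
  have [measurable]: "f n \<in> borel_measurable M" for n
    using f by auto
  have "(\<integral>\<^sup>+x. (\<Sum>n. ennreal \<bar>f (Suc n) x - f n x\<bar>) \<partial>M) = (\<Sum>n. \<integral>\<^sup>+x. ennreal \<bar>f (Suc n) x - f n x\<bar> \<partial>M)"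
    by (rule nn_integral_suminf) measurable
  also have "\<dots> = (\<Sum>n. ennreal (\<integral>x. \<bar>f (Suc n) x - f n x\<bar> \<partial>M))"
    by (intro suminf_cong nn_integral_eq_integral integrable_abs Bochner_Integration.integrable_diff f) simp
  also have "\<dots> = ennreal (\<Sum>n. \<integral>x. \<bar>f (Suc n) x - f n x\<bar> \<partial>M)"
    by (rule suminf_ennreal2[OF _ sum]) simp
  finally have fin: "(\<integral>\<^sup>+x. (\<Sum>n. ennreal \<bar>f (Suc n) x - f n x\<bar>) \<partial>M) \<noteq> \<infinity>"
    by simp
  have "AE x in M. (\<Sum>n. ennreal \<bar>f (Suc n) x - f n x\<bar>) \<noteq> \<infinity>"
    by (rule nn_integral_noteq_infinite[OF _ fin]) measurable
  then show ?thesis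
  proof eventually_elim
    fix x assume "(\<Sum>n. ennreal \<bar>f (Suc n) x - f n x\<bar>) \<noteq> \<infinity>"
    then have "summable (\<lambda>n. \<bar>f (Suc n) x - f n x\<bar>)"
      by (intro summable_suminf_not_top) auto
    then have "summable (\<lambda>n. f (Suc n) x - f n x)"
      by (rule summable_rabs_cancel)
    then have "convergent (\<lambda>n. f n x - f 0 x)"
      unfolding summable_iff_convergent sum_lessThan_telescope[of "\<lambda>n. f n x"] .
    then have "convergent (\<lambda>n. f n x - f 0 x + f 0 x)"
      by (rule convergent_add[OF _ convergent_const])
    then show "convergent (\<lambda>n. f n x)"
      by simp
  qed
qed

text \<open>\<open>sgn (u - q)\<close> is a subgradient of the convex function
  \<open>\<lambda>u. norm (u - q)\<close>. At \<open>u = q\<close> the convention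
  \<open>sgn 0 = 0\<close> still gives one, so visits to \<open>q\<close> need no separate
  treatment.\<close>

lemma norm_subgradient:
  fixes u v q :: "'a::real_inner"
  shows "norm (u - q) + sgn (u - q) \<bullet> (v - u) \<le> norm (v - q)"
proof -
  have "sgn (u - q) \<bullet> (u - q) = norm (u - q)"
  proof (cases "u = q")
    case False
    then show ?thesis
      by (simp add: sgn_div_norm dot_square_norm power2_eq_square)
  qed simp
  moreover have "sgn (u - q) \<bullet> (v - q) \<le> norm (sgn (u - q)) * norm (v - q)"
    by (rule norm_cauchy_schwarz)
  moreover have "\<dots> \<le> 1 * norm (v - q)"
    by (intro mult_right_mono) (auto simp: norm_sgn)
  ultimately show ?thesis
    by (simp add: inner_diff_right algebra_simps)
qed

text \<open>The drift \<open>X - I\<close> is seen only through a continuous increasing process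
  \<open>A\<close> that dominates its variation. Neither a Brownian motion nor coefficients occur,
  and no integrability of \<open>A\<close> is assumed.\<close>

locale martingale_plus_drift = stochastic_basis M F
  for M :: "'w measure" and F :: "real \<Rightarrow> 'w measure" +
  fixes X I :: "real \<Rightarrow> 'w \<Rightarrow> 'a::euclidean_space" and A :: "real \<Rightarrow> 'w \<Rightarrow> real" and q :: 'a
  assumes X: "adapted F X" "continuous_process M X"
    and I: "\<And>b. b \<in> Basis \<Longrightarrow> sq_martingale M F (\<lambda>t \<omega>. I t \<omega> \<bullet> b)"
    and A: "adapted F A" "continuous_process M A"
    and A_mono: "\<And>\<omega> s t. \<omega> \<in> space M \<Longrightarrow> 0 \<le> s \<Longrightarrow> s \<le> t \<Longrightarrow> A s \<omega> \<le> A t \<omega>"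
    and A_0: "\<And>\<omega>. \<omega> \<in> space M \<Longrightarrow> A 0 \<omega> = 0"
    and drift: "AE \<omega> in M. \<forall>s\<ge>0. \<forall>t\<ge>s. norm ((X t \<omega> - I t \<omega>) - (X s \<omega> - I s \<omega>)) \<le> A t \<omega> - A s \<omega>"
begin

definition Y :: "real \<Rightarrow> 'w \<Rightarrow> real" where
  "Y t \<omega> = norm (X t \<omega> - q) + A t \<omega>"

text \<open>The left-endpoint Riemann sum on the grid of mesh \<open>1 / 2 ^ n\<close> for the
  stochastic integral of \<open>sgn (X - q)\<close> against \<open>I\<close>, stopped at
  \<open>t\<close>.\<close>

definition approx :: "nat \<Rightarrow> real \<Rightarrow> 'w \<Rightarrow> real" where
  "approx n t \<omega> = (\<Sum>j<nat \<lceil>t * 2 ^ n\<rceil>. sgn (X (real j / 2 ^ n) \<omega> - q) \<bullet>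
      (I (min t (real (Suc j) / 2 ^ n)) \<omega> - I (min t (real j / 2 ^ n)) \<omega>))"

text \<open>Cells that start at or after \<open>t\<close> contribute 0. Hence one number
  \<open>K\<close> of summands serves for all times up to a bound, as
  \<open>sq_martingale_local\<close> requires.\<close>

lemma approx_eq:
  assumes "t * 2 ^ n \<le> real K"
  shows "approx n t \<omega> = (\<Sum>j<K. sgn (X (real j / 2 ^ n) \<omega> - q) \<bullet>
      (I (min t (real (Suc j) / 2 ^ n)) \<omega> - I (min t (real j / 2 ^ n)) \<omega>))"
  unfolding approx_def
proof (rule sum.mono_neutral_left)
  show "{..<nat \<lceil>t * 2 ^ n\<rceil>} \<subseteq> {..<K}"
    using assms by (auto simp: nat_le_iff ceiling_le_iff)
  show "\<forall>j\<in>{..<K} - {..<nat \<lceil>t * 2 ^ n\<rceil>}. sgn (X (real j / 2 ^ n) \<omega> - q) \<bullet>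
      (I (min t (real (Suc j) / 2 ^ n)) \<omega> - I (min t (real j / 2 ^ n)) \<omega>) = 0"
  proof
    fix j assume "j \<in> {..<K} - {..<nat \<lceil>t * 2 ^ n\<rceil>}"
    then have "t * 2 ^ n \<le> real j"
      by (simp add: not_less nat_le_iff ceiling_le_iff)
    then have "t \<le> real j / 2 ^ n" "t \<le> real (Suc j) / 2 ^ n"
      by (simp_all add: field_simps)
    then show "sgn (X (real j / 2 ^ n) \<omega> - q) \<bullet>
      (I (min t (real (Suc j) / 2 ^ n)) \<omega> - I (min t (real j / 2 ^ n)) \<omega>) = 0"
      by (simp add: min_absorb1)
  qed
qed simp

lemma approx_Suc:
  "approx n (real (Suc j) / 2 ^ n) \<omega> = approx n (real j / 2 ^ n) \<omega> +
    sgn (X (real j / 2 ^ n) \<omega> - q) \<bullet> (I (real (Suc j) / 2 ^ n) \<omega> - I (real j / 2 ^ n) \<omega>)"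
proof -
  have le: "real a / 2 ^ n \<le> real b / 2 ^ n \<longleftrightarrow> a \<le> b" for a b
    by (simp add: divide_le_cancel)
  have "approx n (real (Suc j) / 2 ^ n) \<omega> = (\<Sum>i<Suc j. sgn (X (real i / 2 ^ n) \<omega> - q) \<bullet>
      (I (real (Suc i) / 2 ^ n) \<omega> - I (real i / 2 ^ n) \<omega>))"
    by (subst approx_eq[of _ _ "Suc j"]) (auto simp: min_absorb2 le simp del: of_nat_Suc intro!: sum.cong)
  moreover have "approx n (real j / 2 ^ n) \<omega> = (\<Sum>i<j. sgn (X (real i / 2 ^ n) \<omega> - q) \<bullet>
      (I (real (Suc i) / 2 ^ n) \<omega> - I (real i / 2 ^ n) \<omega>))"
    by (subst approx_eq[of _ _ j]) (auto simp: min_absorb2 le simp del: of_nat_Suc intro!: sum.cong)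
  ultimately show ?thesis
    by simp
qed

lemma approx_0: "approx n 0 \<omega> = 0"
  by (simp add: approx_def)

lemma sq_martingale_approx: "sq_martingale M F (approx n)"
proof (rule sq_martingale_local)
  fix T :: real assume T: "0 \<le> T"
  define K where "K = nat \<lceil>T * 2 ^ n\<rceil>"
  \<comment> \<open>The inner product is expanded in coordinates so that every term becomes a scalar
    block; a coordinate of a sign vector is bounded by 1.\<close>
  let ?N = "\<lambda>t \<omega>. \<Sum>j<K. \<Sum>b\<in>Basis. (sgn (X (real j / 2 ^ n) \<omega> - q) \<bullet> b) *
      (I (min t (real (Suc j) / 2 ^ n)) \<omega> \<bullet> b - I (min t (real j / 2 ^ n)) \<omega> \<bullet> b)"
  have "sq_martingale M F ?N"
  proof (rule sq_martingale_sum, simp, rule sq_martingale_sum, simp)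
    fix j and b :: 'a assume b: "b \<in> Basis"
    have [measurable]: "X (real j / 2 ^ n) \<in> borel_measurable (F (real j / 2 ^ n))"
      using X(1) by (simp add: adapted_def)
    have e: "(\<lambda>\<omega>. sgn (X (real j / 2 ^ n) \<omega> - q) \<bullet> b) \<in> borel_measurable (F (real j / 2 ^ n))"
      unfolding sgn_div_norm by measurable
    have "\<bar>sgn (X (real j / 2 ^ n) \<omega> - q) \<bullet> b\<bar> \<le> 1" for \<omega>
      by (rule order_trans[OF Basis_le_norm[OF b]]) (auto simp: norm_sgn)
    then show "sq_martingale M F (\<lambda>t \<omega>. (sgn (X (real j / 2 ^ n) \<omega> - q) \<bullet> b) *
        (I (min t (real (Suc j) / 2 ^ n)) \<omega> \<bullet> b - I (min t (real j / 2 ^ n)) \<omega> \<bullet> b))"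
      by (intro sq_martingale_block[OF I[OF b] _ _ e, where B=1]) (simp_all add: divide_right_mono)
  qed
  moreover have "\<forall>t\<in>{0..T}. \<forall>\<omega>\<in>space M. approx n t \<omega> = ?N t \<omega>"
  proof (intro ballI)
    fix t \<omega> assume "t \<in> {0..T}"
    then have "t * 2 ^ n \<le> T * 2 ^ n"
      by simp
    also have "\<dots> \<le> real K"
      unfolding K_def by linarith
    finally show "approx n t \<omega> = ?N t \<omega>"
      by (subst approx_eq, assumption, intro sum.cong refl, subst euclidean_inner)
        (simp add: inner_diff_left)
  qed
  ultimately show "\<exists>N'. sq_martingale M F N' \<and> (\<forall>t\<in>{0..T}. \<forall>\<omega>\<in>space M. approx n t \<omega> = N' t \<omega>)"
    by blast
qed

section \<open>Second moments of the grid martingales and monotonicity along the grid\<close>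

definition energy :: "real \<Rightarrow> real" where
  "energy t = (\<Sum>b\<in>Basis. \<integral>\<omega>. (I t \<omega> \<bullet> b)\<^sup>2 \<partial>M)"

lemma energy_nonneg: "0 \<le> energy t"
  unfolding energy_def by (intro sum_nonneg) simp

text \<open>On each cell an increment of \<open>approx n\<close> is the inner product of the
  increment of \<open>I\<close> with a vector of norm at most 1, and on both sides squared
  increments add up by orthogonality. The bound does not depend on \<open>n\<close>, and integer
  times lie on every grid.\<close>

lemma approx_energy_grid: "(\<integral>\<omega>. (approx n (real j / 2 ^ n) \<omega>)\<^sup>2 \<partial>M) \<le> energy (real j / 2 ^ n)"
proof (induction j)
  case 0
  then show ?case
    by (simp add: approx_0 energy_nonneg)
next
  case (Suc j)
  define s t where "s = real j / 2 ^ n" and "t = real (Suc j) / 2 ^ n"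
  have st: "0 \<le> s" "s \<le> t" "0 \<le> t"
    by (auto simp: s_def t_def field_simps)
  note N = sq_martingale_approx[of n]
  have iI: "integrable M (\<lambda>\<omega>. (I t \<omega> \<bullet> b - I s \<omega> \<bullet> b)\<^sup>2)" if "b \<in> Basis" for b
    using st by (intro integrable_square_diff sq_martingaleD[OF I[OF that]])
  have "(\<integral>\<omega>. (approx n t \<omega> - approx n s \<omega>)\<^sup>2 \<partial>M) \<le> (\<integral>\<omega>. (\<Sum>b\<in>Basis. (I t \<omega> \<bullet> b - I s \<omega> \<bullet> b)\<^sup>2) \<partial>M)"
  proof (rule integral_mono)
    show "integrable M (\<lambda>\<omega>. (approx n t \<omega> - approx n s \<omega>)\<^sup>2)"
      using st by (intro integrable_square_diff sq_martingaleD[OF N])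
    show "integrable M (\<lambda>\<omega>. \<Sum>b\<in>Basis. (I t \<omega> \<bullet> b - I s \<omega> \<bullet> b)\<^sup>2)"
      using iI by simp
    fix \<omega>
    let ?e = "sgn (X s \<omega> - q)" and ?d = "I t \<omega> - I s \<omega>"
    have "\<bar>?e \<bullet> ?d\<bar> \<le> norm ?e * norm ?d"
      by (rule Cauchy_Schwarz_ineq2)
    also have "\<dots> \<le> 1 * norm ?d"
      by (intro mult_right_mono) (auto simp: norm_sgn)
    finally have "(?e \<bullet> ?d)\<^sup>2 \<le> (norm ?d)\<^sup>2"
      by (simp add: abs_le_square_iff[symmetric])
    also have "\<dots> = (\<Sum>b\<in>Basis. (I t \<omega> \<bullet> b - I s \<omega> \<bullet> b)\<^sup>2)"
      unfolding power2_norm_eq_inner by (subst euclidean_inner) (simp add: power2_eq_square inner_diff_left)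
    finally show "(approx n t \<omega> - approx n s \<omega>)\<^sup>2 \<le> (\<Sum>b\<in>Basis. (I t \<omega> \<bullet> b - I s \<omega> \<bullet> b)\<^sup>2)"
      unfolding t_def approx_Suc by (simp add: s_def)
  qed
  also have "\<dots> = (\<Sum>b\<in>Basis. \<integral>\<omega>. (I t \<omega> \<bullet> b - I s \<omega> \<bullet> b)\<^sup>2 \<partial>M)"
    using iI by simp
  also have "\<dots> = (\<Sum>b\<in>Basis. (\<integral>\<omega>. (I t \<omega> \<bullet> b)\<^sup>2 \<partial>M) - (\<integral>\<omega>. (I s \<omega> \<bullet> b)\<^sup>2 \<partial>M))"
    using st by (intro sum.cong refl sq_martingale_pythagoras I)
  also have "\<dots> = energy t - energy s"
    by (simp add: energy_def sum_subtractf)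
  finally show ?case
    using Suc.IH sq_martingale_pythagoras[OF N st(1,2)] unfolding s_def[symmetric] t_def[symmetric] by linarith
qed

lemma approx_energy: "(\<integral>\<omega>. (approx n (real k) \<omega>)\<^sup>2 \<partial>M) \<le> energy (real k)"
  using approx_energy_grid[of n "k * 2 ^ n"] by simp

text \<open>Over one cell the norm grows at least by
  \<open>?e \<bullet> (X t \<omega> - X s \<omega>)\<close>, where the martingale part is exactly
  the increment of \<open>approx n\<close> and the drift part is at least
  \<open>- (A t \<omega> - A s \<omega>)\<close>. The summand \<open>A\<close> in \<open>Y\<close>
  compensates the latter.\<close>

lemma AE_Y_minus_approx_mono:
  "AE \<omega> in M. \<forall>i j. i \<le> j \<longrightarrow> Y (real i / 2 ^ n) \<omega> - approx n (real i / 2 ^ n) \<omega>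
    \<le> Y (real j / 2 ^ n) \<omega> - approx n (real j / 2 ^ n) \<omega>"
  using drift
proof eventually_elim
  fix \<omega>
  assume d: "\<forall>s\<ge>0. \<forall>t\<ge>s. norm ((X t \<omega> - I t \<omega>) - (X s \<omega> - I s \<omega>)) \<le> A t \<omega> - A s \<omega>"
  have "Y (real i / 2 ^ n) \<omega> - approx n (real i / 2 ^ n) \<omega>
    \<le> Y (real (Suc i) / 2 ^ n) \<omega> - approx n (real (Suc i) / 2 ^ n) \<omega>" for i
  proof -
    define s t where "s = real i / 2 ^ n" and "t = real (Suc i) / 2 ^ n"
    let ?e = "sgn (X s \<omega> - q)" and ?v = "(X t \<omega> - I t \<omega>) - (X s \<omega> - I s \<omega>)"
    have "0 \<le> s" "s \<le> t"
      by (auto simp: s_def t_def field_simps)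
    then have v: "norm ?v \<le> A t \<omega> - A s \<omega>"
      using d by blast
    have "\<bar>?e \<bullet> ?v\<bar> \<le> norm ?e * norm ?v"
      by (rule Cauchy_Schwarz_ineq2)
    also have "\<dots> \<le> 1 * norm ?v"
      by (intro mult_right_mono) (auto simp: norm_sgn)
    finally have "?e \<bullet> (I t \<omega> - I s \<omega>) - (A t \<omega> - A s \<omega>) \<le> ?e \<bullet> (X t \<omega> - X s \<omega>)"
      using v by (auto simp: inner_diff_right)
    then show ?thesis
      using norm_subgradient[of "X s \<omega>" q "X t \<omega>"] approx_Suc[of n i \<omega>]
      unfolding s_def[symmetric] t_def[symmetric] Y_def by linarith
  qed
  then show "\<forall>i j. i \<le> j \<longrightarrow> Y (real i / 2 ^ n) \<omega> - approx n (real i / 2 ^ n) \<omega>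
    \<le> Y (real j / 2 ^ n) \<omega> - approx n (real j / 2 ^ n) \<omega>"
    using lift_Suc_mono_le[of "\<lambda>i. Y (real i / 2 ^ n) \<omega> - approx n (real i / 2 ^ n) \<omega>"] by blast
qed

text \<open>The energy bound is required at integer times because these belong to all grids, so the
  same bound is available for every \<open>approx n\<close>. At other times second moments are
  controlled by those at a later integer, by \<open>sq_martingale_mono\<close>.\<close>

definition candidates :: "nat \<Rightarrow> (real \<Rightarrow> 'w \<Rightarrow> real) set" where
  "candidates n = {N. sq_martingale M F N \<and>
     (\<forall>k. (\<integral>\<omega>. (N (real k) \<omega>)\<^sup>2 \<partial>M) \<le> energy (real k)) \<and>
     (AE \<omega> in M. \<forall>i j. i \<le> j \<longrightarrow> Y (real i / 2 ^ n) \<omega> - N (real i / 2 ^ n) \<omega>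
        \<le> Y (real j / 2 ^ n) \<omega> - N (real j / 2 ^ n) \<omega>)}"

lemma approx_candidate: "approx n \<in> candidates n"
  unfolding candidates_def using sq_martingale_approx approx_energy AE_Y_minus_approx_mono by blast

lemma candidates_antimono:
  assumes "m \<le> n"
  shows "candidates n \<subseteq> candidates m"
proof
  fix N assume N: "N \<in> candidates n"
  have "(2::real) ^ n = 2 ^ m * 2 ^ (n - m)"
    using assms by (simp flip: power_add)
  then have eq: "real i / 2 ^ m = real (i * 2 ^ (n - m)) / 2 ^ n" for i
    by simp
  have "AE \<omega> in M. \<forall>i j. i \<le> j \<longrightarrow> Y (real i / 2 ^ n) \<omega> - N (real i / 2 ^ n) \<omega>
        \<le> Y (real j / 2 ^ n) \<omega> - N (real j / 2 ^ n) \<omega>"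
    using N by (simp add: candidates_def)
  then have "AE \<omega> in M. \<forall>i j. i \<le> j \<longrightarrow> Y (real i / 2 ^ m) \<omega> - N (real i / 2 ^ m) \<omega>
        \<le> Y (real j / 2 ^ m) \<omega> - N (real j / 2 ^ m) \<omega>"
  proof eventually_elim
    case (elim \<omega>)
    show ?case
      unfolding eq using elim mult_le_mono1 by blast
  qed
  then show "N \<in> candidates m"
    using N by (simp add: candidates_def)
qed

lemma candidates_midpoint:
  assumes f: "f \<in> candidates n" and g: "g \<in> candidates n"
  shows "(\<lambda>t \<omega>. (f t \<omega> + g t \<omega>) / 2) \<in> candidates n"
  unfolding candidates_def
proof (intro CollectI conjI allI)
  have F': "sq_martingale M F f" and G': "sq_martingale M F g"
    using f g by (auto simp: candidates_def)
  show "sq_martingale M F (\<lambda>t \<omega>. (f t \<omega> + g t \<omega>) / 2)"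
    using sq_martingale_cmult[OF sq_martingale_add[OF F' G'], of "1 / 2"] by simp
  show "(\<integral>\<omega>. ((f (real k) \<omega> + g (real k) \<omega>) / 2)\<^sup>2 \<partial>M) \<le> energy (real k)" for k
  proof -
    have "0 \<le> (\<integral>\<omega>. (f (real k) \<omega> - g (real k) \<omega>)\<^sup>2 \<partial>M)"
      by simp
    moreover have "(\<integral>\<omega>. (f (real k) \<omega>)\<^sup>2 \<partial>M) \<le> energy (real k)" "(\<integral>\<omega>. (g (real k) \<omega>)\<^sup>2 \<partial>M) \<le> energy (real k)"
      using f g by (auto simp: candidates_def)
    ultimately show ?thesis
      unfolding integral_midpoint_sq[OF sq_martingaleD(2)[OF F' of_nat_0_le_iff] sq_martingaleD(2)[OF G' of_nat_0_le_iff]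
          sq_martingaleD(3)[OF F' of_nat_0_le_iff] sq_martingaleD(3)[OF G' of_nat_0_le_iff]]
      by argo
  qed
  have "AE \<omega> in M. \<forall>i j. i \<le> j \<longrightarrow> Y (real i / 2 ^ n) \<omega> - f (real i / 2 ^ n) \<omega>
        \<le> Y (real j / 2 ^ n) \<omega> - f (real j / 2 ^ n) \<omega>"
    "AE \<omega> in M. \<forall>i j. i \<le> j \<longrightarrow> Y (real i / 2 ^ n) \<omega> - g (real i / 2 ^ n) \<omega>
        \<le> Y (real j / 2 ^ n) \<omega> - g (real j / 2 ^ n) \<omega>"
    using f g by (auto simp: candidates_def)
  then show "AE \<omega> in M. \<forall>i j. i \<le> j \<longrightarrow>
      Y (real i / 2 ^ n) \<omega> - (f (real i / 2 ^ n) \<omega> + g (real i / 2 ^ n) \<omega>) / 2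
        \<le> Y (real j / 2 ^ n) \<omega> - (f (real j / 2 ^ n) \<omega> + g (real j / 2 ^ n) \<omega>) / 2"
  proof eventually_elim
    case (elim \<omega>)
    show ?case
    proof (intro allI impI)
      fix i j :: nat assume "i \<le> j"
      then have "Y (real i / 2 ^ n) \<omega> - f (real i / 2 ^ n) \<omega> \<le> Y (real j / 2 ^ n) \<omega> - f (real j / 2 ^ n) \<omega>"
        "Y (real i / 2 ^ n) \<omega> - g (real i / 2 ^ n) \<omega> \<le> Y (real j / 2 ^ n) \<omega> - g (real j / 2 ^ n) \<omega>"
        using elim by auto
      then show "Y (real i / 2 ^ n) \<omega> - (f (real i / 2 ^ n) \<omega> + g (real i / 2 ^ n) \<omega>) / 2
        \<le> Y (real j / 2 ^ n) \<omega> - (f (real j / 2 ^ n) \<omega> + g (real j / 2 ^ n) \<omega>) / 2"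
        by argo
    qed
  qed
qed

text \<open>The weights make the energy bounds of the candidates at all integer times summable.\<close>

definition weight :: "nat \<Rightarrow> real" where
  "weight k = (1 / 2) ^ k / (1 + energy (real k))"

lemma weight_pos: "0 < weight k"
  using energy_nonneg[of "real k"] by (simp add: weight_def)

lemma weight_energy: "weight k * energy (real k) \<le> (1 / 2) ^ k"
proof -
  have "(1 / 2 :: real) ^ k * (energy (real k) / (1 + energy (real k))) \<le> (1 / 2) ^ k * 1"
    using energy_nonneg[of "real k"] by (intro mult_left_mono) (simp_all add: divide_le_eq)
  then show ?thesis
    by (simp add: weight_def)
qed

definition size2 :: "(real \<Rightarrow> 'w \<Rightarrow> real) \<Rightarrow> real" where
  "size2 N = (\<Sum>k. weight k * (\<integral>\<omega>. (N (real k) \<omega>)\<^sup>2 \<partial>M))"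

text \<open>Comparison with the geometric series of ratio 1/2, whose sum is 2. Summability has to be
  established along with the bound, since the value of \<open>suminf\<close> says nothing about a
  divergent series.\<close>

lemma
  assumes "N \<in> candidates n"
  shows candidates_summable: "summable (\<lambda>k. weight k * (\<integral>\<omega>. (N (real k) \<omega>)\<^sup>2 \<partial>M))"
    and size2_le: "size2 N \<le> 2"
    and size2_nonneg: "0 \<le> size2 N"
proof -
  have le: "weight k * (\<integral>\<omega>. (N (real k) \<omega>)\<^sup>2 \<partial>M) \<le> (1 / 2) ^ k" for k
  proof -
    have "(\<integral>\<omega>. (N (real k) \<omega>)\<^sup>2 \<partial>M) \<le> energy (real k)"
      using assms by (simp add: candidates_def)
    then show ?thesis
      using weight_energy[of k] weight_pos[of k] by (meson mult_left_mono order_trans less_imp_le)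
  qed
  have nn: "0 \<le> weight k * (\<integral>\<omega>. (N (real k) \<omega>)\<^sup>2 \<partial>M)" for k
    using weight_pos[of k] by simp
  have geo: "summable (\<lambda>k. (1 / 2 :: real) ^ k)"
    by (rule summable_geometric) simp
  show s: "summable (\<lambda>k. weight k * (\<integral>\<omega>. (N (real k) \<omega>)\<^sup>2 \<partial>M))"
    using le nn by (intro summable_comparison_test'[OF geo, of 0]) (simp add: abs_of_nonneg)
  show "size2 N \<le> 2"
    unfolding size2_def using suminf_le[OF le s geo] suminf_geometric[of "1 / 2 :: real"] by simp
  show "0 \<le> size2 N"
    unfolding size2_def using nn s by (intro suminf_nonneg)
qed

text \<open>The identity holds term by term. The difference of two candidates need not be a
  candidate, so its summability is also derived from this identity, whose right-hand side involves
  candidates only.\<close>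

lemma size2_parallelogram:
  assumes f: "f \<in> candidates n" and g: "g \<in> candidates n"
  shows "summable (\<lambda>k. weight k * (\<integral>\<omega>. (f (real k) \<omega> - g (real k) \<omega>)\<^sup>2 \<partial>M))"
    and "size2 (\<lambda>t \<omega>. f t \<omega> - g t \<omega>) =
      2 * size2 f + 2 * size2 g - 4 * size2 (\<lambda>t \<omega>. (f t \<omega> + g t \<omega>) / 2)"
proof -
  have F': "sq_martingale M F f" and G': "sq_martingale M F g"
    using f g by (auto simp: candidates_def)
  let ?i = "\<lambda>N k. weight k * (\<integral>\<omega>. (N (real k) \<omega>)\<^sup>2 \<partial>M)"
  let ?d = "\<lambda>t \<omega>. f t \<omega> - g t \<omega>" and ?m = "\<lambda>t \<omega>. (f t \<omega> + g t \<omega>) / 2"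
  have eq: "?i ?d k = 2 * ?i f k + 2 * ?i g k - 4 * ?i ?m k" for k
    unfolding integral_midpoint_sq[OF sq_martingaleD(2)[OF F' of_nat_0_le_iff] sq_martingaleD(2)[OF G' of_nat_0_le_iff]
          sq_martingaleD(3)[OF F' of_nat_0_le_iff] sq_martingaleD(3)[OF G' of_nat_0_le_iff]]
    by (simp add: field_simps)
  note s = candidates_summable[OF f] candidates_summable[OF g] candidates_summable[OF candidates_midpoint[OF f g]]
  have "(\<lambda>k. 2 * ?i f k + 2 * ?i g k - 4 * ?i ?m k) sums (2 * size2 f + 2 * size2 g - 4 * size2 ?m)"
    unfolding size2_def using s by (intro sums_diff sums_add sums_mult summable_sums)
  then have "?i ?d sums (2 * size2 f + 2 * size2 g - 4 * size2 ?m)"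
    unfolding eq .
  then show "summable (?i ?d)" "size2 ?d = 2 * size2 f + 2 * size2 g - 4 * size2 ?m"
    unfolding size2_def by (auto simp: sums_iff)
qed

lemma limit_martingale:
  obtains L where "sq_martingale M F L"
    and "AE \<omega> in M. \<forall>n i j. i \<le> j \<longrightarrow> Y (real i / 2 ^ n) \<omega> - L (real i / 2 ^ n) \<omega>
        \<le> Y (real j / 2 ^ n) \<omega> - L (real j / 2 ^ n) \<omega>"
proof -
  obtain h where h: "\<And>i. h i \<in> candidates i"
    and hd: "\<And>i. size2 (\<lambda>t \<omega>. h i t \<omega> - h (Suc i) t \<omega>) \<le> (1 / 4) ^ i"
  proof (rule midpoint_minimizing_sequence[of candidates "\<lambda>f g t \<omega>. (f t \<omega> + g t \<omega>) / 2" size2 2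
        "\<lambda>f g. size2 (\<lambda>t \<omega>. f t \<omega> - g t \<omega>)"])
    show "candidates n \<noteq> {}" for n
      using approx_candidate by blast
    show "candidates n \<subseteq> candidates m" if "m \<le> n" for m n
      using that by (rule candidates_antimono)
    show "size2 (\<lambda>t \<omega>. f t \<omega> - g t \<omega>) =
        2 * size2 f + 2 * size2 g - 4 * size2 (\<lambda>t \<omega>. (f t \<omega> + g t \<omega>) / 2)"
      if "f \<in> candidates 0" "g \<in> candidates 0" for f g
      by (rule size2_parallelogram(2)[OF that])
    show "0 \<le> size2 f" "size2 f \<le> 2" if "f \<in> candidates 0" for f
      using size2_nonneg[OF that] size2_le[OF that] .
  qed (blast intro: candidates_midpoint)+
  have hm: "sq_martingale M F (h i)" for i
    using h[of i] by (simp add: candidates_def)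
  have h0: "h i \<in> candidates 0" for i
    using h candidates_antimono[of 0 i] by auto
  \<comment> \<open>One term of the weighted series is at most the whole, which bounds the second
    moment at the integer \<open>k\<close> by \<open>(1 / 4) ^ i / weight k\<close>. It then holds
    at all earlier times, and the square root bounds the first absolute moment.\<close>
  have step: "(\<integral>\<omega>. \<bar>h (Suc i) t \<omega> - h i t \<omega>\<bar> \<partial>M) \<le> (1 / 2) ^ i / sqrt (weight k)"
    if t: "0 \<le> t" "t \<le> real k" for i t k
  proof -
    let ?d = "\<lambda>t \<omega>. h i t \<omega> - h (Suc i) t \<omega>"
    have d: "sq_martingale M F ?d"
      by (rule sq_martingale_diff[OF hm hm])
    have "(\<Sum>k\<in>{k}. weight k * (\<integral>\<omega>. (?d (real k) \<omega>)\<^sup>2 \<partial>M)) \<le> size2 ?d"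
      unfolding size2_def
      using size2_parallelogram(1)[OF h0 h0] weight_pos by (intro sum_le_suminf) (auto simp: less_imp_le)
    then have "weight k * (\<integral>\<omega>. (?d (real k) \<omega>)\<^sup>2 \<partial>M) \<le> (1 / 4) ^ i"
      using hd[of i] by simp
    then have "(\<integral>\<omega>. (?d (real k) \<omega>)\<^sup>2 \<partial>M) \<le> (1 / 4) ^ i / weight k"
      using weight_pos[of k] by (simp add: field_simps)
    moreover have "(\<integral>\<omega>. (?d t \<omega>)\<^sup>2 \<partial>M) \<le> (\<integral>\<omega>. (?d (real k) \<omega>)\<^sup>2 \<partial>M)"
      by (rule sq_martingale_mono[OF d t])
    ultimately have "sqrt (\<integral>\<omega>. (?d t \<omega>)\<^sup>2 \<partial>M) \<le> sqrt ((1 / 4) ^ i / weight k)"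
      by simp
    also have "\<dots> = (1 / 2) ^ i / sqrt (weight k)"
      by (simp add: real_sqrt_divide real_sqrt_power)
    finally have "(\<integral>\<omega>. \<bar>?d t \<omega>\<bar> \<partial>M) \<le> (1 / 2) ^ i / sqrt (weight k)"
      by (rule order_trans[OF expectation_abs_le_sqrt[OF sq_martingaleD(2,3)[OF d t(1)]]])
    then show ?thesis
      by (simp add: abs_minus_commute)
  qed
  have conv: "AE \<omega> in M. convergent (\<lambda>i. h i t \<omega>)" if t: "0 \<le> t" for t
  proof (rule AE_convergent_of_summable_L1)
    show "integrable M (h i t)" for i
      using sq_martingaleD(4)[OF hm t] .
    obtain k where k: "t \<le> real k"
      using real_arch_simple by blast
    show "summable (\<lambda>i. \<integral>\<omega>. \<bar>h (Suc i) t \<omega> - h i t \<omega>\<bar> \<partial>M)"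
    proof (rule summable_comparison_test'[of _ 0])
      show "summable (\<lambda>i. (1 / 2) ^ i / sqrt (weight k))"
        by (intro summable_divide summable_geometric) simp
      show "norm (\<integral>\<omega>. \<bar>h (Suc i) t \<omega> - h i t \<omega>\<bar> \<partial>M) \<le> (1 / 2) ^ i / sqrt (weight k)" for i
        using step[OF t k, of i] by simp
    qed
  qed
  \<comment> \<open>\<open>lim\<close> has an arbitrary default value where the sequence diverges,
    and it is measurable in any case. So \<open>L t\<close> is measurable for \<open>F t\<close>
    without removing a null set.\<close>
  define L where "L t \<omega> = lim (\<lambda>i. h i t \<omega>)" for t \<omega>
  have L: "AE \<omega> in M. (\<lambda>i. h i t \<omega>) \<longlonglongrightarrow> L t \<omega>" if "0 \<le> t" for t
    using conv[OF that] by eventually_elim (simp add: L_def convergent_LIMSEQ_iff)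
  have L_adapted: "adapted F L"
    unfolding adapted_def L_def
  proof (intro allI impI borel_measurable_lim_metric)
    fix t :: real and i assume "0 \<le> t"
    then show "h i t \<in> borel_measurable (F t)"
      using sq_martingaleD(1)[OF hm[of i]] by (simp add: adapted_def)
  qed
  have bnd: "(\<integral>\<omega>. (h i t \<omega>)\<^sup>2 \<partial>M) \<le> energy (real (nat \<lceil>t\<rceil>))" if "0 \<le> t" for i t
  proof -
    have "(\<integral>\<omega>. (h i t \<omega>)\<^sup>2 \<partial>M) \<le> (\<integral>\<omega>. (h i (real (nat \<lceil>t\<rceil>)) \<omega>)\<^sup>2 \<partial>M)"
      using that by (intro sq_martingale_mono hm) linarith+
    then show ?thesis
      using h0[of i] by (auto simp: candidates_def intro: order_trans)
  qed
  note conv' = L2_bounded_convergence[OF sq_martingaleD(2)[OF hm] sq_martingaleD(3)[OF hm] bnd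
      adapted_measurable[OF L_adapted] L]
  have "sq_martingale M F L"
  proof (rule sq_martingale_L1_limit[OF hm L_adapted])
    show "integrable M (\<lambda>\<omega>. (L t \<omega>)\<^sup>2)" if t: "0 \<le> t" for t
      by (rule conv'(1)[OF t t t t t])
    show "(\<lambda>i. \<integral>\<omega>. \<bar>h i t \<omega> - L t \<omega>\<bar> \<partial>M) \<longlonglongrightarrow> 0" if t: "0 \<le> t" for t
      by (rule conv'(3)[OF t t t t t])
  qed
  moreover have "AE \<omega> in M. \<forall>n i j. i \<le> j \<longrightarrow> Y (real i / 2 ^ n) \<omega> - L (real i / 2 ^ n) \<omega>
        \<le> Y (real j / 2 ^ n) \<omega> - L (real j / 2 ^ n) \<omega>"
  proof -
    \<comment> \<open>The exceptional set of the convergence depends on the time; countably many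
      dyadic times share one null set.\<close>
    have "AE \<omega> in M. \<forall>n i. (\<lambda>k. h k (real i / 2 ^ n) \<omega>) \<longlonglongrightarrow> L (real i / 2 ^ n) \<omega>"
      unfolding AE_all_countable by (intro allI L) simp
    \<comment> \<open>For fixed \<open>n\<close> all but finitely many \<open>h k\<close> belong to
      \<open>candidates n\<close>, so monotonicity on each grid passes to the limit.\<close>
    moreover have "AE \<omega> in M. \<forall>n k. n \<le> k \<longrightarrow> (\<forall>i j. i \<le> j \<longrightarrow>
        Y (real i / 2 ^ n) \<omega> - h k (real i / 2 ^ n) \<omega> \<le> Y (real j / 2 ^ n) \<omega> - h k (real j / 2 ^ n) \<omega>)"
      unfolding AE_all_countable
    proof (intro allI)
      fix n k
      show "AE \<omega> in M. n \<le> k \<longrightarrow> (\<forall>i j. i \<le> j \<longrightarrow>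
        Y (real i / 2 ^ n) \<omega> - h k (real i / 2 ^ n) \<omega> \<le> Y (real j / 2 ^ n) \<omega> - h k (real j / 2 ^ n) \<omega>)"
      proof (cases "n \<le> k")
        case True
        then have "h k \<in> candidates n"
          using h[of k] candidates_antimono by blast
        then show ?thesis
          using True by (simp add: candidates_def)
      qed simp
    qed
    ultimately show ?thesis
    proof eventually_elim
      case (elim \<omega>)
      show ?case
      proof (intro allI impI)
        fix n i j :: nat assume ij: "i \<le> j"
        show "Y (real i / 2 ^ n) \<omega> - L (real i / 2 ^ n) \<omega> \<le> Y (real j / 2 ^ n) \<omega> - L (real j / 2 ^ n) \<omega>"
        proof (rule LIMSEQ_le)
          show "(\<lambda>k. Y (real i / 2 ^ n) \<omega> - h k (real i / 2 ^ n) \<omega>) \<longlonglongrightarrow> Y (real i / 2 ^ n) \<omega> - L (real i / 2 ^ n) \<omega>"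
            "(\<lambda>k. Y (real j / 2 ^ n) \<omega> - h k (real j / 2 ^ n) \<omega>) \<longlonglongrightarrow> Y (real j / 2 ^ n) \<omega> - L (real j / 2 ^ n) \<omega>"
            using elim(1) by (intro tendsto_diff tendsto_const, blast)+
          show "\<exists>k0. \<forall>k\<ge>k0. Y (real i / 2 ^ n) \<omega> - h k (real i / 2 ^ n) \<omega>
              \<le> Y (real j / 2 ^ n) \<omega> - h k (real j / 2 ^ n) \<omega>"
            using elim(2) ij by blast
        qed
      qed
    qed
  qed
  ultimately show ?thesis
    by (rule that)
qed

end

section \<open>Right limits along the dyadic numbers\<close>

lemma mono_left_limit:
  fixes f :: "real \<Rightarrow> real"
  assumes mono: "\<And>s t. 0 \<le> s \<Longrightarrow> s \<le> t \<Longrightarrow> f s \<le> f t" and t: "0 < t"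
  shows "\<exists>l. (f \<longlongrightarrow> l) (at_left t)"
proof
  have bdd: "bdd_above (f ` {0..<t})"
    using mono by (intro bdd_aboveI[of _ "f t"]) auto
  have ne: "f ` {0..<t} \<noteq> {}"
    using t by auto
  have ev: "eventually (\<lambda>s. 0 \<le> s \<and> s < t) (at_left t)"
    using t by (auto simp: eventually_at_left intro!: exI[of _ 0])
  show "(f \<longlongrightarrow> Sup (f ` {0..<t})) (at_left t)"
  proof (rule order_tendstoI)
    fix a assume "a < Sup (f ` {0..<t})"
    then obtain s where s: "0 \<le> s" "s < t" "a < f s"
      using less_cSup_iff[OF ne bdd] by auto
    then have "eventually (\<lambda>u. s < u) (at_left t)"
      by (auto simp: eventually_at_left intro!: exI[of _ s])
    then show "eventually (\<lambda>u. a < f u) (at_left t)"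
    proof eventually_elim
      case (elim u)
      then show ?case
        using s mono[of s u] by simp
    qed
  next
    fix a assume "Sup (f ` {0..<t}) < a"
    then show "eventually (\<lambda>u. f u < a) (at_left t)"
      using ev
    proof (elim eventually_mono)
      fix u assume "0 \<le> u \<and> u < t"
      then have "f u \<le> Sup (f ` {0..<t})"
        by (intro cSup_upper bdd) auto
      then show "f u < a"
        using \<open>Sup (f ` {0..<t}) < a\<close> by simp
    qed
  qed
qed

text \<open>Every increment of \<open>f - g\<close> is at most the increment of the increasing
  function \<open>f + g\<close>, whose increments telescope.\<close>

lemma locally_finite_variation_diff_mono:
  assumes f: "\<And>s t. 0 \<le> s \<Longrightarrow> s \<le> t \<Longrightarrow> f s \<le> f t" and g: "\<And>s t. 0 \<le> s \<Longrightarrow> s \<le> t \<Longrightarrow> g s \<le> g t"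
  shows "locally_finite_variation (\<lambda>t. f t - g t)"
  unfolding locally_finite_variation_def
proof (intro allI impI exI)
  fix T :: real and k and \<sigma> :: "nat \<Rightarrow> real"
  assume "0 \<le> T" and \<sigma>: "mono \<sigma> \<and> range \<sigma> \<subseteq> {0..T}"
  then have "\<sigma> i \<in> {0..T}" for i
    by blast
  then have \<sigma>0: "0 \<le> \<sigma> i" "\<sigma> i \<le> T" and \<sigma>m: "\<sigma> i \<le> \<sigma> (Suc i)" for i
    using \<sigma> by (auto simp: monoD)
  let ?h = "\<lambda>i. f (\<sigma> i) + g (\<sigma> i)"
  have "(\<Sum>i<k. \<bar>(f (\<sigma> (Suc i)) - g (\<sigma> (Suc i))) - (f (\<sigma> i) - g (\<sigma> i))\<bar>) \<le> (\<Sum>i<k. ?h (Suc i) - ?h i)"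
  proof (rule sum_mono)
    fix i
    show "\<bar>(f (\<sigma> (Suc i)) - g (\<sigma> (Suc i))) - (f (\<sigma> i) - g (\<sigma> i))\<bar> \<le> ?h (Suc i) - ?h i"
      using f[OF \<sigma>0(1) \<sigma>m, of i] g[OF \<sigma>0(1) \<sigma>m, of i] by linarith
  qed
  also have "\<dots> = ?h k - ?h 0"
    by (rule sum_lessThan_telescope)
  also have "\<dots> \<le> (f T + g T) - (f 0 + g 0)"
    using f[OF \<sigma>0, of k] g[OF \<sigma>0, of k] f[OF order_refl \<sigma>0(1), of 0] g[OF order_refl \<sigma>0(1), of 0]
    by linarith
  finally show "(\<Sum>i<k. \<bar>(f (\<sigma> (Suc i)) - g (\<sigma> (Suc i))) - (f (\<sigma> i) - g (\<sigma> i))\<bar>)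
      \<le> (f T + g T) - (f 0 + g 0)" .
qed

lemma continuous_on_tendsto_at_right:
  fixes f :: "real \<Rightarrow> 'b::topological_space"
  assumes "continuous_on {0..} f" "0 \<le> t"
  shows "(f \<longlongrightarrow> f t) (at_right t)"
proof -
  have "(f \<longlongrightarrow> f t) (at t within {0..})"
    using assms by (simp add: continuous_on)
  then show ?thesis
    by (rule tendsto_within_subset) (use assms in auto)
qed

lemma continuous_on_tendsto_at_left:
  fixes f :: "real \<Rightarrow> 'b::topological_space"
  assumes "continuous_on {0..} f" "0 < t"
  shows "(f \<longlongrightarrow> f t) (at_left t)"
proof -
  have "isCont f t"
    using assms by (intro continuous_on_interior[OF assms(1)]) simp
  then show ?thesis
    unfolding isCont_def by (rule tendsto_within_subset) simp
qed

lemma continuous_process_imp_cadlag: "continuous_process M Z \<Longrightarrow> cadlag_process M Z"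
  unfolding continuous_process_def cadlag_process_def
  using continuous_on_tendsto_at_right continuous_on_tendsto_at_left by blast

text \<open>Rounding up strictly: the summand 1 moves even a grid point \<open>t\<close> to its
  successor. Limits along these times are therefore genuine right limits; without strictness the
  limit at a dyadic \<open>t\<close> would be the value at \<open>t\<close> itself, and
  right-continuity could fail.\<close>

definition next_dyadic :: "nat \<Rightarrow> real \<Rightarrow> real" where
  "next_dyadic n t = real (nat \<lfloor>t * 2 ^ n\<rfloor> + 1) / 2 ^ n"

lemma next_dyadic_gt: "0 \<le> t \<Longrightarrow> t < next_dyadic n t"
  unfolding next_dyadic_def by (subst pos_less_divide_eq) (simp, linarith)

lemma next_dyadic_le: "0 \<le> t \<Longrightarrow> next_dyadic n t \<le> t + (1 / 2) ^ n"
proof -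
  assume "0 \<le> t"
  then have "0 \<le> t * 2 ^ n"
    by simp
  then have "real (nat \<lfloor>t * 2 ^ n\<rfloor> + 1) \<le> t * 2 ^ n + 1"
    by linarith
  then show ?thesis
    unfolding next_dyadic_def by (simp add: divide_le_eq power_divide field_simps)
qed

lemma next_dyadic_mono: "s \<le> t \<Longrightarrow> next_dyadic n s \<le> next_dyadic n t"
  unfolding next_dyadic_def
  by (intro divide_right_mono of_nat_mono add_right_mono nat_mono floor_mono mult_right_mono) auto

lemma next_dyadic_tendsto: "0 \<le> t \<Longrightarrow> (\<lambda>n. next_dyadic n t) \<longlonglongrightarrow> t"
proof (rule tendsto_sandwich[of "\<lambda>_. t" _ _ "\<lambda>n. t + (1 / 2) ^ n"])
  have "(\<lambda>n. t + (1 / 2) ^ n) \<longlonglongrightarrow> t + 0"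
    by (intro tendsto_intros LIMSEQ_power_zero) simp
  then show "(\<lambda>n. t + (1 / 2) ^ n) \<longlonglongrightarrow> t"
    by simp
qed (use next_dyadic_gt next_dyadic_le in \<open>auto simp: less_imp_le\<close>)

lemma next_dyadic_Suc_le: "0 \<le> t \<Longrightarrow> next_dyadic (Suc n) t \<le> next_dyadic n t"
proof -
  assume t: "0 \<le> t"
  have "\<lfloor>t * 2 ^ Suc n\<rfloor> \<le> 2 * \<lfloor>t * 2 ^ n\<rfloor> + 1"
    by (simp add: floor_le_iff algebra_simps) linarith
  moreover have "0 \<le> \<lfloor>t * 2 ^ n\<rfloor>"
    using t by simp
  ultimately have "nat \<lfloor>t * 2 ^ Suc n\<rfloor> + 1 \<le> 2 * (nat \<lfloor>t * 2 ^ n\<rfloor> + 1)"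
    by (simp add: nat_le_iff)
  then have "real (nat \<lfloor>t * 2 ^ Suc n\<rfloor> + 1) \<le> real (2 * (nat \<lfloor>t * 2 ^ n\<rfloor> + 1))"
    by (rule of_nat_mono)
  then have "real (nat \<lfloor>t * 2 ^ Suc n\<rfloor> + 1) / 2 ^ Suc n \<le> real (2 * (nat \<lfloor>t * 2 ^ n\<rfloor> + 1)) / 2 ^ Suc n"
    by (rule divide_right_mono) simp
  also have "\<dots> = real (nat \<lfloor>t * 2 ^ n\<rfloor> + 1) / 2 ^ n"
    by (subst of_nat_mult) (simp only: power_Suc of_nat_numeral mult_divide_mult_cancel_left_if, simp)
  finally show ?thesis
    unfolding next_dyadic_def .
qed

section \<open>The cadlag version of the limit martingale and the decomposition of the norm\<close>

context martingale_plus_drift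
begin

lemma Y_adapted: "adapted F Y"
  unfolding adapted_def Y_def
proof (intro allI impI)
  fix t :: real assume "0 \<le> t"
  then have [measurable]: "X t \<in> borel_measurable (F t)" "A t \<in> borel_measurable (F t)"
    using X(1) A(1) by (auto simp: adapted_def)
  show "(\<lambda>\<omega>. norm (X t \<omega> - q) + A t \<omega>) \<in> borel_measurable (F t)"
    by measurable
qed

lemma Y_continuous: "\<omega> \<in> space M \<Longrightarrow> continuous_on {0..} (\<lambda>t. Y t \<omega>)"
  using X(2) A(2) unfolding Y_def continuous_process_def by (intro continuous_intros) auto

theorem semimartingale_norm: "semimartingale M F (\<lambda>t \<omega>. norm (X t \<omega> - q))"
proof -
  obtain L where L: "sq_martingale M F L"
    and L_mono: "AE \<omega> in M. \<forall>n i j. i \<le> j \<longrightarrow> Y (real i / 2 ^ n) \<omega> - L (real i / 2 ^ n) \<omega>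
        \<le> Y (real j / 2 ^ n) \<omega> - L (real j / 2 ^ n) \<omega>"
    by (rule limit_martingale)
  define D where "D t \<omega> = Y t \<omega> - L t \<omega>" for t \<omega>
  obtain G where G: "G \<subseteq> space M" and GF: "\<And>t. 0 \<le> t \<Longrightarrow> G \<in> sets (F t)"
    and AE_G: "AE \<omega> in M. \<omega> \<in> G"
    and D_grid: "\<And>\<omega> n i j. \<omega> \<in> G \<Longrightarrow> i \<le> j \<Longrightarrow> D (real i / 2 ^ n) \<omega> \<le> D (real j / 2 ^ n) \<omega>"
    by (rule AE_full_set[OF L_mono[folded D_def]]) blast
  \<comment> \<open>Monotonicity is known within one grid; dyadic numbers of levels \<open>m\<close>
    and \<open>n\<close> are compared on the grid of level \<open>m + n\<close>.\<close>
  have D_dyadic: "D (real i / 2 ^ m) \<omega> \<le> D (real j / 2 ^ n) \<omega>"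
    if "\<omega> \<in> G" "real i / 2 ^ m \<le> real j / 2 ^ n" for \<omega> i j m n
  proof -
    have eq: "real i / 2 ^ m = real (i * 2 ^ n) / 2 ^ (m + n)" "real j / 2 ^ n = real (j * 2 ^ m) / 2 ^ (m + n)"
      by (simp_all add: power_add)
    have "real (i * 2 ^ n) \<le> real (j * 2 ^ m)"
      using that(2) unfolding eq by (simp only: divide_le_cancel) simp
    then show ?thesis
      unfolding eq by (intro D_grid that(1)) (simp only: of_nat_le_iff)
  qed
  have D_next: "D (next_dyadic m s) \<omega> \<le> D (next_dyadic n t) \<omega>"
    if "\<omega> \<in> G" "next_dyadic m s \<le> next_dyadic n t" for \<omega> m n s t
    using that unfolding next_dyadic_def by (rule D_dyadic)
  \<comment> \<open>The value 0 off \<open>G\<close> keeps every path increasing and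
    right-continuous, since the definition of a semimartingale speaks of all paths. On
    \<open>G\<close> the limit exists: the sequence decreases in \<open>n\<close> and is bounded
    below by \<open>D 0 \<omega>\<close>.\<close>
  define R where "R t \<omega> = (if \<omega> \<in> G then lim (\<lambda>n. D (next_dyadic n t) \<omega>) else 0)" for t \<omega>
  have R: "(\<lambda>n. D (next_dyadic n t) \<omega>) \<longlonglongrightarrow> R t \<omega>" if "\<omega> \<in> G" "0 \<le> t" for t \<omega>
  proof -
    have "decseq (\<lambda>n. D (next_dyadic n t) \<omega>)"
      using that by (intro decseq_SucI D_next next_dyadic_Suc_le)
    moreover have "D 0 \<omega> \<le> D (next_dyadic n t) \<omega>" for n
      using D_dyadic[OF that(1), of 0 0 "nat \<lfloor>t * 2 ^ n\<rfloor> + 1" n] by (simp add: next_dyadic_def)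
    ultimately show ?thesis
      using that decseq_convergent[of "\<lambda>n. D (next_dyadic n t) \<omega>" "D 0 \<omega>"]
      by (metis R_def limI)
  qed
  have R_mono: "R s \<omega> \<le> R t \<omega>" if "0 \<le> s" "s \<le> t" for s t \<omega>
  proof (cases "\<omega> \<in> G")
    case True
    then show ?thesis
      using that by (intro LIMSEQ_le[OF R R]) (auto intro!: D_next next_dyadic_mono)
  qed (simp add: R_def)
  \<comment> \<open>Since \<open>s < next_dyadic n t\<close> strictly, the approximating times of
    \<open>s\<close> eventually fall below this grid point as well. This gives the upper bound
    needed for right-continuity of \<open>R\<close>.\<close>
  have R_le: "R s \<omega> \<le> D (next_dyadic n t) \<omega>" if "\<omega> \<in> G" "0 \<le> s" "s < next_dyadic n t" for \<omega> s t n
  proof (rule LIMSEQ_le_const2[OF R[OF that(1,2)]])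
    have "eventually (\<lambda>k. next_dyadic k s < next_dyadic n t) sequentially"
      using order_tendstoD(2)[OF next_dyadic_tendsto[OF that(2)] that(3)] .
    then show "\<exists>k0. \<forall>k\<ge>k0. D (next_dyadic k s) \<omega> \<le> D (next_dyadic n t) \<omega>"
      using D_next[OF that(1)] unfolding eventually_sequentially by (meson less_imp_le)
  qed
  have R_right: "((\<lambda>s. R s \<omega>) \<longlongrightarrow> R t \<omega>) (at_right t)" if t: "0 \<le> t" for t \<omega>
  proof (cases "\<omega> \<in> G")
    case True
    show ?thesis
    proof (rule order_tendstoI)
      fix a assume "a < R t \<omega>"
      have "eventually (\<lambda>s. t < s) (at_right t)"
        by (simp add: eventually_at_right_less)
      then show "eventually (\<lambda>s. a < R s \<omega>) (at_right t)"
      proof eventually_elim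
        case (elim s)
        then show ?case
          using R_mono[OF t, of s \<omega>] \<open>a < R t \<omega>\<close> by simp
      qed
    next
      fix a assume "R t \<omega> < a"
      then obtain n where n: "D (next_dyadic n t) \<omega> < a"
        using order_tendstoD(2)[OF R[OF True t]] by (auto simp: eventually_sequentially)
      have "eventually (\<lambda>s. s \<in> {t<..<next_dyadic n t}) (at_right t)"
        by (rule eventually_at_right_real[OF next_dyadic_gt[OF t]])
      then show "eventually (\<lambda>s. R s \<omega> < a) (at_right t)"
      proof eventually_elim
        case (elim s)
        then show ?case
          using R_le[OF True, of s n t] t n by simp
      qed
    qed
  qed (simp add: R_def)
  have R_adapted: "adapted F R"
    unfolding adapted_def
  proof (intro allI impI)
    fix t :: real assume t: "0 \<le> t"
    show "R t \<in> borel_measurable (F t)"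
    proof (rule measurable_F_right[OF t])
      fix u assume u: "t < u"
      then obtain n0 where n0: "\<And>n. n \<ge> n0 \<Longrightarrow> next_dyadic n t < u"
        using order_tendstoD(2)[OF next_dyadic_tendsto[OF t] u] by (auto simp: eventually_sequentially)
      \<comment> \<open>Dropping the first \<open>n0\<close> terms does not change the limit and
        leaves only times in \<open>(t, u]\<close>.\<close>
      have Dm: "D (next_dyadic (n + n0) t) \<in> borel_measurable (F u)" for n
      proof -
        have "0 \<le> next_dyadic (n + n0) t" "next_dyadic (n + n0) t \<le> u"
          using next_dyadic_gt[OF t, of "n + n0"] n0[of "n + n0"] t by auto
        then show ?thesis
          unfolding D_def
          by (intro borel_measurable_diff adapted_measurable_F[OF Y_adapted]
              adapted_measurable_F[OF sq_martingaleD(1)[OF L]])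
      qed
      have "R t = (\<lambda>\<omega>. if \<omega> \<in> G then lim (\<lambda>n. D (next_dyadic (n + n0) t) \<omega>) else 0)"
      proof
        fix \<omega>
        show "R t \<omega> = (if \<omega> \<in> G then lim (\<lambda>n. D (next_dyadic (n + n0) t) \<omega>) else 0)"
          using limI[OF LIMSEQ_ignore_initial_segment[OF R[OF _ t], of \<omega> n0]] by (simp add: R_def)
      qed
      also have "\<dots> \<in> borel_measurable (F u)"
      proof (rule measurable_If_set)
        show "G \<inter> space (F u) \<in> sets (F u)"
          using GF[of u] t u by auto
      qed (use borel_measurable_lim_metric[OF Dm] in auto)
      finally show "R t \<in> borel_measurable (F u)" .
    qed
  qed
  \<comment> \<open>Equals \<open>L t\<close> almost surely for every \<open>t\<close>, but with cadlag paths.\<close>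
  define H where "H t \<omega> = (if \<omega> \<in> G then Y t \<omega> - R t \<omega> else 0)" for t \<omega>
  have H_adapted: "adapted F H"
    unfolding adapted_def H_def
  proof (intro allI impI measurable_If_set)
    fix t :: real assume "0 \<le> t"
    then show "(\<lambda>\<omega>. Y t \<omega> - R t \<omega>) \<in> borel_measurable (F t)"
      using Y_adapted R_adapted by (auto simp: adapted_def intro!: borel_measurable_diff)
    show "G \<inter> space (F t) \<in> sets (F t)"
      using GF[OF \<open>0 \<le> t\<close>] by auto
  qed simp
  \<comment> \<open>\<open>Y\<close> is continuous and \<open>D\<close> tends to \<open>R\<close>
    along these times, so their difference \<open>L\<close> tends to \<open>H\<close>.\<close>
  have H_lim: "AE \<omega> in M. (\<lambda>n. L (next_dyadic n t) \<omega>) \<longlonglongrightarrow> H t \<omega>" if t: "0 \<le> t" for t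
    using AE_G AE_space
  proof eventually_elim
    case (elim \<omega>)
    have "(\<lambda>n. Y (next_dyadic n t) \<omega>) \<longlonglongrightarrow> Y t \<omega>"
      using t less_imp_le[OF le_less_trans[OF t next_dyadic_gt[OF t]]]
      by (intro continuous_on_tendsto_compose[OF Y_continuous[OF elim(2)] next_dyadic_tendsto[OF t]])
        simp_all
    then have "(\<lambda>n. Y (next_dyadic n t) \<omega> - D (next_dyadic n t) \<omega>) \<longlonglongrightarrow> Y t \<omega> - R t \<omega>"
      by (intro tendsto_diff R elim t)
    then show ?case
      using elim by (simp add: H_def D_def)
  qed
  have next0: "0 \<le> next_dyadic n t" if "0 \<le> t" for n t
    using next_dyadic_gt[OF that, of n] that by simp
  have L_bound: "(\<integral>\<omega>. (L (next_dyadic n t) \<omega>)\<^sup>2 \<partial>M) \<le> (\<integral>\<omega>. (L (t + 1) \<omega>)\<^sup>2 \<partial>M)" if t: "0 \<le> t" for n t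
  proof (rule sq_martingale_mono[OF L next0[OF t]])
    show "next_dyadic n t \<le> t + 1"
      using next_dyadic_le[OF t, of n] power_le_one[of "1 / 2 :: real" n] by simp
  qed
  note conv = L2_bounded_convergence[OF sq_martingaleD(2)[OF L next0] sq_martingaleD(3)[OF L next0]
      L_bound adapted_measurable[OF H_adapted] H_lim]
  have H_sq: "integrable M (\<lambda>\<omega>. (H t \<omega>)\<^sup>2)" if t: "0 \<le> t" for t
    by (rule conv(1)[OF t t t t t])
  have H_int: "integrable M (H t)" if t: "0 \<le> t" for t
    by (rule integrable_of_square[OF adapted_measurable[OF H_adapted t] H_sq[OF t]])
  have H: "sq_martingale M F H"
    unfolding sq_martingale_def
  proof (intro conjI allI impI ballI H_adapted H_sq)
    fix s t :: real and B assume st: "0 \<le> s" "s \<le> t" and B: "B \<in> sets (F s)"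
    have t: "0 \<le> t"
      using st by simp
    have i: "integrable M (L (next_dyadic n r))" if "0 \<le> r" for n r
      using sq_martingaleD(4)[OF L next0[OF that]] .
    show "(\<integral>\<omega>. (H t \<omega> - H s \<omega>) * indicator B \<omega> \<partial>M) = 0"
    proof (rule integral_indicator_L1_limit)
      show "(\<lambda>n. \<integral>\<omega>. \<bar>L (next_dyadic n t) \<omega> - L (next_dyadic n s) \<omega> - (H t \<omega> - H s \<omega>)\<bar> \<partial>M) \<longlonglongrightarrow> 0"
        by (intro L1_limit_diff i H_int t st(1) conv(3)[OF t t t t t]
            conv(3)[OF st(1) st(1) st(1) st(1) st(1)])
      \<comment> \<open>The martingale property of \<open>H\<close> between \<open>s\<close> and
        \<open>t\<close> is the limit of that of \<open>L\<close> between the dyadic times just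
        after them; \<open>B\<close> is known at the earlier one.\<close>
      show "(\<integral>\<omega>. (L (next_dyadic n t) \<omega> - L (next_dyadic n s) \<omega>) * indicator B \<omega> \<partial>M) = 0" for n
      proof (rule sq_martingaleD(5)[OF L next0[OF st(1)] next_dyadic_mono[OF st(2)]])
        show "B \<in> sets (F (next_dyadic n s))"
          using B sets_F_mono[OF less_imp_le[OF next_dyadic_gt[OF st(1), of n]]] by blast
      qed
    qed (use i H_int t st sets_F_imp[OF B] in auto)
  qed
  define N where "N t \<omega> = H t \<omega> - H 0 \<omega>" for t \<omega>
  have "sq_martingale M F (\<lambda>t. H 0)"
    using H_adapted H_sq[of 0] by (intro sq_martingale_const) (auto simp: adapted_def)
  then have N: "sq_martingale M F N"
    unfolding N_def by (rule sq_martingale_diff[OF H])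
  have N_cadlag: "cadlag_process M N"
    unfolding cadlag_process_def
  proof (intro ballI allI impI conjI)
    fix \<omega> t assume \<omega>: "\<omega> \<in> space M" and t: "(0::real) \<le> t"
    note YR = continuous_on_tendsto_at_right[OF Y_continuous[OF \<omega>] t]
    show "((\<lambda>s. N s \<omega>) \<longlongrightarrow> N t \<omega>) (at_right t)"
      unfolding N_def H_def using R_right[OF t] YR
      by (cases "\<omega> \<in> G") (auto intro!: tendsto_intros)
    assume t: "0 < t"
    obtain l where "((\<lambda>s. R s \<omega>) \<longlongrightarrow> l) (at_left t)"
      using mono_left_limit[of "\<lambda>s. R s \<omega>", OF R_mono t] by blast
    then have "((\<lambda>s. N s \<omega>) \<longlongrightarrow> (if \<omega> \<in> G then Y t \<omega> - l else 0) - H 0 \<omega>) (at_left t)"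
      unfolding N_def H_def using continuous_on_tendsto_at_left[OF Y_continuous[OF \<omega>] t]
      by (cases "\<omega> \<in> G") (auto intro!: tendsto_intros)
    then show "\<exists>l. ((\<lambda>s. N s \<omega>) \<longlongrightarrow> l) (at_left t)"
      by blast
  qed
  \<comment> \<open>On \<open>G\<close> the norm is \<open>Y - A = H + R - A\<close>. After
    subtraction of the initial values \<open>H\<close> gives the martingale part, and
    \<open>V\<close> collects a difference of two increasing processes.\<close>
  define V where "V t \<omega> = (R t \<omega> - R 0 \<omega>) - A t \<omega>" for t \<omega>
  have A_cont: "continuous_on {0..} (\<lambda>t. A t \<omega>)" if "\<omega> \<in> space M" for \<omega>
    using A(2) that by (simp add: continuous_process_def)
  have V_cadlag: "cadlag_process M V"
    unfolding cadlag_process_def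
  proof (intro ballI allI impI conjI)
    fix \<omega> t assume \<omega>: "\<omega> \<in> space M" and t: "(0::real) \<le> t"
    show "((\<lambda>s. V s \<omega>) \<longlongrightarrow> V t \<omega>) (at_right t)"
      unfolding V_def using R_right[OF t] continuous_on_tendsto_at_right[OF A_cont[OF \<omega>] t]
      by (intro tendsto_intros)
    assume t: "0 < t"
    obtain l where "((\<lambda>s. R s \<omega>) \<longlongrightarrow> l) (at_left t)"
      using mono_left_limit[of "\<lambda>s. R s \<omega>", OF R_mono t] by blast
    then have "((\<lambda>s. V s \<omega>) \<longlongrightarrow> l - R 0 \<omega> - A t \<omega>) (at_left t)"
      unfolding V_def using continuous_on_tendsto_at_left[OF A_cont[OF \<omega>] t] by (intro tendsto_intros)
    then show "\<exists>l. ((\<lambda>s. V s \<omega>) \<longlongrightarrow> l) (at_left t)"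
      by blast
  qed
  have V_adapted: "adapted F V"
    unfolding adapted_def V_def
  proof (intro allI impI)
    fix t :: real assume t: "0 \<le> t"
    then have [measurable]: "R t \<in> borel_measurable (F t)" "R 0 \<in> borel_measurable (F t)" "A t \<in> borel_measurable (F t)"
      by (auto intro!: adapted_measurable_F R_adapted A(1))
    show "(\<lambda>\<omega>. (R t \<omega> - R 0 \<omega>) - A t \<omega>) \<in> borel_measurable (F t)"
      by measurable
  qed
  have X_cont: "continuous_process M (\<lambda>t \<omega>. norm (X t \<omega> - q))"
    using X(2) unfolding continuous_process_def by (auto intro!: continuous_intros)
  show ?thesis
    unfolding semimartingale_def
  proof (rule conjI[OF _ conjI[OF continuous_process_imp_cadlag[OF X_cont]]], goal_cases)
    case 1
    show ?case
      using X(1) unfolding adapted_def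
      by (auto intro!: borel_measurable_norm borel_measurable_diff)
  next
    case 2
    show ?case
    proof (rule exI[of _ N], rule exI[of _ V], intro conjI ballI)
      show "local_martingale M F N"
        by (rule sq_martingale_imp_local_martingale[OF N N_cadlag])
      show "adapted F V" "cadlag_process M V"
        by fact+
      show "locally_finite_variation (\<lambda>t. V t \<omega>)" if "\<omega> \<in> space M" for \<omega>
        unfolding V_def
        using R_mono A_mono[OF that] by (intro locally_finite_variation_diff_mono) auto
      show "N 0 \<omega> = 0" "V 0 \<omega> = 0" if "\<omega> \<in> space M" for \<omega>
        using A_0[OF that] by (auto simp: N_def V_def)
      show "AE \<omega> in M. \<forall>t\<ge>0. norm (X t \<omega> - q) = norm (X 0 \<omega> - q) + N t \<omega> + V t \<omega>"
        using AE_G AE_space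
      proof eventually_elim
        case (elim \<omega>)
        then show ?case
          using A_0[OF elim(2)] by (simp add: N_def V_def H_def Y_def)
      qed
   
   qed
  qed
qed

end

section \<open>Brownian motion and the stochastic integral\<close>

text \<open>The density is a product over the coordinates, so by Fubini the factors of the other
  coordinates integrate to 1 and a one-dimensional Gaussian integral remains.\<close>

lemma
  fixes b :: "'a::euclidean_space" and g :: "real \<Rightarrow> real"
  assumes b: "b \<in> Basis" and \<sigma>: "0 < \<sigma>" and [measurable]: "g \<in> borel_measurable borel"
    and g: "integrable lborel (\<lambda>x. normal_density 0 \<sigma> x * g x)"
  defines "\<nu> \<equiv> density lborel (\<lambda>y::'a. ennreal (\<Prod>b\<in>Basis. normal_density 0 \<sigma> (y \<bullet> b)))"
  shows integrable_gaussian_coordinate: "integrable \<nu> (\<lambda>y. g (y \<bullet> b))"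
    and integral_gaussian_coordinate:
      "(\<integral>y. g (y \<bullet> b) \<partial>\<nu>) = (\<integral>x. normal_density 0 \<sigma> x * g x \<partial>lborel)"
proof -
  interpret product_sigma_finite "\<lambda>_::'a. lborel :: real measure" ..
  \<comment> \<open>The test function is absorbed into the factor of the coordinate
    \<open>b\<close>, which turns the integrand into a pure product.\<close>
  define h where "h b' x = normal_density 0 \<sigma> x * (if b' = b then g x else 1)" for b' :: 'a and x
  let ?P = "\<Pi>\<^sub>M b\<in>Basis. (lborel :: real measure)" and ?T = "\<lambda>f. \<Sum>b\<in>Basis. f b *\<^sub>R (b::'a)"
  have h_int: "integrable lborel (h b')" for b'
    using g \<sigma> by (cases "b' = b") (simp_all add: h_def[abs_def])
  have h_prod: "(\<Prod>b'\<in>Basis. normal_density 0 \<sigma> (y \<bullet> b')) *\<^sub>R g (y \<bullet> b) = (\<Prod>b'\<in>Basis. h b' (y \<bullet> b'))" for y :: 'a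
    using b by (simp add: h_def prod.distrib)
  have nn: "AE y in lborel. 0 \<le> (\<Prod>b\<in>Basis. normal_density 0 \<sigma> ((y::'a) \<bullet> b))"
    by (intro AE_I2 prod_nonneg) simp
  have hT: "(\<Prod>b'\<in>Basis. h b' (?T f \<bullet> b')) = (\<Prod>b'\<in>Basis. h b' (f b'))" for f
    by (intro prod.cong refl) simp
  have [measurable]: "h b' \<in> borel_measurable borel" for b'
    unfolding h_def by measurable
  have P: "integrable ?P (\<lambda>f. \<Prod>b'\<in>Basis. h b' (f b'))"
    by (rule product_integrable_prod) (simp_all add: h_int)
  have "integrable lborel (\<lambda>y::'a. \<Prod>b'\<in>Basis. h b' (y \<bullet> b'))"
    unfolding lborel_eq[where 'a='a] using P by (subst integrable_distr_eq) (simp_all only: hT, measurable)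
  then show "integrable \<nu> (\<lambda>y. g (y \<bullet> b))"
    unfolding \<nu>_def using nn by (subst integrable_density) (simp_all only: h_prod, measurable)
  have "(\<integral>y. g (y \<bullet> b) \<partial>\<nu>) = (\<integral>y. (\<Prod>b'\<in>Basis. h b' (y \<bullet> b')) \<partial>(lborel :: 'a measure))"
    unfolding \<nu>_def using nn by (subst integral_density) (simp_all only: h_prod, measurable)
  also have "\<dots> = (\<integral>f. (\<Prod>b'\<in>Basis. h b' (f b')) \<partial>?P)"
    unfolding lborel_eq[where 'a='a] by (subst integral_distr) (simp_all only: hT, measurable)
  also have "\<dots> = (\<Prod>b'\<in>Basis. integral\<^sup>L lborel (h b'))"
    by (rule product_integral_prod) (simp_all add: h_int)
  also have "\<dots> = (\<Prod>b'\<in>Basis. if b' = b then (\<integral>x. normal_density 0 \<sigma> x * g x \<partial>lborel) else 1)"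
    using \<sigma> by (intro prod.cong refl) (auto simp: h_def[abs_def])
  also have "\<dots> = (\<integral>x. normal_density 0 \<sigma> x * g x \<partial>lborel)"
    using b by simp
  finally show "(\<integral>y. g (y \<bullet> b) \<partial>\<nu>) = (\<integral>x. normal_density 0 \<sigma> x * g x \<partial>lborel)" .
qed

context stochastic_basis
begin

text \<open>Square integrability and mean zero are read off from the Gaussian law; independence of
  \<open>F s\<close> then factors the integral over \<open>G\<close>.\<close>

lemma
  fixes W :: "real \<Rightarrow> 'w \<Rightarrow> 'a::euclidean_space"
  assumes W: "brownian_motion M F W" and b: "b \<in> Basis" and st: "0 \<le> s" "s < t"
  shows brownian_increment_square: "integrable M (\<lambda>\<omega>. ((W t \<omega> - W s \<omega>) \<bullet> b)\<^sup>2)"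
    and brownian_increment_integral:
      "G \<in> sets (F s) \<Longrightarrow> (\<integral>\<omega>. ((W t \<omega> - W s \<omega>) \<bullet> b) * indicator G \<omega> \<partial>M) = 0"
proof -
  let ?D = "\<lambda>\<omega>. W t \<omega> - W s \<omega>"
  have "adapted F W"
    using W by (simp add: brownian_motion_def)
  then have Wm: "W t \<in> borel_measurable M" "W s \<in> borel_measurable M"
    using st by (auto intro: adapted_measurable)
  then have Dm[measurable]: "?D \<in> borel_measurable M"
    by simp
  have D: "distr M borel ?D =
      density lborel (\<lambda>y. ennreal (\<Prod>b\<in>Basis. normal_density 0 (sqrt (t - s)) (y \<bullet> b)))"
    and ind: "indep_set (sets (F s)) {?D -` B \<inter> space M | B. B \<in> sets borel}"
    using W st by (auto simp: brownian_motion_def)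
  have \<sigma>: "0 < sqrt (t - s)"
    using st by simp
  have "integrable (distr M borel ?D) (\<lambda>y. (y \<bullet> b)\<^sup>2)"
    unfolding D using integrable_normal_moment[OF \<sigma>, of 0 2]
    by (intro integrable_gaussian_coordinate[OF b \<sigma>]) auto
  then show sq: "integrable M (\<lambda>\<omega>. (?D \<omega> \<bullet> b)\<^sup>2)"
    by (subst (asm) integrable_distr_eq) auto
  have int: "integrable M (\<lambda>\<omega>. ?D \<omega> \<bullet> b)"
    by (rule integrable_of_square[OF _ sq]) simp
  have "(\<integral>y. y \<bullet> b \<partial>distr M borel ?D) = (\<integral>x. normal_density 0 (sqrt (t - s)) x * x \<partial>lborel)"
    unfolding D using integrable_normal_moment_nz_1[OF \<sigma>, of 0]
    by (intro integral_gaussian_coordinate[OF b \<sigma>]) auto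
  then have zero: "(\<integral>\<omega>. ?D \<omega> \<bullet> b \<partial>M) = 0"
    using integral_normal_moment_nz_1[OF \<sigma>, of 0] by (subst (asm) integral_distr) auto
  assume G: "G \<in> sets (F s)"
  then have GM[measurable]: "G \<in> sets M"
    using sets_F_imp st by blast
  \<comment> \<open>Independence of random variables refers to the generated \<sigma>-algebras. That
    of the indicator lies in \<open>F s\<close> and, by \<open>sub2\<close>, that of the coordinate
    lies in the one generated by the increment, so independence is inherited from the definition of
    Brownian motion.\<close>
  have sub1: "sigma_sets (space M) {(indicator G :: 'w \<Rightarrow> real) -` A \<inter> space M | A. A \<in> sets borel} \<subseteq> sets (F s)"
  proof -
    have "(indicator G :: 'w \<Rightarrow> real) -` A \<inter> space M \<in> sets (F s)" if "A \<in> sets borel" for A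
      using measurable_sets[of "indicator G :: 'w \<Rightarrow> real" "F s" borel A] that G by (simp add: space_F)
    then have "{(indicator G :: 'w \<Rightarrow> real) -` A \<inter> space M | A. A \<in> sets borel} \<subseteq> sets (F s)"
      by blast
    then show ?thesis
      using sets.sigma_sets_subset[of _ "F s"] by (simp add: space_F)
  qed
  have sub2: "sigma_sets (space M) {(\<lambda>\<omega>. ?D \<omega> \<bullet> b) -` A \<inter> space M | A. A \<in> sets borel}
      \<subseteq> {?D -` B \<inter> space M | B. B \<in> sets borel}"
  proof -
    have V: "sets (vimage_algebra (space M) ?D borel) = {?D -` B \<inter> space M | B. B \<in> sets borel}"
      by (rule sets_vimage_algebra2) simp
    have "(\<lambda>\<omega>. ?D \<omega> \<bullet> b) -` A \<inter> space M \<in> sets (vimage_algebra (space M) ?D borel)"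
      if "A \<in> sets borel" for A
    proof -
      have "(\<lambda>y. y \<bullet> b) -` A \<in> sets borel"
        using measurable_sets[of "\<lambda>y. y \<bullet> b" borel borel A] that by simp
      moreover have "(\<lambda>\<omega>. ?D \<omega> \<bullet> b) -` A = ?D -` ((\<lambda>y. y \<bullet> b) -` A)"
        by auto
      ultimately show ?thesis
        unfolding V by blast
    qed
    then show ?thesis
      unfolding V[symmetric]
      using sets.sigma_sets_subset[of "{(\<lambda>\<omega>. ?D \<omega> \<bullet> b) -` A \<inter> space M | A. A \<in> sets borel}"
          "vimage_algebra (space M) ?D borel"] by auto
  qed
  have iv: "indep_var borel (indicator G :: 'w \<Rightarrow> real) borel (\<lambda>\<omega>. ?D \<omega> \<bullet> b)"
    unfolding indep_var_eq
  proof (intro conjI)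
    show "indep_set (sigma_sets (space M) {(indicator G :: 'w \<Rightarrow> real) -` A \<inter> space M | A. A \<in> sets borel})
        (sigma_sets (space M) {(\<lambda>\<omega>. ?D \<omega> \<bullet> b) -` A \<inter> space M | A. A \<in> sets borel})"
      unfolding indep_set_def
    proof (rule indep_sets_mono_sets[OF ind[unfolded indep_set_def]])
    qed (use sub1 sub2 in \<open>auto split: bool.splits\<close>)
  qed simp_all
  have "(\<integral>\<omega>. indicator G \<omega> * (?D \<omega> \<bullet> b) \<partial>M) = 0"
    using zero int by (subst indep_var_lebesgue_integral[OF iv]) (auto simp: emeasure_eq_measure)
  then show "(\<integral>\<omega>. (?D \<omega> \<bullet> b) * indicator G \<omega> \<partial>M) = 0"
    by (simp add: mult.commute)
qed

lemma brownian_sq_martingale: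
  fixes W :: "real \<Rightarrow> 'w \<Rightarrow> 'a::euclidean_space"
  assumes W: "brownian_motion M F W" and b: "b \<in> Basis"
  shows "sq_martingale M F (\<lambda>t \<omega>. W t \<omega> \<bullet> b)"
  unfolding sq_martingale_def
proof (intro conjI allI impI ballI)
  have A: "adapted F W" and W0: "AE \<omega> in M. W 0 \<omega> = 0"
    using W by (auto simp: brownian_motion_def)
  have Wm: "W t \<in> borel_measurable M" if "0 \<le> t" for t
    using A that by (rule adapted_measurable)
  show "adapted F (\<lambda>t \<omega>. W t \<omega> \<bullet> b)"
    using A by (auto simp: adapted_def intro!: borel_measurable_inner)
  show "integrable M (\<lambda>\<omega>. (W t \<omega> \<bullet> b)\<^sup>2)" if t: "0 \<le> t" for t
  proof -
    have [measurable]: "W t \<in> borel_measurable M" "W 0 \<in> borel_measurable M"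
      using Wm t by auto
    \<comment> \<open>The law of an increment is prescribed for distinct times only, so
      \<open>t = 0\<close> is separate. As \<open>W 0\<close> vanishes only almost surely, it is
      removed afterwards up to a null set.\<close>
    have sq: "integrable M (\<lambda>\<omega>. ((W t \<omega> - W 0 \<omega>) \<bullet> b)\<^sup>2)"
      using brownian_increment_square[OF W b order_refl, of t] t by (cases "t = 0") auto
    have "AE \<omega> in M. ((W t \<omega> - W 0 \<omega>) \<bullet> b)\<^sup>2 = (W t \<omega> \<bullet> b)\<^sup>2"
      using W0 by eventually_elim simp
    then show ?thesis
      using sq by (subst (asm) integrable_cong_AE) auto
  qed
  fix s t :: real and G assume st: "0 \<le> s" "s \<le> t" and G: "G \<in> sets (F s)"
  then show "(\<integral>\<omega>. (W t \<omega> \<bullet> b - W s \<omega> \<bullet> b) * indicator G \<omega> \<partial>M) = 0"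
    using brownian_increment_integral[OF W b st(1) _ G, of t] by (cases "s = t") (auto simp: inner_diff_left)
qed

lemma simple_integral_sq_martingale:
  fixes W :: "real \<Rightarrow> 'w \<Rightarrow> 'a::euclidean_space"
  assumes W: "brownian_motion M F W" and b: "b \<in> Basis" and data: "simple_data M F k \<tau> \<xi>"
  shows "sq_martingale M F (\<lambda>t \<omega>. simple_integral W k \<tau> \<xi> t \<omega> \<bullet> b)"
proof -
  have \<tau>0: "0 \<le> \<tau> i" if "i \<le> k" for i
    using that
  proof (induction i)
    case 0
    then show ?case
      using data by (simp add: simple_data_def)
  next
    case (Suc i)
    then have "\<tau> i \<le> \<tau> (Suc i)"
      using data by (simp add: simple_data_def)
    then show ?case
      using Suc by simp
  qed
  have "sq_martingale M F (\<lambda>t \<omega>. \<Sum>i<k. \<xi> i \<omega> * (W (min t (\<tau> (Suc i))) \<omega> \<bullet> b - W (min t (\<tau> i)) \<omega> \<bullet> b))"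
  proof (rule sq_martingale_sum)
    fix i assume "i \<in> {..<k}"
    then have i: "0 \<le> \<tau> i" "\<tau> i \<le> \<tau> (Suc i)" "\<xi> i \<in> borel_measurable (F (\<tau> i))"
      and "\<exists>B. \<forall>\<omega>\<in>space M. \<bar>\<xi> i \<omega>\<bar> \<le> B"
      using \<tau>0[of i] data by (auto simp: simple_data_def)
    then obtain B where "\<And>\<omega>. \<omega> \<in> space M \<Longrightarrow> \<bar>\<xi> i \<omega>\<bar> \<le> B"
      by blast
    then show "sq_martingale M F (\<lambda>t \<omega>. \<xi> i \<omega> * (W (min t (\<tau> (Suc i))) \<omega> \<bullet> b - W (min t (\<tau> i)) \<omega> \<bullet> b))"
      by (rule sq_martingale_block[OF brownian_sq_martingale[OF W b] i])
  qed simp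
  then show ?thesis
    by (simp add: simple_integral_def inner_sum_left inner_diff_left)
qed

text \<open>Mean square convergence of the simple integrals is all that is used. It implies
  convergence in mean by \<open>expectation_abs_le_sqrt\<close>, and the martingale property passes
  to the limit.\<close>

lemma ito_integral_sq_martingale:
  fixes W I :: "real \<Rightarrow> 'w \<Rightarrow> 'a::euclidean_space"
  assumes W: "brownian_motion M F W" and b: "b \<in> Basis" and I: "ito_integral M F W H I"
  shows "sq_martingale M F (\<lambda>t \<omega>. I t \<omega> \<bullet> b)"
proof -
  obtain k \<tau> \<xi> where data: "\<And>n :: nat. simple_data M F (k n) (\<tau> n) (\<xi> n)"
    and lim: "\<And>t. 0 \<le> t \<Longrightarrow> (\<lambda>n. \<integral>\<^sup>+\<omega>. ennreal ((norm (simple_integral W (k n) (\<tau> n) (\<xi> n) t \<omega> - I t \<omega>))\<^sup>2) \<partial>M)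
           \<longlonglongrightarrow> 0"
    using I unfolding ito_integral_def by blast
  define J where "J n t \<omega> = simple_integral W (k n) (\<tau> n) (\<xi> n) t \<omega>" for n t \<omega>
  have J: "sq_martingale M F (\<lambda>t \<omega>. J n t \<omega> \<bullet> b)" for n
    unfolding J_def by (rule simple_integral_sq_martingale[OF W b data])
  have A: "adapted F (\<lambda>t \<omega>. I t \<omega> \<bullet> b)"
    using I by (auto simp: ito_integral_def adapted_def intro!: borel_measurable_inner)
  let ?d = "\<lambda>n t \<omega>. J n t \<omega> \<bullet> b - I t \<omega> \<bullet> b"
  have nn: "(\<lambda>n. \<integral>\<^sup>+\<omega>. ennreal ((?d n t \<omega>)\<^sup>2) \<partial>M) \<longlonglongrightarrow> 0" if t: "0 \<le> t" for t
  proof (rule tendsto_sandwich[OF _ _ tendsto_const lim[OF t]])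
    show "\<forall>\<^sub>F n in sequentially. (\<integral>\<^sup>+\<omega>. ennreal ((?d n t \<omega>)\<^sup>2) \<partial>M)
        \<le> (\<integral>\<^sup>+\<omega>. ennreal ((norm (simple_integral W (k n) (\<tau> n) (\<xi> n) t \<omega> - I t \<omega>))\<^sup>2) \<partial>M)"
    proof (intro always_eventually allI nn_integral_mono ennreal_leI)
      fix n \<omega>
      have "\<bar>(J n t \<omega> - I t \<omega>) \<bullet> b\<bar> \<le> norm (J n t \<omega> - I t \<omega>)"
        by (rule Basis_le_norm[OF b])
      then show "(?d n t \<omega>)\<^sup>2 \<le> (norm (simple_integral W (k n) (\<tau> n) (\<xi> n) t \<omega> - I t \<omega>))\<^sup>2"
        unfolding J_def[symmetric] by (simp add: inner_diff_left abs_le_square_iff[symmetric])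
    qed
  qed simp
  have dm: "?d n t \<in> borel_measurable M" and Im: "(\<lambda>\<omega>. I t \<omega> \<bullet> b) \<in> borel_measurable M" if "0 \<le> t" for n t
    using sq_martingaleD(2)[OF J that] adapted_measurable[OF A that] by auto
  have Isq: "integrable M (\<lambda>\<omega>. (I t \<omega> \<bullet> b)\<^sup>2)" if t: "0 \<le> t" for t
  proof -
    \<comment> \<open>Square integrability of \<open>I\<close> is not part of its definition. It
      follows as soon as one simple integral is at finite mean square distance from
      \<open>I\<close>.\<close>
    obtain n where n: "(\<integral>\<^sup>+\<omega>. ennreal ((?d n t \<omega>)\<^sup>2) \<partial>M) < 1"
      using order_tendstoD(2)[OF nn[OF t], of 1] by (auto simp: eventually_sequentially)
    have dsq: "integrable M (\<lambda>\<omega>. (?d n t \<omega>)\<^sup>2)"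
      using less_trans[OF n ennreal_one_less_top]
      by (intro integrableI_bounded borel_measurable_power dm t) simp
    have "integrable M (\<lambda>\<omega>. (J n t \<omega> \<bullet> b - ?d n t \<omega>)\<^sup>2)"
      by (rule integrable_square_diff[OF sq_martingaleD(2)[OF J t] dm[OF t] sq_martingaleD(3)[OF J t] dsq])
    then show ?thesis
      by simp
  qed
  show ?thesis
  proof (rule sq_martingale_L1_limit[OF J A Isq])
    fix t :: real assume t: "0 \<le> t"
    have dsq: "integrable M (\<lambda>\<omega>. (?d n t \<omega>)\<^sup>2)" for n
      by (intro integrable_square_diff sq_martingaleD(2,3)[OF J t] Im[OF t] Isq[OF t])
    have "(\<lambda>n. ennreal (\<integral>\<omega>. (?d n t \<omega>)\<^sup>2 \<partial>M)) \<longlonglongrightarrow> 0"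
      using nn[OF t] by (subst (asm) nn_integral_eq_integral[OF dsq]) simp_all
    then have "(\<lambda>n. \<integral>\<omega>. (?d n t \<omega>)\<^sup>2 \<partial>M) \<longlonglongrightarrow> 0"
      by (subst (asm) ennreal_tendsto_0_iff) simp_all
    then have sqrt: "(\<lambda>n. sqrt (\<integral>\<omega>. (?d n t \<omega>)\<^sup>2 \<partial>M)) \<longlonglongrightarrow> 0"
      using tendsto_real_sqrt by fastforce
    show "(\<lambda>n. \<integral>\<omega>. \<bar>?d n t \<omega>\<bar> \<partial>M) \<longlonglongrightarrow> 0"
    proof (rule tendsto_sandwich[OF _ _ tendsto_const sqrt])
      show "\<forall>\<^sub>F n in sequentially. (\<integral>\<omega>. \<bar>?d n t \<omega>\<bar> \<partial>M) \<le> sqrt (\<integral>\<omega>. (?d n t \<omega>)\<^sup>2 \<partial>M)"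
        using expectation_abs_le_sqrt[OF dm[OF t] dsq] by (simp add: always_eventually)
    qed simp
  qed
qed

end

section \<open>Measurability of the drift\<close>

text \<open>Rounding the time down to a dyadic grid leaves countably many values, for which joint
  measurability is clear; continuity of the paths gives the limit.\<close>

lemma measurable_continuous_process:
  fixes Z :: "real \<Rightarrow> 'w \<Rightarrow> 'b::metric_space"
  assumes Z: "\<And>s. Z s \<in> borel_measurable N"
    and cont: "\<And>\<omega>. \<omega> \<in> space N \<Longrightarrow> continuous_on UNIV (\<lambda>s. Z s \<omega>)"
  shows "(\<lambda>(\<omega>, s). Z s \<omega>) \<in> borel_measurable (N \<Otimes>\<^sub>M borel)"
proof (rule borel_measurable_LIMSEQ_metric)
  let ?g = "\<lambda>n (s::real). real_of_int \<lfloor>s * 2 ^ n\<rfloor> / 2 ^ n"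
  show "(\<lambda>(\<omega>, s). Z (?g n s) \<omega>) \<in> borel_measurable (N \<Otimes>\<^sub>M borel)" for n :: nat
  proof -
    have "(\<lambda>p. Z (real_of_int i / 2 ^ n) (fst p)) \<in> borel_measurable (N \<Otimes>\<^sub>M (borel :: real measure))" for i :: int
      using Z by measurable
    moreover have "(\<lambda>p. \<lfloor>snd p * 2 ^ n\<rfloor>) \<in> N \<Otimes>\<^sub>M (borel :: real measure) \<rightarrow>\<^sub>M count_space UNIV"
      by measurable
    ultimately have "(\<lambda>p. Z (real_of_int \<lfloor>snd p * 2 ^ n\<rfloor> / 2 ^ n) (fst p))
        \<in> borel_measurable (N \<Otimes>\<^sub>M (borel :: real measure))"
      by (rule measurable_compose_countable)
    then show ?thesis
      by (simp add: case_prod_beta')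
  qed
  fix p assume p: "p \<in> space (N \<Otimes>\<^sub>M (borel :: real measure))"
  obtain \<omega> s where [simp]: "p = (\<omega>, s)"
    by (cases p)
  have "(\<lambda>n. ?g n s) \<longlonglongrightarrow> s"
  proof (rule tendsto_sandwich[of "\<lambda>n. s - (1 / 2) ^ n" _ _ "\<lambda>_. s"])
    have "(\<lambda>n. s - (1 / 2) ^ n) \<longlonglongrightarrow> s - 0"
      by (intro tendsto_intros LIMSEQ_power_zero) simp
    then show "(\<lambda>n. s - (1 / 2) ^ n) \<longlonglongrightarrow> s"
      by simp
    have "s * 2 ^ n - 1 \<le> real_of_int \<lfloor>s * 2 ^ n\<rfloor>" for n
      by linarith
    then show "\<forall>\<^sub>F n in sequentially. s - (1 / 2) ^ n \<le> ?g n s"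
      by (intro always_eventually allI) (simp add: le_divide_eq left_diff_distrib power_divide)
    show "\<forall>\<^sub>F n in sequentially. ?g n s \<le> s"
      by (intro always_eventually allI) (simp add: divide_le_eq)
  qed simp
  then have "(\<lambda>n. Z (?g n s) \<omega>) \<longlonglongrightarrow> Z s \<omega>"
    using p by (intro continuous_on_tendsto_compose[OF cont]) (auto simp: space_pair_measure)
  then show "(\<lambda>n. (\<lambda>(\<omega>, s). Z (?g n s) \<omega>) p) \<longlonglongrightarrow> (\<lambda>(\<omega>, s). Z s \<omega>) p"
    by simp
qed

text \<open>Dominated convergence: along a sequence of endpoints tending to \<open>t\<close> the
  indicators become eventually constant at every point except \<open>t\<close>, a null set.\<close>

lemma continuous_on_set_lebesgue_integral:
  fixes f :: "real \<Rightarrow> real"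
  assumes int: "\<And>t. 0 \<le> t \<Longrightarrow> set_integrable lborel {0..t} f"
  shows "continuous_on {0..} (\<lambda>t. LBINT s:{0..t}. f s)"
  unfolding continuous_on_sequentially
proof (intro allI ballI impI)
  fix u :: "nat \<Rightarrow> real" and t assume "t \<in> {0..}" and u: "(\<forall>n. u n \<in> {0..}) \<and> u \<longlonglongrightarrow> t"
  then have t0: "0 \<le> t" and u0: "0 \<le> u n" for n
    by auto
  obtain T where T: "\<And>n. u n \<le> T"
    using u convergent_imp_Bseq[of u] by (auto simp: convergent_def Bseq_def abs_le_iff)
  have T0: "0 \<le> T"
    using u0[of 0] T[of 0] by simp
  show "((\<lambda>t. LBINT s:{0..t}. f s) \<circ> u) \<longlonglongrightarrow> (LBINT s:{0..t}. f s)"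
    unfolding o_def set_lebesgue_integral_def
  proof (rule integral_dominated_convergence[where w="\<lambda>s. indicator {0..T} s *\<^sub>R \<bar>f s\<bar>"])
    show "(\<lambda>s. indicat_real {0..t} s *\<^sub>R f s) \<in> borel_measurable lborel"
      using int[OF t0] by (auto simp: set_integrable_def)
    show "(\<lambda>s. indicat_real {0..u n} s *\<^sub>R f s) \<in> borel_measurable lborel" for n
      using int[OF u0[of n]] by (auto simp: set_integrable_def)
    show "integrable lborel (\<lambda>s. indicator {0..T} s *\<^sub>R \<bar>f s\<bar>)"
      using set_integrable_abs[OF int[OF T0]] by (simp add: set_integrable_def)
    have "AE s in lborel. s \<noteq> t"
      by (rule AE_lborel_singleton)
    then show "AE s in lborel. (\<lambda>n. indicat_real {0..u n} s *\<^sub>R f s) \<longlonglongrightarrow> indicat_real {0..t} s *\<^sub>R f s"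
    proof eventually_elim
      case (elim s)
      have "\<forall>\<^sub>F n in sequentially. indicat_real {0..u n} s = indicat_real {0..t} s"
      proof (cases "s < t")
        case True
        then have "\<forall>\<^sub>F n in sequentially. s < u n"
          using u order_tendstoD(1) by blast
        then show ?thesis
          by eventually_elim (use True in \<open>auto simp: indicator_def\<close>)
      next
        case False
        then have "\<forall>\<^sub>F n in sequentially. u n < s"
          using u elim order_tendstoD(2)[of u t sequentially s] by auto
        then show ?thesis
          by eventually_elim (use False elim in \<open>auto simp: indicator_def\<close>)
      qed
      then have "\<forall>\<^sub>F n in sequentially. indicat_real {0..u n} s *\<^sub>R f s = indicat_real {0..t} s *\<^sub>R f s"
        by eventually_elim simp
      then show ?case
        by (rule tendsto_eventually)
    qed
    show "AE s in lborel. norm (indicat_real {0..u n} s *\<^sub>R f s) \<le> indicator {0..T} s *\<^sub>R \<bar>f s\<bar>" for n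
      using T[of n] by (auto simp: indicator_def)
  qed
qed

section \<open>Borel measurability of the radial drift coefficient\<close>

lemma differentiable_powr_const:
  fixes f :: "real \<Rightarrow> real"
  assumes "f differentiable at r" "0 < f r"
  shows "(\<lambda>x. f x powr a) differentiable at r"
proof -
  obtain D where "(f has_real_derivative D) (at r)"
    using assms(1) by (auto simp: real_differentiable_def)
  from DERIV_powr[OF this assms(2) DERIV_const[of a]] show ?thesis
    by (auto simp: real_differentiable_def)
qed

text \<open>\<open>deriv\<close> is a choice operator and carries no measurability in parameters; a
  limit of a sequence of difference quotients does.\<close>

lemma deriv_eq_lim:
  fixes f :: "real \<Rightarrow> real"
  assumes "f differentiable at r"
  shows "deriv f r = lim (\<lambda>n. (f (r + inverse (real (Suc n))) - f r) / inverse (real (Suc n)))"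
proof -
  have "(f has_real_derivative deriv f r) (at r)"
    using assms DERIV_imp_deriv by (auto simp: real_differentiable_def)
  then have "((\<lambda>h. (f (r + h) - f r) / h) \<longlongrightarrow> deriv f r) (at 0)"
    by (simp add: DERIV_def)
  moreover have "filterlim (\<lambda>n. inverse (real (Suc n))) (at 0) sequentially"
    using LIMSEQ_inverse_real_of_nat by (simp add: filterlim_at)
  ultimately have "(\<lambda>n. (f (r + inverse (real (Suc n))) - f r) / inverse (real (Suc n))) \<longlonglongrightarrow> deriv f r"
    by (rule filterlim_compose)
  then show ?thesis
    by (simp add: limI)
qed

text \<open>Inside the support both derivatives can be computed or approximated from closed formulas
  built from \<open>powr\<close>, which are jointly measurable in time and radius.\<close>

lemma bb_ar_measurable:
  assumes p: "1 < p" and m: "0 < m" and mp: "m * (p - 1) > 1"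
  shows "(\<lambda>(t, r). bb_ar d p m t r) \<in> borel_measurable (borel \<Otimes>\<^sub>M borel)"
proof -
  define \<beta> \<gamma> \<kappa> C \<rho> e where "\<beta> = bb_beta d p m" and "\<gamma> = bb_gamma p m" and "\<kappa> = bb_kappa d p m"
    and "C = bb_C d p m" and "\<rho> = bb_rho d p m" and "e = p / (p - 1)"
  note defs = \<beta>_def \<gamma>_def \<kappa>_def C_def \<rho>_def e_def
  have \<beta>: "0 < \<beta>"
    using p mp by (simp add: \<beta>_def bb_beta_def add_pos_nonneg)
  have \<gamma>: "0 < \<gamma>"
    using p mp by (simp add: \<gamma>_def bb_gamma_def)
  have \<kappa>: "0 < \<kappa>"
    using p m mp \<beta> by (simp add: \<kappa>_def bb_kappa_def \<beta>_def)
  have e: "0 < e"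
    using p by (simp add: e_def)
  define S where "S t r = C - \<kappa> * (t powr (- 1 / \<beta>) * r) powr e" for t r
  have U: "bb_U d p m t r = t powr (- real d / \<beta>) * max (S t r) 0 powr \<gamma>" for t r
    by (simp add: bb_U_def bb_profile_def S_def Let_def defs)
  show ?thesis
  proof (cases "0 < C")
    \<comment> \<open>\<open>C\<close> is a definite description whose existence is not established here, so its sign is unknown.\<close>
    case False
    have "S t r \<le> 0" for t r
    proof -
      have "0 \<le> \<kappa> * (t powr (- 1 / \<beta>) * r) powr e"
        using \<kappa> by simp
      then show ?thesis
        using False unfolding S_def by linarith
    qed
    then have "bb_a d p m t r = 0" for t r
      by (simp add: bb_a_def U max_absorb2)
    then have "bb_a d p m t = (\<lambda>_. 0)" for t
      by auto
    then have "bb_ar d p m t r = 0" for t r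
      by (simp add: bb_ar_def)
    then show ?thesis
      by simp
  next
    case C: True
    \<comment> \<open>Strict positivity of all bases inside the support; there every
      \<open>powr\<close> occurring below is differentiable, whatever its exponent.\<close>
    have region: "0 < t powr (- 1 / \<beta>) \<and> 0 < t powr (- real d / \<beta>) \<and> 0 < S t r"
      if r: "0 < r" "r < \<rho> * t powr (1 / \<beta>)" for t r
    proof -
      \<comment> \<open>A \<open>powr\<close> with base 0 is 0, so the region is empty at
        \<open>t = 0\<close>. For all other \<open>t\<close>, even negative ones,
        \<open>powr\<close> is positive, so the argument covers the whole time axis.\<close>
      have t: "t \<noteq> 0"
        using r by auto
      then have c: "0 < t powr (- 1 / \<beta>)"
        by simp
      have "t powr (- 1 / \<beta>) * r < t powr (- 1 / \<beta>) * (\<rho> * t powr (1 / \<beta>))"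
        using c r(2) by simp
      also have "\<dots> = \<rho>"
        using t by (simp add: powr_minus)
      finally have "(t powr (- 1 / \<beta>) * r) powr e < \<rho> powr e"
        using c r(1) e by (intro powr_less_mono2) auto
      also have "\<rho> powr e = C / \<kappa>"
        using C \<kappa> p by (simp add: \<rho>_def bb_rho_def e_def powr_powr flip: C_def \<kappa>_def)
      finally show ?thesis
        using c t \<kappa> by (simp add: S_def field_simps)
    qed
    \<comment> \<open>\<open>v\<close> is minus the radial derivative of the profile, by the chain
      rule, and \<open>g\<close> is the coefficient \<open>bb_a\<close> with \<open>v\<close> as the
      absolute value of that derivative.\<close>
    define v where "v t r = t powr (- real d / \<beta>) * (\<gamma> * \<kappa> * e * t powr (- 1 / \<beta>)) *
        S t r powr (\<gamma> - 1) * (t powr (- 1 / \<beta>) * r) powr (e - 1)" for t r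
    define g where "g t r = m powr (p - 1) * v t r powr (p - 2) *
        (t powr (- real d / \<beta>) * S t r powr \<gamma>) powr ((m - 1) * (p - 1))" for t r
    have near: "\<forall>\<^sub>F r' in nhds r. 0 < r' \<and> r' < \<rho> * t powr (1 / \<beta>)"
      if "0 < r" "r < \<rho> * t powr (1 / \<beta>)" for t r
      using eventually_nhds_in_open[of "{0<..<\<rho> * t powr (1 / \<beta>)}" r] that by simp
    have a_eq: "bb_a d p m t r = g t r" if r: "0 < r" "r < \<rho> * t powr (1 / \<beta>)" for t r
    proof -
      note pos = region[OF r]
      have "((\<lambda>r. t powr (- real d / \<beta>) * S t r powr \<gamma>) has_real_derivative - v t r) (at r)"
      proof -
        let ?k = "t powr (- 1 / \<beta>)"
        have "((\<lambda>r. ?k * r) has_real_derivative ?k) (at r)"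
          using DERIV_cmult[OF DERIV_ident] by simp
        moreover have "((\<lambda>z. z powr e) has_real_derivative e * (?k * r) powr (e - 1)) (at (?k * r))"
          using pos r by (intro has_real_derivative_powr) simp
        ultimately have "((\<lambda>r. (?k * r) powr e) has_real_derivative e * (?k * r) powr (e - 1) * ?k) (at r)"
          by (rule DERIV_chain2[rotated])
        then have "((\<lambda>r. C - \<kappa> * (?k * r) powr e) has_real_derivative
            0 - \<kappa> * (e * (?k * r) powr (e - 1) * ?k)) (at r)"
          by (intro DERIV_diff DERIV_const DERIV_cmult)
        moreover have "((\<lambda>z. z powr \<gamma>) has_real_derivative \<gamma> * S t r powr (\<gamma> - 1)) (at (C - \<kappa> * (?k * r) powr e))"
          using pos unfolding S_def by (intro has_real_derivative_powr) simp
        ultimately have "((\<lambda>r. (C - \<kappa> * (?k * r) powr e) powr \<gamma>) has_real_derivative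
            \<gamma> * S t r powr (\<gamma> - 1) * (0 - \<kappa> * (e * (?k * r) powr (e - 1) * ?k))) (at r)"
          by (rule DERIV_chain2[rotated])
        from DERIV_cmult[OF this, of "t powr (- real d / \<beta>)"] show ?thesis
          by (simp add: S_def v_def mult_ac)
      qed
      moreover have "\<forall>\<^sub>F r' in nhds r. bb_U d p m t r' = t powr (- real d / \<beta>) * S t r' powr \<gamma>"
        using near[OF r]
      proof eventually_elim
        case (elim r')
        then show ?case
          using region[of r' t] by (simp add: U)
      qed
      ultimately have "deriv (bb_U d p m t) r = - v t r"
        using deriv_cong_ev DERIV_imp_deriv by metis
      moreover have "0 < v t r"
        using pos r \<gamma> \<kappa> e by (simp add: v_def)
      ultimately show ?thesis
        using r pos by (simp add: bb_a_def g_def U \<rho>_def \<beta>_def)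
    qed
    \<comment> \<open>The quotients are formed with \<open>g\<close>, an explicit expression, and
      not with \<open>bb_a\<close>, which itself contains \<open>deriv\<close>. The two agree near
      \<open>r\<close> because the region is open in the radius.\<close>
    have ar_eq: "bb_ar d p m t r =
        lim (\<lambda>n. (g t (r + inverse (real (Suc n))) - g t r) / inverse (real (Suc n)))"
      if r: "0 < r" "r < \<rho> * t powr (1 / \<beta>)" for t r
    proof -
      note pos = region[OF r]
      have v: "0 < v t r"
        using pos r \<gamma> \<kappa> e by (simp add: v_def)
      have Sd: "S t differentiable at r"
        unfolding S_def using pos r
        by (intro differentiable_diff differentiable_mult differentiable_const differentiable_powr_const
            differentiable_ident) auto
      have "v t differentiable at r"
        unfolding v_def using pos r Sd
        by (intro differentiable_mult differentiable_const differentiable_powr_const differentiable_ident) auto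
      then have "g t differentiable at r"
        unfolding g_def using pos r v Sd
        by (intro differentiable_mult differentiable_const differentiable_powr_const) auto
      then have "deriv (g t) r = lim (\<lambda>n. (g t (r + inverse (real (Suc n))) - g t r) / inverse (real (Suc n)))"
        by (rule deriv_eq_lim)
      moreover have "deriv (bb_a d p m t) r = deriv (g t) r"
      proof (rule deriv_cong_ev[OF _ refl])
        show "\<forall>\<^sub>F r' in nhds r. bb_a d p m t r' = g t r'"
          using near[OF r] by eventually_elim (simp add: a_eq)
      qed
      ultimately show ?thesis
        using r by (simp add: bb_ar_def \<rho>_def \<beta>_def)
    qed
    have "(\<lambda>(t, r). bb_ar d p m t r) = (\<lambda>q. if 0 < snd q \<and> snd q < \<rho> * fst q powr (1 / \<beta>)
        then lim (\<lambda>n. (g (fst q) (snd q + inverse (real (Suc n))) - g (fst q) (snd q)) / inverse (real (Suc n)))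
        else 0)"
      by (auto simp: fun_eq_iff ar_eq) (auto simp: bb_ar_def \<rho>_def \<beta>_def)
    also have "\<dots> \<in> borel_measurable (borel \<Otimes>\<^sub>M borel)"
    proof (intro measurable_If borel_measurable_lim_metric)
      show "(\<lambda>q. (g (fst q) (snd q + inverse (real (Suc n))) - g (fst q) (snd q)) / inverse (real (Suc n)))
          \<in> borel_measurable (borel \<Otimes>\<^sub>M borel)" for n
        unfolding g_def v_def S_def by measurable
    qed measurable
    finally show ?thesis .
  qed
qed

text \<open>Reduction to \<open>martingale_plus_drift\<close>, with \<open>A\<close> the integral of
  \<open>\<bar>c\<bar>\<close> along the path. Of the drift only joint measurability of
  \<open>c\<close> and the expectation bound \<open>fin\<close> are used.\<close>

theorem (in stochastic_basis) semimartingale_norm_ito_process: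
  fixes X W I :: "real \<Rightarrow> 'w \<Rightarrow> 'a::euclidean_space" and c :: "real \<Rightarrow> 'a \<Rightarrow> real" and x q :: 'a
  assumes X: "adapted F X" "continuous_process M X"
    and W: "brownian_motion M F W" and I: "ito_integral M F W H I"
    and c[measurable]: "(\<lambda>(t, y). c t y) \<in> borel_measurable (borel \<Otimes>\<^sub>M borel)"
    and fin: "\<And>t. 0 < t \<Longrightarrow> (\<integral>\<^sup>+\<omega>. (\<integral>\<^sup>+s\<in>{0..t}. ennreal \<bar>c s (X s \<omega>)\<bar> \<partial>lborel) \<partial>M) < \<infinity>"
    and eq: "AE \<omega> in M. \<forall>t\<ge>0. X t \<omega> = X 0 \<omega> + I t \<omega> + (LBINT s:{0..t}. c s (X s \<omega>) *\<^sub>R sgn (X s \<omega> - x))"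
  shows "semimartingale M F (\<lambda>t \<omega>. norm (X t \<omega> - q))"
proof -
  define \<psi> where "\<psi> t \<omega> = (\<integral>\<^sup>+s\<in>{0..t}. ennreal \<bar>c s (X s \<omega>)\<bar> \<partial>lborel)" for t \<omega>
  \<comment> \<open>The path frozen outside \<open>[0, t]\<close>: continuous on the whole line and
    measurable for \<open>F t\<close> at every time, which gives joint measurability with respect to
    \<open>F t\<close> instead of only \<open>M\<close>.\<close>
  define Z where "Z t s = X (max 0 (min s t))" for t s
  have Z_m: "(\<lambda>(\<omega>, s). Z t s \<omega>) \<in> borel_measurable (F t \<Otimes>\<^sub>M lborel)" if t: "0 \<le> t" for t
  proof -
    have "(\<lambda>(\<omega>, s). Z t s \<omega>) \<in> borel_measurable (F t \<Otimes>\<^sub>M borel)"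
    proof (rule measurable_continuous_process)
      show "Z t s \<in> borel_measurable (F t)" for s
        unfolding Z_def using t by (intro adapted_measurable_F X(1)) auto
      show "continuous_on UNIV (\<lambda>s. Z t s \<omega>)" if "\<omega> \<in> space (F t)" for \<omega>
      proof -
        have "continuous_on {0..} (\<lambda>s. X s \<omega>)"
          using X(2) that by (simp add: continuous_process_def space_F)
        then show ?thesis
          unfolding Z_def by (rule continuous_on_compose2) (auto intro!: continuous_intros)
      qed
    qed
    then show ?thesis
      by (subst measurable_cong_sets[OF sets_pair_measure_cong[OF refl sets_lborel] refl])
  qed
  have XZ: "indicator {0..t} s * c s (X s \<omega>) = indicator {0..t} s * c s (Z t s \<omega>)" for s t \<omega>
    by (auto simp: Z_def indicator_def)
  have c_m: "(\<lambda>(\<omega>, s). indicator {0..t} s * c s (X s \<omega>)) \<in> borel_measurable (F t \<Otimes>\<^sub>M lborel)" if t: "0 \<le> t" for t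
  proof -
    have [measurable]: "(\<lambda>p. Z t (snd p) (fst p)) \<in> borel_measurable (F t \<Otimes>\<^sub>M lborel)"
      using Z_m[OF t] by (simp add: case_prod_beta')
    have [measurable]: "snd \<in> F t \<Otimes>\<^sub>M lborel \<rightarrow>\<^sub>M (borel :: real measure)"
      using measurable_snd[of "F t" lborel] by simp
    have "(\<lambda>p. (snd p, Z t (snd p) (fst p))) \<in> F t \<Otimes>\<^sub>M lborel \<rightarrow>\<^sub>M borel \<Otimes>\<^sub>M borel"
      by measurable
    from measurable_compose[OF this c]
    have [measurable]: "(\<lambda>p. c (snd p) (Z t (snd p) (fst p))) \<in> borel_measurable (F t \<Otimes>\<^sub>M lborel)"
      by simp
    have "(\<lambda>p. indicator {0..t} (snd p) * c (snd p) (Z t (snd p) (fst p))) \<in> borel_measurable (F t \<Otimes>\<^sub>M lborel)"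
      by measurable
    then show ?thesis
      by (simp add: XZ case_prod_beta')
  qed
  have \<psi>_alt: "\<psi> t \<omega> = (\<integral>\<^sup>+s. ennreal \<bar>indicator {0..t} s * c s (X s \<omega>)\<bar> \<partial>lborel)" for t \<omega>
    unfolding \<psi>_def by (intro nn_integral_cong) (auto simp: indicator_def)
  have \<psi>_m: "\<psi> t \<in> borel_measurable M" if t: "0 \<le> t" for t
  proof -
    have "(\<lambda>(\<omega>, s). ennreal \<bar>indicator {0..t} s * c s (X s \<omega>)\<bar>) \<in> borel_measurable (F t \<Otimes>\<^sub>M lborel)"
      using measurable_compose[OF c_m[OF t], of "\<lambda>y. ennreal \<bar>y\<bar>" borel] by (simp add: case_prod_beta')
    then have "\<psi> t \<in> borel_measurable (F t)"
      unfolding \<psi>_alt[abs_def] by (rule lborel.borel_measurable_nn_integral)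
    then show ?thesis
      using t by (rule measurable_F_imp)
  qed
  \<comment> \<open>One null set for all times: finiteness at positive integers suffices since
    \<open>\<psi>\<close> increases in time, and \<open>Suc\<close> is there because
    \<open>fin\<close> concerns positive times.\<close>
  have "AE \<omega> in M. \<forall>n. \<psi> (real (Suc n)) \<omega> \<noteq> \<infinity>"
    unfolding AE_all_countable
  proof
    fix n
    show "AE \<omega> in M. \<psi> (real (Suc n)) \<omega> \<noteq> \<infinity>"
      using fin[of "real (Suc n)"] unfolding \<psi>_def[symmetric]
      by (intro nn_integral_noteq_infinite \<psi>_m) auto
  qed
  with eq have "AE \<omega> in M. (\<forall>n. \<psi> (real (Suc n)) \<omega> \<noteq> \<infinity>) \<and>
      (\<forall>t\<ge>0. X t \<omega> = X 0 \<omega> + I t \<omega> + (LBINT s:{0..t}. c s (X s \<omega>) *\<^sub>R sgn (X s \<omega> - x)))"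
    by eventually_elim blast
  then obtain G where G: "G \<subseteq> space M" "\<And>t. 0 \<le> t \<Longrightarrow> G \<in> sets (F t)" "AE \<omega> in M. \<omega> \<in> G"
    and G_fin: "\<And>\<omega> n. \<omega> \<in> G \<Longrightarrow> \<psi> (real (Suc n)) \<omega> \<noteq> \<infinity>"
    and G_eq: "\<And>\<omega> t. \<omega> \<in> G \<Longrightarrow> 0 \<le> t \<Longrightarrow>
      X t \<omega> = X 0 \<omega> + I t \<omega> + (LBINT s:{0..t}. c s (X s \<omega>) *\<^sub>R sgn (X s \<omega> - x))"
    by (rule AE_full_set) blast
  have \<psi>_mono: "\<psi> s \<omega> \<le> \<psi> t \<omega>" if "s \<le> t" for s t \<omega>
    unfolding \<psi>_def using that by (intro nn_integral_mono) (auto simp: indicator_def)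
  have c_section: "(\<lambda>s. indicator {0..t} s * c s (X s \<omega>)) \<in> borel_measurable lborel"
    if "\<omega> \<in> space M" "0 \<le> t" for \<omega> t
    using measurable_compose[OF measurable_Pair1' c_m[OF that(2)], of \<omega>] that(1) by (simp add: space_F)
  have c_int: "set_integrable lborel {0..t} (\<lambda>s. c s (X s \<omega>))" if \<omega>: "\<omega> \<in> G" and t: "0 \<le> t" for \<omega> t
    unfolding set_integrable_def
  proof (rule integrableI_bounded)
    show "(\<lambda>s. indicat_real {0..t} s *\<^sub>R c s (X s \<omega>)) \<in> borel_measurable lborel"
      using c_section[of \<omega> t] \<omega> t G(1) by auto
    obtain n where n: "t \<le> real n"
      using real_arch_simple by blast
    have "(\<integral>\<^sup>+s. ennreal (norm (indicat_real {0..t} s *\<^sub>R c s (X s \<omega>))) \<partial>lborel) = \<psi> t \<omega>"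
      unfolding \<psi>_alt by simp
    also have "\<dots> \<le> \<psi> (real (Suc n)) \<omega>"
      using n by (intro \<psi>_mono) simp
    also have "\<dots> < \<infinity>"
      using G_fin[OF \<omega>, of n] by (simp add: less_top)
    finally show "(\<integral>\<^sup>+s. ennreal (norm (indicat_real {0..t} s *\<^sub>R c s (X s \<omega>))) \<partial>lborel) < \<infinity>" .
  qed
  note abs_int = set_integrable_abs[OF c_int]
  \<comment> \<open>Off \<open>G\<close> the integrand may fail to be integrable, and its integral
    would default to 0 from some time on, which destroys monotonicity; the value 0 on the whole path
    avoids this.\<close>
  define A where "A t \<omega> = (if \<omega> \<in> G then LBINT s:{0..t}. \<bar>c s (X s \<omega>)\<bar> else 0)" for t \<omega>
  have split: "(LBINT r:{0..t}. f r) - (LBINT r:{0..s}. f r) = (LBINT r:{s<..t}. f r)"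
    and sub: "set_integrable lborel {s<..t} f"
    if "0 \<le> s" "s \<le> t" "set_integrable lborel {0..t} f"
    for s t and f :: "real \<Rightarrow> 'b::{banach, second_countable_topology}"
  proof -
    show i: "set_integrable lborel {s<..t} f"
      by (rule set_integrable_subset[OF that(3)]) (use that in auto)
    have "set_integrable lborel {0..s} f"
      by (rule set_integrable_subset[OF that(3)]) (use that in auto)
    moreover have "{0..t} = {0..s} \<union> {s<..t}" "{0..s} \<inter> {s<..t} = {}"
      using that by auto
    ultimately show "(LBINT r:{0..t}. f r) - (LBINT r:{0..s}. f r) = (LBINT r:{s<..t}. f r)"
      using i by (simp add: set_integral_Un)
  qed
  have A_nonneg: "0 \<le> (LBINT s:B. \<bar>c s (X s \<omega>)\<bar>)" for B \<omega>
    unfolding set_lebesgue_integral_def by (intro integral_nonneg_AE) (auto simp: indicator_def)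
  have "martingale_plus_drift M F X I A"
  proof (unfold_locales)
    show "adapted F X" "continuous_process M X"
      by fact+
    show "sq_martingale M F (\<lambda>t \<omega>. I t \<omega> \<bullet> b)" if "b \<in> Basis" for b
      by (rule ito_integral_sq_martingale[OF W that I])
    show "adapted F A"
      unfolding adapted_def
    proof (intro allI impI)
      fix t :: real assume t: "0 \<le> t"
      have "(\<lambda>(\<omega>, s). indicator {0..t} s *\<^sub>R \<bar>c s (X s \<omega>)\<bar>) = (\<lambda>p. \<bar>(\<lambda>(\<omega>, s). indicator {0..t} s * c s (X s \<omega>)) p\<bar>)"
        by (auto simp: fun_eq_iff abs_mult)
      also have "\<dots> \<in> borel_measurable (F t \<Otimes>\<^sub>M lborel)"
        using c_m[OF t] by (rule borel_measurable_abs)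
      finally have "(\<lambda>\<omega>. LBINT s:{0..t}. \<bar>c s (X s \<omega>)\<bar>) \<in> borel_measurable (F t)"
        unfolding set_lebesgue_integral_def by (rule lborel.borel_measurable_lebesgue_integral)
      then show "A t \<in> borel_measurable (F t)"
        unfolding A_def[abs_def] using G(2)[OF t] by (intro measurable_If_set) auto
    qed
    show "continuous_process M A"
      unfolding continuous_process_def
    proof
      fix \<omega>
      show "continuous_on {0..} (\<lambda>t. A t \<omega>)"
        unfolding A_def
        by (cases "\<omega> \<in> G") (auto intro!: continuous_on_set_lebesgue_integral abs_int)
    qed
    show "A s \<omega> \<le> A t \<omega>" if "0 \<le> s" "s \<le> t" for \<omega> s t
    proof (cases "\<omega> \<in> G")
      case True
      have "0 \<le> t"
        using that by simp
      then show ?thesis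
        using split[OF that abs_int[OF True]] A_nonneg[of "{s<..t}" \<omega>] True by (simp add: A_def)
    qed (simp add: A_def)
    show "A 0 \<omega> = 0" for \<omega>
    proof -
      have "(LBINT s:{0..0}. \<bar>c s (X s \<omega>)\<bar>) = 0"
        unfolding set_lebesgue_integral_def
        by (rule integral_eq_zero_AE, use AE_lborel_singleton[of 0] in eventually_elim) simp
      then show ?thesis
        by (simp add: A_def)
    qed
    show "AE \<omega> in M. \<forall>s\<ge>0. \<forall>t\<ge>s. norm ((X t \<omega> - I t \<omega>) - (X s \<omega> - I s \<omega>)) \<le> A t \<omega> - A s \<omega>"
      using G(3)
    proof eventually_elim
      case (elim \<omega>)
      show ?case
      proof (intro allI impI)
        fix s t :: real assume st: "0 \<le> s" "s \<le> t"
        let ?f = "\<lambda>r. c r (X r \<omega>) *\<^sub>R sgn (X r \<omega> - x)"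
        have t: "0 \<le> t"
          using st by simp
        have f: "set_integrable lborel {0..t} ?f"
        proof -
          have "continuous_on {0..t} (\<lambda>r. X r \<omega>)"
            using X(2) elim G(1)
            by (auto simp: continuous_process_def intro!: continuous_on_subset[of "{0..}" _ "{0..t}"])
          then have [measurable]: "(\<lambda>r. indicator {0..t} r *\<^sub>R X r \<omega>) \<in> borel_measurable borel"
            by (rule borel_measurable_continuous_on_indicator[rotated]) simp
          have [measurable]: "(\<lambda>r. indicator {0..t} r * c r (X r \<omega>)) \<in> borel_measurable borel"
            using c_section[of \<omega> t] elim G(1) t by auto
          \<comment> \<open>The path is cut off inside \<open>sgn\<close> too, because it is known
            to be measurable only on \<open>[0, t]\<close>. Outside this interval the first factor
            vanishes, so the product is unchanged.\<close>
          have "(\<lambda>r. (indicator {0..t} r * c r (X r \<omega>)) *\<^sub>R sgn (indicator {0..t} r *\<^sub>R X r \<omega> - x))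
              \<in> borel_measurable lborel"
            unfolding sgn_div_norm by measurable
          moreover have "(\<lambda>r. (indicator {0..t} r * c r (X r \<omega>)) *\<^sub>R sgn (indicator {0..t} r *\<^sub>R X r \<omega> - x))
              = (\<lambda>r. indicator {0..t} r *\<^sub>R ?f r)"
            by (auto simp: indicator_def)
          ultimately have "set_borel_measurable lborel {0..t} ?f"
            by (simp add: set_borel_measurable_def)
          from set_integrable_bound[OF abs_int[OF elim t] this] show ?thesis
            by (auto simp: norm_sgn)
        qed
        have "(X t \<omega> - I t \<omega>) - (X s \<omega> - I s \<omega>) = (LBINT r:{0..t}. ?f r) - (LBINT r:{0..s}. ?f r)"
          using G_eq[OF elim t] G_eq[OF elim st(1)] by simp
        also have "\<dots> = (LBINT r:{s<..t}. ?f r)"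
          by (rule split[OF st f])
        finally have "norm ((X t \<omega> - I t \<omega>) - (X s \<omega> - I s \<omega>)) \<le> (LBINT r:{s<..t}. norm (?f r))"
          using set_integral_norm_bound[OF sub[OF st f]] by simp
        also have "\<dots> \<le> (LBINT r:{s<..t}. \<bar>c r (X r \<omega>)\<bar>)"
          by (rule set_integral_mono[OF set_integrable_norm[OF sub[OF st f]] sub[OF st abs_int[OF elim t]]])
            (simp add: norm_sgn)
        also have "\<dots> = A t \<omega> - A s \<omega>"
          using split[OF st abs_int[OF elim t]] elim by (simp add: A_def)
        finally show "norm ((X t \<omega> - I t \<omega>) - (X s \<omega> - I s \<omega>)) \<le> A t \<omega> - A s \<omega>" .
      qed
    qed
  qed
  then show ?thesis
    by (rule martingale_plus_drift.semimartingale_norm)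
qed

theorem corollary1p2:
  fixes p m :: real
    and q x :: "'a::euclidean_space"
    and M :: "'w measure" and F :: "real \<Rightarrow> 'w measure" and X :: "real \<Rightarrow> 'w \<Rightarrow> 'a"
  assumes "1 < p" and "0 < m" and "m * (p - 1) > 1"
    and "real DIM('a) * p > real DIM('a) + 1"
    and "weak_solution p m x M F X"
  shows "semimartingale M F (\<lambda>t \<omega>. norm (X t \<omega> - q))"
proof -
  let ?c = "\<lambda>s y. bb_ar DIM('a) p m s (norm (y - x))"
  note ws = assms(5)[unfolded weak_solution_def]
  interpret stochastic_basis M F
    using ws by blast
  obtain W :: "real \<Rightarrow> 'w \<Rightarrow> 'a" and I where W: "brownian_motion M F W"
    and fin: "\<And>t. 0 < t \<Longrightarrow> (\<integral>\<^sup>+\<omega>. (\<integral>\<^sup>+s\<in>{0..t}. ennreal \<bar>?c s (X s \<omega>)\<bar> \<partial>lborel) \<partial>M) < \<infinity>"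
    and I: "ito_integral M F W (\<lambda>s \<omega>. sqrt (2 * bb_a DIM('a) p m s (norm (X s \<omega> - x)))) I"
    and eq: "AE \<omega> in M. \<forall>t\<ge>0. X t \<omega> = X 0 \<omega> + I t \<omega> +
        (LBINT s:{0..t}. ?c s (X s \<omega>) *\<^sub>R sgn (X s \<omega> - x))"
    using ws by blast
  have "(\<lambda>q. (fst q, norm (snd q - x))) \<in> borel \<Otimes>\<^sub>M borel \<rightarrow>\<^sub>M borel \<Otimes>\<^sub>M borel"
    by measurable
  from measurable_compose[OF this bb_ar_measurable[OF assms(1-3), of "DIM('a)"]]
  have c: "(\<lambda>(s, y). ?c s y) \<in> borel_measurable (borel \<Otimes>\<^sub>M borel)"
    by (simp add: case_prod_beta')
  show ?thesis
    by (rule semimartingale_norm_ito_process[OF _ _ W I c fin eq]) (use ws in auto)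
qed

end
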